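(* Let $F:\mathcal S\to\mathbb R$ be concave and satisfy hypotheses (i) and (ii) of the context, let $S\subset\mathbb S^{n-1}$ be a domain in the unit sphere such that $\partial S$ is smooth, and for $t>0$ let $\mathcal K_t=\{x=r\sigma:\ \sigma\in S,\ 0<r<t\}$. Let $\kappa>0$ and $\phi\in C^\infty(\overline S)$ satisfy $F(D^2(r^\kappa\phi(\sigma)))=0$ in $\mathcal K_1$, $\phi=0$ on $\partial S$, $\phi>0$ in $S$, where $r=|x|$, $\sigma=x/|x|$, and normalize $\phi$ so that $\max_{\overline S}\phi=1$. Let $u\ge0$, $u\not\equiv0$, be a viscosity solution of $F(D^2u)=0$ in $\mathcal K_1$, continuous up to the lateral boundary $\{r\sigma:\sigma\in\partial S,\ 0\le r<1\}$ and vanishing there. Then for every sequence $\{R_k\}_{k=1}^\infty$ with $R_k\downarrow0$ there exists a subsequence $R_{k_j}$ such that the functions $$u_j(x)=\frac{u(R_{k_j}x)}{M(R_{k_j})},\qquad M(R)=\sup_{\mathcal K_1\cap B_R}u,$$ converge locally uniformly in $\mathcal K_1$ to $r^\kappa\phi(\sigma)$.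
   Context: $\mathcal S$ is the space of real symmetric $n\times n$ matrices. Hypotheses on $F:\mathcal S\to\mathbb R$: (i) (uniform ellipticity) there are constants $\lambda,\Lambda>0$ such that $\lambda\|N\|\le F(M+N)-F(M)\le\Lambda\|N\|$ for all $M\in\mathcal S$ and all nonnegative $N\in\mathcal S$, where $\|\cdot\|$ is the matrix norm; (ii) $F$ is smooth except at the origin, homogeneous of degree one, $F(tM)=tF(M)$ for $t\in\mathbb R$, and $F(0)=0$. $\mathbb S^{n-1}$ is the unit sphere of $\mathbb R^n$, $\partial S$ and $\overline S$ are the boundary and closure of $S$ relative to $\mathbb S^{n-1}$, and $B_r$ is the open ball of radius $r$ centered at $0$. Solutions of $F(D^2u)=0$ are understood in the standard viscosity sense. *)

theory Defs
  imports "HOL-Analysis.Analysis"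
begin

section \<open>Smooth functions\<close>

text \<open>\<open>Ck_on k V U f\<close>: \<open>f\<close> is \<open>k\<close> times continuously differentiable on \<open>U\<close>, where \<open>U\<close> is a relatively open
  subset of the finite-dimensional linear subspace \<open>V\<close>. Derivatives are taken within \<open>V\<close>; they are
  determined by \<open>f\<close> in the directions of \<open>V\<close>, which are the only ones that are used. For functions on
  the whole space take \<open>V = UNIV\<close>.\<close>

primrec Ck_on :: "nat \<Rightarrow> 'a::real_normed_vector set \<Rightarrow> 'a set \<Rightarrow> ('a \<Rightarrow> real) \<Rightarrow> bool" where
  "Ck_on 0 V U f \<longleftrightarrow> continuous_on U f"
| "Ck_on (Suc k) V U f \<longleftrightarrow>
     (\<exists>D. (\<forall>x\<in>U. (f has_derivative D x) (at x within V)) \<and> (\<forall>v\<in>V. Ck_on k V U (\<lambda>x. D x v)))"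

definition smooth_on :: "'a::real_normed_vector set \<Rightarrow> 'a set \<Rightarrow> ('a \<Rightarrow> real) \<Rightarrow> bool" where
  "smooth_on V U f \<longleftrightarrow> (\<forall>k. Ck_on k V U f)"

text \<open>Smoothness on an arbitrary set, e.g. up to the boundary: existence of a smooth extension to an
  open neighbourhood in the ambient space.\<close>

definition smooth_up_to :: "'a::real_normed_vector set \<Rightarrow> ('a \<Rightarrow> real) \<Rightarrow> bool" where
  "smooth_up_to A f \<longleftrightarrow>
     (\<exists>U g. open U \<and> A \<subseteq> U \<and> smooth_on UNIV U g \<and> (\<forall>x\<in>A. g x = f x))"

section \<open>Fully nonlinear operators\<close>

definition sym_matrices :: "(real^'n^'n) set" where
  "sym_matrices = {M. transpose M = M}"

definition nonneg_matrix :: "real^'n^'n \<Rightarrow> bool" where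
  "nonneg_matrix N \<longleftrightarrow> (\<forall>x. 0 \<le> x \<bullet> (N *v x))"

text \<open>Operators are total functions on square matrices, but only their values on symmetric
  matrices matter. The matrix norm is the operator norm for the Euclidean norm.\<close>

definition uniformly_elliptic :: "(real^'n^'n \<Rightarrow> real) \<Rightarrow> bool" where
  "uniformly_elliptic F \<longleftrightarrow>
     (\<exists>l L. 0 < l \<and> 0 < L \<and>
        (\<forall>M\<in>sym_matrices. \<forall>N\<in>sym_matrices. nonneg_matrix N \<longrightarrow>
            l * onorm ((*v) N) \<le> F (M + N) - F M \<and>
            F (M + N) - F M \<le> L * onorm ((*v) N)))"

definition homogeneous_degree_one :: "(real^'n^'n \<Rightarrow> real) \<Rightarrow> bool" where
  "homogeneous_degree_one F \<longleftrightarrow> (\<forall>t::real. \<forall>M\<in>sym_matrices. F (t *\<^sub>R M) = t * F M)"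

section \<open>Viscosity solutions\<close>

definition partial :: "'n \<Rightarrow> (real^'n \<Rightarrow> real) \<Rightarrow> real^'n \<Rightarrow> real" where
  "partial i f x = frechet_derivative f (at x) (axis i 1)"

definition hessian :: "(real^'n \<Rightarrow> real) \<Rightarrow> real^'n \<Rightarrow> real^'n^'n" where
  "hessian f x = (\<chi> i j. partial i (partial j f) x)"

text \<open>The signs below are those for operators that are nondecreasing in the Hessian; \<open>\<Omega>\<close> is open.\<close>

definition viscosity_subsolution ::
    "(real^'n^'n \<Rightarrow> real) \<Rightarrow> (real^'n) set \<Rightarrow> (real^'n \<Rightarrow> real) \<Rightarrow> bool" where
  "viscosity_subsolution F \<Omega> u \<longleftrightarrow>
     (\<forall>x0 U \<psi>. open U \<and> x0 \<in> U \<and> U \<subseteq> \<Omega> \<and> Ck_on 2 UNIV U \<psi> \<and>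
        (\<forall>x\<in>U. u x - \<psi> x \<le> u x0 - \<psi> x0) \<longrightarrow> 0 \<le> F (hessian \<psi> x0))"

definition viscosity_supersolution ::
    "(real^'n^'n \<Rightarrow> real) \<Rightarrow> (real^'n) set \<Rightarrow> (real^'n \<Rightarrow> real) \<Rightarrow> bool" where
  "viscosity_supersolution F \<Omega> u \<longleftrightarrow>
     (\<forall>x0 U \<psi>. open U \<and> x0 \<in> U \<and> U \<subseteq> \<Omega> \<and> Ck_on 2 UNIV U \<psi> \<and>
        (\<forall>x\<in>U. u x0 - \<psi> x0 \<le> u x - \<psi> x) \<longrightarrow> F (hessian \<psi> x0) \<le> 0)"

definition viscosity_solution ::
    "(real^'n^'n \<Rightarrow> real) \<Rightarrow> (real^'n) set \<Rightarrow> (real^'n \<Rightarrow> real) \<Rightarrow> bool" where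
  "viscosity_solution F \<Omega> u \<longleftrightarrow>
     continuous_on \<Omega> u \<and> viscosity_subsolution F \<Omega> u \<and> viscosity_supersolution F \<Omega> u"

section \<open>Spherical domains and cones\<close>

abbreviation unit_sphere :: "(real^'n) set" where
  "unit_sphere \<equiv> sphere 0 1"

definition sph_domain :: "(real^'n) set \<Rightarrow> bool" where
  "sph_domain S \<longleftrightarrow> openin (top_of_set unit_sphere) S \<and> connected S \<and> S \<noteq> {}"

definition sph_closure :: "(real^'n) set \<Rightarrow> (real^'n) set" where
  "sph_closure S = (top_of_set unit_sphere) closure_of S"

definition sph_boundary :: "(real^'n) set \<Rightarrow> (real^'n) set" where
  "sph_boundary S = (top_of_set unit_sphere) frontier_of S"

text \<open>Near each boundary point, \<open>S\<close> is the part of the sphere where a smooth function \<open>\<rho>\<close> is positive;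
  the derivative of \<open>\<rho>\<close> does not vanish on the tangent space of the sphere at that point.\<close>

definition smooth_sph_boundary :: "(real^'n) set \<Rightarrow> bool" where
  "smooth_sph_boundary S \<longleftrightarrow>
     (\<forall>p\<in>sph_boundary S. \<exists>U \<rho>. open U \<and> p \<in> U \<and> smooth_on UNIV U \<rho> \<and>
        S \<inter> U = {x \<in> unit_sphere \<inter> U. 0 < \<rho> x} \<and>
        (\<exists>v. v \<bullet> p = 0 \<and> frechet_derivative \<rho> (at p) v \<noteq> 0))"

definition trunc_cone :: "(real^'n) set \<Rightarrow> real \<Rightarrow> (real^'n) set" where
  "trunc_cone S t = {r *\<^sub>R \<sigma> | r \<sigma>. \<sigma> \<in> S \<and> 0 < r \<and> r < t}"

definition lateral_boundary :: "(real^'n) set \<Rightarrow> (real^'n) set" where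
  "lateral_boundary S = {r *\<^sub>R \<sigma> | r \<sigma>. \<sigma> \<in> sph_boundary S \<and> 0 \<le> r \<and> r < 1}"

definition homogeneous_ext :: "real \<Rightarrow> (real^'n \<Rightarrow> real) \<Rightarrow> real^'n \<Rightarrow> real" where
  "homogeneous_ext \<kappa> \<phi> x = norm x powr \<kappa> * \<phi> (x /\<^sub>R norm x)"

definition sup_cone :: "(real^'n) set \<Rightarrow> (real^'n \<Rightarrow> real) \<Rightarrow> real \<Rightarrow> real" where
  "sup_cone S u R = (SUP x \<in> trunc_cone S 1 \<inter> ball 0 R. u x)"

definition converges_locally_uniformly_on ::
    "(real^'n) set \<Rightarrow> (nat \<Rightarrow> real^'n \<Rightarrow> real) \<Rightarrow> (real^'n \<Rightarrow> real) \<Rightarrow> bool" where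
  "converges_locally_uniformly_on \<Omega> f g \<longleftrightarrow>
     (\<forall>K. compact K \<and> K \<subseteq> \<Omega> \<longrightarrow> uniform_limit K f g sequentially)"

end

theory Submission
  imports Defs
begin

text \<open>
  A concave \<open>F\<close> with \<open>F (t M) = t F M\<close> for all real \<open>t\<close>, negative \<open>t\<close> included, is both superadditive
  and odd, hence linear on symmetric matrices: \<open>F M = A \<bullet> M\<close> with \<open>A\<close> positive definite. So \<open>u\<close>
  and \<open>w = r\<^sup>\<kappa> \<phi>(\<sigma>)\<close> solve the same linear equation with constant coefficients, differences of
  a viscosity solution and multiples of the classical solution \<open>w\<close> are again solutions, and it suffices
  to show that the oscillation of \<open>u / w\<close> over \<open>\<K>\<^sub>r\<close> tends to 0 as \<open>r \<rightarrow> 0\<close>, while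
  \<open>u / w\<close> stays between positive bounds. The convergence then holds along the whole sequence.

  If \<open>v\<^sub>1, v\<^sub>2 \<ge> 0\<close> are solutions with sum \<open>w\<close>, at least half of the points of a fine
  grid in a fixed ball carry a lower bound for one of them. Comparison with the sum of the kernels
  \<open>q(x - y)\<^bsup>(1-n)/2\<^esup>\<close>, \<open>q(x) = x \<bullet> A\<^sup>-\<^sup>1 x\<close>, over these grid points (strict subsolutions away
  from \<open>y\<close>, with integrable singularity) bounds this \<open>v\<^sub>i\<close> from below on a ball. Chains of balls and the
  barriers \<open>w (\<eta> + k w)\<close> carry the bound to the lateral boundary, giving \<open>v\<^sub>i \<ge> \<delta> w\<close> on
  \<open>\<K>\<^sub>1\<^sub>/\<^sub>2\<close>. By scaling the oscillation of \<open>u / w\<close> decreases by the factor \<open>1 - \<delta>\<close> with every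
  halving of the radius. The barriers work because \<open>A \<nabla>w \<bullet> \<nabla>w\<close> is bounded below near the lateral
  boundary, by the Hopf lemma for \<open>w\<close>.
\<close>

section \<open>Twice differentiable functions\<close>

text \<open>The grid argument resolves this: its mesh follows the given solutions, but the sum of
  the kernels is a discrete potential of a uniform density, and its bound grows with the number of
  grid points at the same rate as the contribution of the poles, so the mesh drops out of the
  estimate. A second obstacle is that the viscosity definition gives no direct access to the
  difference of two viscosity solutions. Hence \<open>u\<close> is only ever compared with C2
  functions: multiples of \<open>w\<close>, kernels, barriers. Kernels and barriers are strict
  subsolutions, so each comparison reduces to a single touching point. At the lateral boundary the
  strictness comes from the square of \<open>w\<close> (or of a defining function), whose Hessian
  contains the outer product of the gradient with itself; this is why a lower bound on the gradient
  is the decisive input there.\<close>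

definition outer :: "real^'n \<Rightarrow> real^'n \<Rightarrow> real^'n^'n" where
  "outer a b = (\<chi> i j. a $ i * b $ j)"

text \<open>Gradient and Hessian are carried as explicit functions, so that the closure lemmas
  compute \<open>A \<bullet> H x\<close> for composite barriers by rewriting. Only the Hessian needs
  a continuity clause; \<open>f\<close> and \<open>G\<close> are continuous because they are
  differentiable.\<close>

definition C2 ::
    "(real^'n) set \<Rightarrow> (real^'n \<Rightarrow> real) \<Rightarrow> (real^'n \<Rightarrow> real^'n) \<Rightarrow> (real^'n \<Rightarrow> real^'n^'n) \<Rightarrow> bool" where
  "C2 U f G H \<longleftrightarrow>
     (\<forall>x\<in>U. (f has_derivative (\<lambda>h. G x \<bullet> h)) (at x) \<and>
             (G has_derivative (\<lambda>h. H x *v h)) (at x)) \<and> continuous_on U H"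

lemma inner_matrix_sum: "(A::real^'n^'n) \<bullet> B = (\<Sum>i\<in>UNIV. \<Sum>j\<in>UNIV. A$i$j * B$i$j)"
  by (simp add: inner_vec_def)

lemma inner_outer: "A \<bullet> outer a b = a \<bullet> (A *v b)"
  unfolding inner_matrix_sum outer_def matrix_vector_mult_def
  by (simp add: inner_vec_def sum_distrib_left mult_ac)

lemma outer_mult_vec: "outer a b *v h = (b \<bullet> h) *\<^sub>R a"
  by (simp add: vec_eq_iff outer_def matrix_vector_mult_def inner_vec_def sum_distrib_left mult_ac)

lemma continuous_on_outer [continuous_intros]:
  "continuous_on U f \<Longrightarrow> continuous_on U g \<Longrightarrow> continuous_on U (\<lambda>x. outer (f x) (g x))"
  unfolding outer_def by (intro continuous_intros)

lemma outer_in_sym [simp]: "outer a a \<in> sym_matrices"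
  by (simp add: sym_matrices_def outer_def transpose_def vec_eq_iff mult.commute)

lemma C2_D1: "C2 U f G H \<Longrightarrow> x \<in> U \<Longrightarrow> (f has_derivative (\<lambda>h. G x \<bullet> h)) (at x)"
  and C2_D2: "C2 U f G H \<Longrightarrow> x \<in> U \<Longrightarrow> (G has_derivative (\<lambda>h. H x *v h)) (at x)"
  and C2_cont_H: "C2 U f G H \<Longrightarrow> continuous_on U H"
  by (auto simp: C2_def)

lemma C2_cont: "C2 U f G H \<Longrightarrow> continuous_on U f"
  and C2_cont_G: "C2 U f G H \<Longrightarrow> continuous_on U G"
  by (auto simp: C2_def intro!: has_derivative_continuous_on intro: has_derivative_at_withinI)

lemma C2_subset: "C2 U f G H \<Longrightarrow> V \<subseteq> U \<Longrightarrow> C2 V f G H"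
  by (auto simp: C2_def intro: continuous_on_subset)

lemma C2_const: "C2 U (\<lambda>x. c) (\<lambda>x. 0) (\<lambda>x. 0)"
  by (auto simp: C2_def)

lemma C2_add:
  assumes "C2 U f G H" "C2 U f' G' H'"
  shows "C2 U (\<lambda>x. f x + f' x) (\<lambda>x. G x + G' x) (\<lambda>x. H x + H' x)"
  unfolding C2_def
proof (intro conjI ballI)
  fix x assume x: "x \<in> U"
  show "((\<lambda>x. f x + f' x) has_derivative (\<lambda>h. (G x + G' x) \<bullet> h)) (at x)"
    unfolding inner_add_left by (rule has_derivative_add[OF C2_D1[OF assms(1) x] C2_D1[OF assms(2) x]])
  show "((\<lambda>x. G x + G' x) has_derivative (\<lambda>h. (H x + H' x) *v h)) (at x)"
    unfolding matrix_vector_mult_add_rdistrib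
    by (rule has_derivative_add[OF C2_D2[OF assms(1) x] C2_D2[OF assms(2) x]])
qed (intro continuous_intros C2_cont_H[OF assms(1)] C2_cont_H[OF assms(2)])

lemma C2_scale:
  assumes "C2 U f G H"
  shows "C2 U (\<lambda>x. c * f x) (\<lambda>x. c *\<^sub>R G x) (\<lambda>x. c *\<^sub>R H x)"
  unfolding C2_def
proof (intro conjI ballI)
  fix x assume x: "x \<in> U"
  show "((\<lambda>x. c * f x) has_derivative (\<lambda>h. (c *\<^sub>R G x) \<bullet> h)) (at x)"
    unfolding inner_scaleR_left by (rule has_derivative_mult_right[OF C2_D1[OF assms x]])
  show "((\<lambda>x. c *\<^sub>R G x) has_derivative (\<lambda>h. (c *\<^sub>R H x) *v h)) (at x)"
    unfolding scaleR_matrix_vector_assoc[symmetric]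
    by (rule has_derivative_scaleR_right[OF C2_D2[OF assms x]])
qed (intro continuous_intros C2_cont_H[OF assms])

lemma C2_mult:
  assumes "C2 U f G H" "C2 U f' G' H'"
  shows "C2 U (\<lambda>x. f x * f' x) (\<lambda>x. f x *\<^sub>R G' x + f' x *\<^sub>R G x)
     (\<lambda>x. f x *\<^sub>R H' x + f' x *\<^sub>R H x + outer (G x) (G' x) + outer (G' x) (G x))"
proof -
  have c: "continuous_on U f" "continuous_on U f'" "continuous_on U G" "continuous_on U G'"
    using assms C2_cont C2_cont_G by blast+
  show ?thesis
    unfolding C2_def
  proof (intro conjI ballI)
    fix x assume x: "x \<in> U"
    note d = C2_D1[OF assms(1) x] C2_D2[OF assms(1) x] C2_D1[OF assms(2) x] C2_D2[OF assms(2) x]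
    show "((\<lambda>x. f x * f' x) has_derivative (\<lambda>h. (f x *\<^sub>R G' x + f' x *\<^sub>R G x) \<bullet> h)) (at x)"
      by (rule has_derivative_eq_rhs[OF has_derivative_mult[OF d(1) d(3)]])
        (auto simp: inner_add_left algebra_simps)
    show "((\<lambda>x. f x *\<^sub>R G' x + f' x *\<^sub>R G x) has_derivative
        (\<lambda>h. (f x *\<^sub>R H' x + f' x *\<^sub>R H x + outer (G x) (G' x) + outer (G' x) (G x)) *v h)) (at x)"
      by (rule has_derivative_eq_rhs[OF has_derivative_add[OF has_derivative_scaleR[OF d(1) d(4)] has_derivative_scaleR[OF d(3) d(2)]]])
        (auto simp: matrix_vector_mult_add_rdistrib outer_mult_vec scaleR_matrix_vector_assoc)
  next
    show "continuous_on U (\<lambda>x. f x *\<^sub>R H' x + f' x *\<^sub>R H x + outer (G x) (G' x) + outer (G' x) (G x))"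
      using c assms by (auto intro!: continuous_intros simp: C2_def)
  qed
qed

lemma C2_compose_real:
  assumes "C2 U f G H"
    and d1: "\<And>x. x \<in> U \<Longrightarrow> (p has_real_derivative p1 (f x)) (at (f x))"
    and d2: "\<And>x. x \<in> U \<Longrightarrow> (p1 has_real_derivative p2 (f x)) (at (f x))"
    and c2: "continuous_on U (\<lambda>x. p2 (f x))"
  shows "C2 U (\<lambda>x. p (f x)) (\<lambda>x. p1 (f x) *\<^sub>R G x)
     (\<lambda>x. p1 (f x) *\<^sub>R H x + p2 (f x) *\<^sub>R outer (G x) (G x))"
proof -
  have dp: "((\<lambda>x. p (f x)) has_derivative (\<lambda>h. p1 (f x) * (G x \<bullet> h))) (at x)"
    "((\<lambda>x. p1 (f x)) has_derivative (\<lambda>h. p2 (f x) * (G x \<bullet> h))) (at x)" if "x \<in> U" for x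
    using has_derivative_compose[OF C2_D1[OF assms(1) that] d1[OF that, unfolded has_field_derivative_def]]
      has_derivative_compose[OF C2_D1[OF assms(1) that] d2[OF that, unfolded has_field_derivative_def]]
    by (simp_all add: mult.commute)
  show ?thesis
    unfolding C2_def
  proof (intro conjI ballI)
    fix x assume x: "x \<in> U"
    show "((\<lambda>x. p (f x)) has_derivative (\<lambda>h. (p1 (f x) *\<^sub>R G x) \<bullet> h)) (at x)"
      using dp(1)[OF x] by simp
    show "((\<lambda>x. p1 (f x) *\<^sub>R G x) has_derivative
        (\<lambda>h. (p1 (f x) *\<^sub>R H x + p2 (f x) *\<^sub>R outer (G x) (G x)) *v h)) (at x)"
      by (rule has_derivative_eq_rhs[OF has_derivative_scaleR[OF dp(2)[OF x] C2_D2[OF assms(1) x]]])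
        (auto simp: matrix_vector_mult_add_rdistrib outer_mult_vec scaleR_matrix_vector_assoc[symmetric])
  next
    have "continuous_on U (\<lambda>x. p1 (f x))"
      using dp(2) by (auto intro!: has_derivative_continuous_on intro: has_derivative_at_withinI)
    then show "continuous_on U (\<lambda>x. p1 (f x) *\<^sub>R H x + p2 (f x) *\<^sub>R outer (G x) (G x))"
      using c2 C2_cont_G[OF assms(1)] C2_cont_H[OF assms(1)] by (intro continuous_intros)
  qed
qed

lemma C2_quadratic:
  assumes "B \<in> sym_matrices"
  shows "C2 U (\<lambda>x. (x - y) \<bullet> (B *v (x - y))) (\<lambda>x. 2 *\<^sub>R (B *v (x - y))) (\<lambda>x. 2 *\<^sub>R B)"
proof -
  have sym: "(a \<bullet> (B *v b)) = (B *v a) \<bullet> b" for a b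
    using assms by (metis (mono_tags, lifting) dot_lmul_matrix mem_Collect_eq sym_matrices_def
        transpose_matrix_vector)
  have lin: "((\<lambda>x. B *v (x - y)) has_derivative (\<lambda>h. B *v h)) (at x)" for x
    by (rule has_derivative_eq_rhs[OF bounded_linear.has_derivative[OF matrix_vector_mul_bounded_linear]])
      (auto intro!: derivative_eq_intros)
  have lin': "((\<lambda>x. x - y) has_derivative (\<lambda>h. h)) (at x)" for x
    by (auto intro!: derivative_eq_intros)
  show ?thesis
    unfolding C2_def
  proof (intro conjI ballI)
    fix x
    show "((\<lambda>x. (x - y) \<bullet> (B *v (x - y))) has_derivative (\<lambda>h. (2 *\<^sub>R (B *v (x - y))) \<bullet> h)) (at x)"
      by (rule has_derivative_eq_rhs[OF has_derivative_inner[OF lin' lin]])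
        (auto simp: sym inner_commute)
    show "((\<lambda>x. 2 *\<^sub>R (B *v (x - y))) has_derivative (\<lambda>h. (2 *\<^sub>R B) *v h)) (at x)"
      by (rule has_derivative_eq_rhs[OF has_derivative_scaleR_right[OF lin]])
        (auto simp: scaleR_matrix_vector_assoc)
  qed auto
qed

lemma C2_dilate:
  assumes "C2 U f G H" "r > 0"
  shows "C2 {x. r *\<^sub>R x \<in> U} (\<lambda>x. f (r *\<^sub>R x)) (\<lambda>x. r *\<^sub>R G (r *\<^sub>R x)) (\<lambda>x. r^2 *\<^sub>R H (r *\<^sub>R x))"
  unfolding C2_def
proof (intro conjI ballI)
  fix x assume x: "x \<in> {x. r *\<^sub>R x \<in> U}"
  have lin: "((\<lambda>x. r *\<^sub>R x) has_derivative (\<lambda>h. r *\<^sub>R h)) (at x)"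
    by (auto intro!: derivative_eq_intros)
  show "((\<lambda>x. f (r *\<^sub>R x)) has_derivative (\<lambda>h. (r *\<^sub>R G (r *\<^sub>R x)) \<bullet> h)) (at x)"
    using has_derivative_compose[OF lin C2_D1[OF assms(1)]] x by simp
  have "((\<lambda>x. G (r *\<^sub>R x)) has_derivative (\<lambda>h. H (r *\<^sub>R x) *v (r *\<^sub>R h))) (at x)"
    using has_derivative_compose[OF lin C2_D2[OF assms(1)]] x by simp
  from has_derivative_scaleR_right[OF this, of r]
  show "((\<lambda>x. r *\<^sub>R G (r *\<^sub>R x)) has_derivative (\<lambda>h. (r\<^sup>2 *\<^sub>R H (r *\<^sub>R x)) *v h)) (at x)"
    by (simp add: matrix_vector_mult_scaleR scaleR_matrix_vector_assoc[symmetric] power2_eq_square)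
next
  show "continuous_on {x. r *\<^sub>R x \<in> U} (\<lambda>x. r\<^sup>2 *\<^sub>R H (r *\<^sub>R x))"
    by (intro continuous_intros continuous_on_compose2[OF C2_cont_H[OF assms(1)]]) auto
qed

lemma C2_cong:
  assumes "C2 U f G H" "open U" "\<And>x. x \<in> U \<Longrightarrow> f' x = f x" "\<And>x. x \<in> U \<Longrightarrow> G' x = G x"
    "\<And>x. x \<in> U \<Longrightarrow> H' x = H x"
  shows "C2 U f' G' H'"
  unfolding C2_def
proof (intro conjI ballI)
  fix x assume x: "x \<in> U"
  show "(f' has_derivative (\<lambda>h. G' x \<bullet> h)) (at x)"
    using has_derivative_transform_within_open[OF C2_D1[OF assms(1) x] assms(2) x] assms x by simp
  show "(G' has_derivative (\<lambda>h. H' x *v h)) (at x)"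
    using has_derivative_transform_within_open[OF C2_D2[OF assms(1) x] assms(2) x] assms x by simp
next
  show "continuous_on U H'"
    using C2_cont_H[OF assms(1)] assms(5) by (simp cong: continuous_on_cong)
qed

text \<open>The second difference is symmetric in \<open>a\<close> and \<open>b\<close>, which gives Schwarz's theorem below.\<close>

lemma C2_second_difference:
  assumes C: "C2 U f G H" and U: "open U" "x \<in> U" and e: "0 < e"
  shows "\<exists>d>0. \<forall>t. 0 < t \<and> t < d \<longrightarrow>
    \<bar>f (x + t *\<^sub>R a + t *\<^sub>R b) - f (x + t *\<^sub>R a) - f (x + t *\<^sub>R b) + f x - t^2 * (a \<bullet> (H x *v b))\<bar> \<le> e * t^2"
proof -
  \<comment> \<open>Absorbs both norm factors: the final error is e' t (2|a| + |b| + 1)(|a| + 1) = e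
    t.\<close>
  define e' where "e' = e / ((2 * norm a + norm b + 1) * (norm a + 1))"
  have e': "e' > 0" using e unfolding e'_def by (intro divide_pos_pos mult_pos_pos add_nonneg_pos) auto
  from C2_D2[OF C U(2), unfolded has_derivative_at_alt] e' obtain d0 where d0: "d0 > 0"
    "\<And>y. norm (y - x) < d0 \<Longrightarrow> norm (G y - G x - H x *v (y - x)) \<le> e' * norm (y - x)"
    by auto
  from U obtain d1 where d1: "d1 > 0" "ball x d1 \<subseteq> U" by (meson open_contains_ball)
  define d where "d = min d0 d1 / (norm a + norm b + 1)"
  have pos: "norm a + norm b + 1 > 0" by (intro add_nonneg_pos) auto
  have d: "d > 0" using d0 d1 pos by (simp add: d_def)
  show ?thesis
  proof (intro exI[of _ d] conjI allI impI d)
    fix t assume t: "0 < t \<and> t < d"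
    have small: "norm (s *\<^sub>R a + r *\<^sub>R b) < min d0 d1" if "0 \<le> s" "s \<le> t" "0 \<le> r" "r \<le> t" for s r
    proof -
      have "norm (s *\<^sub>R a + r *\<^sub>R b) \<le> s * norm a + r * norm b"
        using that by (intro norm_triangle_le) auto
      also have "\<dots> \<le> t * norm a + t * norm b"
        using that by (intro add_mono mult_right_mono) auto
      also have "\<dots> \<le> t * (norm a + norm b + 1)" using t by (simp add: algebra_simps)
      also have "\<dots> < d * (norm a + norm b + 1)" using t pos by (intro mult_strict_right_mono) auto
      also have "\<dots> = min d0 d1" using pos by (simp add: d_def)
      finally show ?thesis .
    qed
    have inU: "x + s *\<^sub>R a + r *\<^sub>R b \<in> U" if "0 \<le> s" "s \<le> t" "0 \<le> r" "r \<le> t" for s r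
      using small[OF that] d1(2) by (auto simp: subset_iff dist_norm norm_minus_commute add.assoc)
    \<comment> \<open>The mean value theorem in \<open>s\<close> alone turns the second difference
      into a first difference of \<open>G\<close>, to which differentiability of \<open>G\<close> at
      \<open>x\<close> applies.\<close>
    define p where "p = (\<lambda>s. f (x + s *\<^sub>R a + t *\<^sub>R b) - f (x + s *\<^sub>R a + 0 *\<^sub>R b))"
    define p' where "p' = (\<lambda>s. (G (x + s *\<^sub>R a + t *\<^sub>R b) - G (x + s *\<^sub>R a + 0 *\<^sub>R b)) \<bullet> a)"
    have part: "((\<lambda>s. f (x + s *\<^sub>R a + r *\<^sub>R b)) has_derivative (\<lambda>h. G (x + s *\<^sub>R a + r *\<^sub>R b) \<bullet> (h *\<^sub>R a))) (at s)"
      if "0 \<le> s" "s \<le> t" "0 \<le> r" "r \<le> t" for s r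
    proof -
      have "((\<lambda>s. x + s *\<^sub>R a + r *\<^sub>R b) has_derivative (\<lambda>h. h *\<^sub>R a)) (at s)"
        by (auto intro!: derivative_eq_intros)
      from has_derivative_compose[OF this C2_D1[OF C inU[OF that]]] show ?thesis .
    qed
    have "(p has_real_derivative p' s) (at s)" if "0 \<le> s" "s \<le> t" for s
      unfolding p_def p'_def has_field_derivative_def
      by (rule has_derivative_eq_rhs[OF has_derivative_diff[OF part part]])
        (use that t in \<open>auto simp: inner_diff_left algebra_simps\<close>)
    with MVT2[of 0 t p p'] t obtain z where z: "0 < z" "z < t" "p t - p 0 = (t - 0) * p' z" by auto
    define y1 where "y1 = z *\<^sub>R a + t *\<^sub>R b"
    define y2 where "y2 = z *\<^sub>R a"
    have n1: "norm y1 \<le> t * (norm a + norm b)"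
    proof -
      have "norm y1 \<le> z * norm a + t * norm b" unfolding y1_def using z t by (intro norm_triangle_le) auto
      also have "\<dots> \<le> t * norm a + t * norm b" using z by (intro add_mono mult_right_mono) auto
      finally show ?thesis by (simp add: algebra_simps)
    qed
    have n2: "norm y2 \<le> t * norm a" unfolding y2_def using z t by (auto intro: mult_right_mono)
    have g1: "norm (G (x + y1) - G x - H x *v y1) \<le> e' * norm y1"
      using d0(2)[of "x + y1"] small[of z t] z t by (auto simp: y1_def)
    have g2: "norm (G (x + y2) - G x - H x *v y2) \<le> e' * norm y2"
      using d0(2)[of "x + y2"] small[of z 0] z t by (auto simp: y2_def)
    have "H x *v y1 - H x *v y2 = t *\<^sub>R (H x *v b)"
      by (simp add: matrix_vector_right_distrib matrix_vector_mult_scaleR y1_def y2_def)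
    then have "norm (G (x + y1) - G (x + y2) - t *\<^sub>R (H x *v b)) \<le> e' * norm y1 + e' * norm y2"
      using norm_triangle_ineq4[of "G (x + y1) - G x - H x *v y1" "G (x + y2) - G x - H x *v y2"] g1 g2
      by (simp add: algebra_simps)
    also have "\<dots> \<le> e' * (t * (norm a + norm b)) + e' * (t * norm a)"
      using n1 n2 e' by (intro add_mono mult_left_mono) auto
    also have "\<dots> \<le> e' * t * (2 * norm a + norm b + 1)"
      using e' t by (simp add: algebra_simps)
    finally have gg: "norm (G (x + y1) - G (x + y2) - t *\<^sub>R (H x *v b)) \<le> e' * t * (2 * norm a + norm b + 1)" .
    have "p' z - t * (a \<bullet> (H x *v b)) = (G (x + y1) - G (x + y2) - t *\<^sub>R (H x *v b)) \<bullet> a"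
      unfolding p'_def y1_def y2_def by (simp add: inner_diff_left inner_diff_right inner_commute add.assoc)
    then have "\<bar>p' z - t * (a \<bullet> (H x *v b))\<bar> \<le> norm (G (x + y1) - G (x + y2) - t *\<^sub>R (H x *v b)) * norm a"
      using Cauchy_Schwarz_ineq2 by metis
    also have "\<dots> \<le> e' * t * (2 * norm a + norm b + 1) * (norm a + 1)"
      using gg e' t by (intro mult_mono) auto
    also have "\<dots> = e * t"
    proof -
      have "2 * norm a + norm b + 1 \<noteq> 0" "norm a + 1 \<noteq> 0"
        by (smt (verit) norm_ge_zero)+
      then show ?thesis by (simp add: e'_def)
    qed
    finally have 1: "\<bar>p' z - t * (a \<bullet> (H x *v b))\<bar> \<le> e * t" .
    have "f (x + t *\<^sub>R a + t *\<^sub>R b) - f (x + t *\<^sub>R a) - f (x + t *\<^sub>R b) + f x - t^2 * (a \<bullet> (H x *v b)) =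
       t * (p' z - t * (a \<bullet> (H x *v b)))"
      using z(3) by (simp add: p_def algebra_simps power2_eq_square)
    then show "\<bar>f (x + t *\<^sub>R a + t *\<^sub>R b) - f (x + t *\<^sub>R a) - f (x + t *\<^sub>R b) + f x - t^2 * (a \<bullet> (H x *v b))\<bar> \<le> e * t^2"
      using mult_left_mono[OF 1, of t] t
      by (simp only: abs_mult) (simp add: power2_eq_square mult_ac)
  qed
qed

lemma C2_hessian_sym_inner:
  assumes C: "C2 U f G H" and U: "open U" "x \<in> U"
  shows "a \<bullet> (H x *v b) = b \<bullet> (H x *v a)"
proof -
  have "\<bar>a \<bullet> (H x *v b) - b \<bullet> (H x *v a)\<bar> \<le> 2 * e" if e: "e > 0" for e
  proof -
    let ?D = "\<lambda>t. f (x + t *\<^sub>R a + t *\<^sub>R b) - f (x + t *\<^sub>R a) - f (x + t *\<^sub>R b) + f x"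
    obtain d1 where d1: "d1 > 0" "\<And>t. 0 < t \<and> t < d1 \<Longrightarrow> \<bar>?D t - t^2 * (a \<bullet> (H x *v b))\<bar> \<le> e * t^2"
      using C2_second_difference[OF C U e, of a b] by blast
    obtain d2 where d2: "d2 > 0" "\<And>t. 0 < t \<and> t < d2 \<Longrightarrow> \<bar>?D t - t^2 * (b \<bullet> (H x *v a))\<bar> \<le> e * t^2"
      using C2_second_difference[OF C U e, of b a] by (auto simp: add.commute add.left_commute algebra_simps)
    define t where "t = min d1 d2 / 2"
    have t: "0 < t" "t < d1" "t < d2" using d1 d2 by (auto simp: t_def)
    have "t^2 * \<bar>a \<bullet> (H x *v b) - b \<bullet> (H x *v a)\<bar> = \<bar>t^2 * (a \<bullet> (H x *v b)) - t^2 * (b \<bullet> (H x *v a))\<bar>"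
      by (simp add: abs_mult flip: right_diff_distrib)
    also have "\<dots> \<le> 2 * (e * t^2)" using d1(2)[of t] d2(2)[of t] t by auto
    also have "\<dots> = t^2 * (2 * e)" by simp
    finally show ?thesis using t by simp
  qed
  \<comment> \<open>Taken at a quarter of the discrepancy, the bound makes a positive discrepancy at
    most half of itself.\<close>
  from this[of "\<bar>a \<bullet> (H x *v b) - b \<bullet> (H x *v a)\<bar> / 4"] show ?thesis by fastforce
qed

lemma C2_hessian_sym:
  assumes C: "C2 U f G H" and U: "open U" "x \<in> U"
  shows "H x \<in> sym_matrices"
proof -
  have "H x $ i $ j = H x $ j $ i" for i j
    using C2_hessian_sym_inner[OF assms, of "axis i 1" "axis j 1"]
    by (simp add: inner_axis' matrix_vector_mul_component inner_axis)
  then show ?thesis by (simp add: sym_matrices_def transpose_def vec_eq_iff)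
qed

lemma C2_imp_Ck_on:
  assumes C: "C2 U f G H"
  shows "Ck_on 2 UNIV U f"
proof -
  have "((\<lambda>x. G x \<bullet> v) has_derivative (\<lambda>h. (H x *v h) \<bullet> v)) (at x)" if "x \<in> U" for x v
    by (rule has_derivative_inner_left[OF C2_D2[OF C that]])
  moreover have "continuous_on U (\<lambda>x. (H x *v w) \<bullet> v)" for w v
    using C2_cont_H[OF C] unfolding matrix_vector_mult_def by (intro continuous_intros) auto
  ultimately have "Ck_on (Suc 0) UNIV U (\<lambda>x. G x \<bullet> v)" for v
    unfolding Ck_on.simps by (intro exI[of _ "\<lambda>x h. (H x *v h) \<bullet> v"]) auto
  then have "Ck_on (Suc (Suc 0)) UNIV U f"
    using C2_D1[OF C] by (subst Ck_on.simps(2), intro exI[of _ "\<lambda>x h. G x \<bullet> h"]) auto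
  then show ?thesis by (simp add: numeral_2_eq_2)
qed

text \<open>\<open>hessian\<close> indexes in the opposite order to the Jacobian of
  \<open>G\<close>, so its entry (i, j) is first found as \<open>H x $ j $ i\<close>; Schwarz's
  theorem identifies the two.\<close>

lemma C2_hessian:
  assumes C: "C2 U f G H" and U: "open U" "x \<in> U"
  shows "hessian f x = H x"
proof -
  have 1: "partial j f y = G y $ j" if "y \<in> U" for y j
    using frechet_derivative_at[OF C2_D1[OF C that]] unfolding partial_def
    by (metis inner_axis inner_real_def mult.right_neutral)
  have "partial i (partial j f) x = H x $ i $ j" for i j
  proof -
    have "((\<lambda>y. G y $ j) has_derivative (\<lambda>h. (H x *v h) $ j)) (at x)"
      using C2_D2[OF C U(2)] by (rule bounded_linear.has_derivative[OF bounded_linear_vec_nth])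
    then have "(partial j f has_derivative (\<lambda>h. (H x *v h) $ j)) (at x)"
      by (rule has_derivative_transform_within_open[OF _ U]) (simp add: 1)
    then have "partial i (partial j f) x = (H x *v axis i 1) $ j"
      unfolding partial_def[of i] by (metis frechet_derivative_at)
    also have "\<dots> = H x $ j $ i" by (simp add: matrix_vector_mul_component inner_axis)
    also have "\<dots> = H x $ i $ j"
      using C2_hessian_sym[OF assms] by (simp add: sym_matrices_def transpose_def vec_eq_iff)
    finally show ?thesis .
  qed
  then show ?thesis by (simp add: hessian_def vec_eq_iff)
qed

text \<open>\<open>Ck_on\<close> controls derivatives in each fixed direction only. In finite
  dimension the coordinate directions determine the linear maps; this assembles gradient and
  Jacobian and gives continuity of the latter entry by entry.\<close>

lemma Ck_on_imp_C2:
  fixes f :: "real^'n \<Rightarrow> real"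
  assumes "Ck_on 2 UNIV U f"
  obtains G H where "C2 U f G H"
proof -
  from assms have "Ck_on (Suc (Suc 0)) UNIV U f" by (simp add: numeral_2_eq_2)
  then obtain D where D: "\<And>x. x \<in> U \<Longrightarrow> (f has_derivative D x) (at x)"
    and D1: "\<And>v. Ck_on (Suc 0) UNIV U (\<lambda>x. D x v)"
    unfolding Ck_on.simps(2)[of "Suc 0"] by auto
  from D1 have "\<forall>v. \<exists>E. (\<forall>x\<in>U. ((\<lambda>x. D x v) has_derivative E x) (at x)) \<and> (\<forall>h. continuous_on U (\<lambda>x. E x h))"
    by auto
  then obtain E where E: "\<And>v x. x \<in> U \<Longrightarrow> ((\<lambda>x. D x v) has_derivative E v x) (at x)"
    and Ec: "\<And>v h. continuous_on U (\<lambda>x. E v x h)" by metis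
  define G where "G = (\<lambda>x. \<chi> i. D x (axis i 1))"
  define H where "H = (\<lambda>x. \<chi> i j. E (axis i 1) x (axis j 1))"
  have lin: "g h = (\<chi> i. g (axis i 1)) \<bullet> h" if "bounded_linear g" for g :: "real^'n \<Rightarrow> real" and h
  proof -
    have l: "linear g" using that by (rule bounded_linear.linear)
    have "g h = g (\<Sum>i\<in>UNIV. h $ i *s axis i 1)" by (simp add: basis_expansion)
    also have "\<dots> = (\<Sum>i\<in>UNIV. h $ i * g (axis i 1))"
      by (simp add: linear_sum[OF l] linear_cmul[OF l] scalar_mult_eq_scaleR)
    finally show ?thesis by (simp add: inner_vec_def mult.commute)
  qed
  have "C2 U f G H"
    unfolding C2_def
  proof (intro conjI ballI)
    fix x assume x: "x \<in> U"
    show "(f has_derivative (\<lambda>h. G x \<bullet> h)) (at x)"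
      using D[OF x] lin[OF has_derivative_bounded_linear[OF D[OF x]]] unfolding G_def
      by (metis (no_types, lifting) ext)
    have "((\<lambda>x. G x) has_derivative (\<lambda>h. \<chi> i. E (axis i 1) x h)) (at x)"
      unfolding G_def using E[OF x]
      by (subst has_derivative_componentwise_within) (auto simp: Basis_vec_def inner_axis)
    moreover have "(\<chi> i. E (axis i 1) x h) = H x *v h" for h
      by (subst vec_eq_iff) (auto simp: H_def matrix_vector_mul_component lin[OF has_derivative_bounded_linear[OF E[OF x]], of _ h])
    ultimately show "(G has_derivative (\<lambda>h. H x *v h)) (at x)" by simp
  next
    show "continuous_on U H" unfolding H_def by (intro continuous_intros Ec)
  qed
  then show thesis by (rule that)
qed

section \<open>Classical test functions and comparison\<close>

lemma C2I:
  assumes "\<And>x. x \<in> U \<Longrightarrow> (f has_derivative (\<lambda>h. G x \<bullet> h)) (at x)"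
    and d: "\<And>x. x \<in> U \<Longrightarrow> (G has_derivative E x) (at x)"
    and "\<And>h. continuous_on U (\<lambda>x. E x h)"
  shows "C2 U f G (\<lambda>x. matrix (E x))"
  unfolding C2_def
proof (intro conjI ballI)
  fix x assume x: "x \<in> U"
  show "(G has_derivative (\<lambda>h. matrix (E x) *v h)) (at x)"
    using d[OF x] matrix_vector_mul(2)[OF has_derivative_linear[OF d[OF x]]] by simp
next
  show "continuous_on U (\<lambda>x. matrix (E x))"
    unfolding matrix_def by (intro continuous_intros assms)
qed (use assms in auto)

lemma C2_norm_powr:
  obtains G H where "C2 (UNIV - {0}) (\<lambda>x::real^'n. norm x powr a) G H"
proof -
  have "C2 (UNIV - {0::real^'n}) (\<lambda>x. (x - 0) \<bullet> (mat 1 *v (x - 0))) (\<lambda>x. 2 *\<^sub>R (mat 1 *v (x - 0))) (\<lambda>x. 2 *\<^sub>R mat 1)"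
    by (rule C2_quadratic) (simp add: sym_matrices_def)
  then have q: "C2 (UNIV - {0::real^'n}) (\<lambda>x. x \<bullet> x) (\<lambda>x. 2 *\<^sub>R x) (\<lambda>x. 2 *\<^sub>R mat 1)"
    by simp
  have d1: "((\<lambda>t. t powr (a / 2)) has_real_derivative a * t powr (a / 2 - 1) / 2) (at t)"
    and d2: "((\<lambda>t. a * t powr (a / 2 - 1) / 2) has_real_derivative a * ((a / 2 - 1) * t powr (a / 2 - 2)) / 2) (at t)"
    if "t > 0" for t
    using has_real_derivative_powr[OF that, of "a/2"]
      DERIV_cmult[OF has_real_derivative_powr[OF that, of "a/2 - 1"], of "a/2"] by simp_all
  have c: "C2 (UNIV - {0::real^'n}) (\<lambda>x. (x \<bullet> x) powr (a / 2)) (\<lambda>x. ((a / 2) * (x \<bullet> x) powr (a / 2 - 1)) *\<^sub>R (2 *\<^sub>R x))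
     (\<lambda>x. ((a / 2) * (x \<bullet> x) powr (a / 2 - 1)) *\<^sub>R (2 *\<^sub>R mat 1) +
       ((a / 2) * ((a / 2 - 1) * (x \<bullet> x) powr (a / 2 - 2))) *\<^sub>R outer (2 *\<^sub>R x) (2 *\<^sub>R x))"
    by (rule C2_compose_real[OF q, where p="\<lambda>t. t powr (a/2)" and ?p1.0="\<lambda>t. (a/2) * t powr (a/2 - 1)" and ?p2.0="\<lambda>t. (a/2) * ((a/2 - 1) * t powr (a/2 - 2))"])
      (auto intro!: d1 d2 continuous_intros)
  have "norm x powr a = (x \<bullet> x) powr (a / 2)" for x :: "real^'n"
    by (simp add: norm_eq_sqrt_inner powr_half_sqrt[symmetric] powr_powr)
  with c show thesis by (intro that) auto
qed

section \<open>Differentiability of homogeneous extensions\<close>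

lemma open_cone_over:
  fixes U :: "(real^'n) set"
  assumes "open U"
  shows "open {x. x \<noteq> 0 \<and> x /\<^sub>R norm x \<in> U}"
proof -
  have "continuous_on (UNIV - {0}) (\<lambda>x::real^'n. x /\<^sub>R norm x)"
    by (intro continuous_intros) auto
  then have "open ((\<lambda>x. x /\<^sub>R norm x) -` U \<inter> (UNIV - {0}))"
    using assms by (subst (asm) continuous_on_open_vimage) auto
  moreover have "(\<lambda>x. x /\<^sub>R norm x) -` U \<inter> (UNIV - {0}) = {x. x \<noteq> 0 \<and> x /\<^sub>R norm x \<in> U}" by auto
  ultimately show ?thesis by simp
qed

lemma has_derivative_normalize:
  fixes x :: "real^'n"
  assumes "x \<noteq> 0"
  shows "((\<lambda>x. x /\<^sub>R norm x) has_derivative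
     (\<lambda>h. inverse (norm x) *\<^sub>R h - (inverse (norm x) ^ 3 * (x \<bullet> h)) *\<^sub>R x)) (at x)"
    and "((\<lambda>x. inverse (norm x)) has_derivative (\<lambda>h. - (inverse (norm x) ^ 3 * (x \<bullet> h)))) (at x)"
proof -
  have "((\<lambda>x. inverse (norm x)) has_derivative
      (\<lambda>h. - (inverse (norm x) * (sgn x \<bullet> h) * inverse (norm x)))) (at x)"
    using has_derivative_compose[OF has_derivative_norm[OF assms] has_derivative_inverse'[of "norm x"]] assms
    by (simp add: inner_commute)
  then show 1: "((\<lambda>x. inverse (norm x)) has_derivative (\<lambda>h. - (inverse (norm x) ^ 3 * (x \<bullet> h)))) (at x)"
    by (simp add: sgn_div_norm power3_eq_cube mult_ac)
  show "((\<lambda>x. x /\<^sub>R norm x) has_derivative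
     (\<lambda>h. inverse (norm x) *\<^sub>R h - (inverse (norm x) ^ 3 * (x \<bullet> h)) *\<^sub>R x)) (at x)"
    by (rule has_derivative_eq_rhs[OF has_derivative_scaleR[OF 1 has_derivative_ident]]) auto
qed

text \<open>The extension of degree zero, g(x / |x|), is differentiated by hand, because
  normalization is vector-valued and outside the scalar calculus of \<open>C2\<close>; the factor
  |x|^a then enters as a product.\<close>

lemma C2_homogeneous_ext:
  fixes g :: "real^'n \<Rightarrow> real"
  assumes "C2 U g G H"
  obtains G' H' where "C2 {x. x \<noteq> 0 \<and> x /\<^sub>R norm x \<in> U} (homogeneous_ext a g) G' H'"
proof -
  define W where "W = {x. x \<noteq> 0 \<and> x /\<^sub>R norm x \<in> U}"
  define s where "s = (\<lambda>x::real^'n. x /\<^sub>R norm x)"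
  define n where "n = (\<lambda>x::real^'n. inverse (norm x))"
  define ds where "ds = (\<lambda>x h::real^'n. n x *\<^sub>R h - (n x ^ 3 * (x \<bullet> h)) *\<^sub>R x)"
  define P' where "P' = (\<lambda>x h. H (s x) *v ds x h)"
  \<comment> \<open>The derivative \<open>ds x\<close> of normalization is self-adjoint, so the
    gradient is \<open>ds x\<close> applied to \<open>G (s x)\<close>.\<close>
  define GG where "GG = (\<lambda>x. n x *\<^sub>R G (s x) - (n x ^ 3 * (x \<bullet> G (s x))) *\<^sub>R x)"
  define E where "E = (\<lambda>x h. (n x *\<^sub>R P' x h - (n x ^ 3 * (x \<bullet> h)) *\<^sub>R G (s x))
      - ((n x ^ 3 * (x \<bullet> G (s x))) *\<^sub>R h +
         (n x ^ 3 * (x \<bullet> P' x h + h \<bullet> G (s x)) + 3 * (- (n x ^ 3 * (x \<bullet> h))) * n x ^ 2 * (x \<bullet> G (s x))) *\<^sub>R x))"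
  have W: "x \<noteq> 0" "s x \<in> U" if "x \<in> W" for x using that by (auto simp: W_def s_def)
  have sd: "(s has_derivative ds x) (at x)" and nd: "(n has_derivative (\<lambda>h. - (n x ^ 3 * (x \<bullet> h)))) (at x)"
    if "x \<in> W" for x
    using has_derivative_normalize[of x] W[OF that] unfolding s_def ds_def n_def by auto
  have Gd: "((\<lambda>x. G (s x)) has_derivative P' x) (at x)" if "x \<in> W" for x
    unfolding P'_def by (rule has_derivative_compose[OF sd C2_D2[OF assms]]) (use that W in auto)
  have sc: "continuous_on W s" and nc: "continuous_on W n" and Gc: "continuous_on W (\<lambda>x. G (s x))"
    by (auto intro!: has_derivative_continuous_on has_derivative_at_withinI[OF sd]
         has_derivative_at_withinI[OF nd] has_derivative_at_withinI[OF Gd])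
  have dsc: "continuous_on W (\<lambda>x. ds x h)" for h
    unfolding ds_def by (intro continuous_intros nc)
  have "continuous_on W (\<lambda>x. H (s x))"
    by (rule continuous_on_compose2[OF C2_cont_H[OF assms] sc]) (use W in auto)
  then have P'c: "continuous_on W (\<lambda>x. P' x h)" for h
    unfolding P'_def matrix_vector_mult_def by (intro continuous_intros dsc)
  have "C2 W (\<lambda>x. g (s x)) GG (\<lambda>x. matrix (E x))"
  proof (rule C2I)
    fix x assume x: "x \<in> W"
    have "((\<lambda>x. g (s x)) has_derivative (\<lambda>h. G (s x) \<bullet> ds x h)) (at x)"
      by (rule has_derivative_compose[OF sd C2_D1[OF assms]]) (use x W in auto)
    moreover have "G (s x) \<bullet> ds x h = GG x \<bullet> h" for h
      unfolding GG_def ds_def by (simp add: inner_diff_left inner_diff_right inner_commute)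
    ultimately show "((\<lambda>x. g (s x)) has_derivative (\<lambda>h. GG x \<bullet> h)) (at x)" by simp
    have n3: "((\<lambda>x. n x ^ 3) has_derivative (\<lambda>h. 3 * (- (n x ^ 3 * (x \<bullet> h))) * n x ^ 2)) (at x)"
      by (rule has_derivative_eq_rhs[OF has_derivative_power[OF nd[OF x]]]) (auto simp: algebra_simps)
    have ip: "((\<lambda>x. x \<bullet> G (s x)) has_derivative (\<lambda>h. x \<bullet> P' x h + h \<bullet> G (s x))) (at x)"
      by (rule has_derivative_inner[OF has_derivative_ident Gd[OF x]])
    show "(GG has_derivative E x) (at x)"
      unfolding GG_def E_def
      by (rule has_derivative_eq_rhs[OF has_derivative_diff[OF has_derivative_scaleR[OF nd[OF x] Gd[OF x]]
           has_derivative_scaleR[OF has_derivative_mult[OF n3 ip] has_derivative_ident]]]) auto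
  next
    show "continuous_on W (\<lambda>x. E x h)" for h
      unfolding E_def by (intro continuous_intros nc P'c Gc)
  qed
  moreover obtain G1 H1 where "C2 (UNIV - {0}) (\<lambda>x::real^'n. norm x powr a) G1 H1"
    using C2_norm_powr .
  then have "C2 W (\<lambda>x::real^'n. norm x powr a) G1 H1" by (rule C2_subset) (use W in auto)
  ultimately have "\<exists>G' H'. C2 W (\<lambda>x. norm x powr a * g (s x)) G' H'"
    using C2_mult by blast
  then show thesis using that by (auto simp: W_def s_def homogeneous_ext_def[abs_def])
qed

section \<open>Viscosity supersolutions of a linear equation with constant coefficients\<close>

locale elliptic =
  fixes A :: "real^'n^'n" and l :: real
  assumes A_sym: "A \<in> sym_matrices" and l_pos: "0 < l"
    and A_ge: "\<And>x. l * (norm x)\<^sup>2 \<le> x \<bullet> (A *v x)"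
    and dim: "2 \<le> CARD('n)"
begin

text \<open>The operator is odd, so a subsolution is a function whose negative is a supersolution,
  and \<open>solution\<close> needs no second notion.\<close>

definition supersol :: "(real^'n) set \<Rightarrow> (real^'n \<Rightarrow> real) \<Rightarrow> bool" where
  "supersol \<Omega> v \<longleftrightarrow>
     (\<forall>x0 U \<psi> G H. open U \<and> x0 \<in> U \<and> U \<subseteq> \<Omega> \<and> C2 U \<psi> G H \<and>
        (\<forall>x\<in>U. v x0 - \<psi> x0 \<le> v x - \<psi> x) \<longrightarrow> A \<bullet> H x0 \<le> 0)"

definition solution :: "(real^'n) set \<Rightarrow> (real^'n \<Rightarrow> real) \<Rightarrow> bool" where
  "solution \<Omega> v \<longleftrightarrow> continuous_on \<Omega> v \<and> supersol \<Omega> v \<and> supersol \<Omega> (\<lambda>x. - v x)"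

lemma supersolD:
  assumes "supersol \<Omega> v" "open U" "x0 \<in> U" "U \<subseteq> \<Omega>" "C2 U \<psi> G H"
    "\<And>x. x \<in> U \<Longrightarrow> v x0 - \<psi> x0 \<le> v x - \<psi> x"
  shows "A \<bullet> H x0 \<le> 0"
  using assms unfolding supersol_def by blast

lemma supersol_subset: "supersol \<Omega> v \<Longrightarrow> \<Omega>' \<subseteq> \<Omega> \<Longrightarrow> supersol \<Omega>' v"
  unfolding supersol_def by (meson order_trans)

text \<open>If \<open>\<psi>\<close> touches \<open>v + f\<close> from below, then
  \<open>\<psi> - f\<close> touches \<open>v\<close> at the same point.\<close>

lemma supersol_add_C2:
  assumes "supersol \<Omega> v" "C2 \<Omega> f Gf Hf" "\<And>x. x \<in> \<Omega> \<Longrightarrow> A \<bullet> Hf x \<le> 0"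
  shows "supersol \<Omega> (\<lambda>x. v x + f x)"
  unfolding supersol_def
proof (intro allI impI, elim conjE)
  fix x0 U \<psi> G H
  assume U: "open U" "x0 \<in> U" "U \<subseteq> \<Omega>" "C2 U \<psi> G H" "\<forall>x\<in>U. v x0 + f x0 - \<psi> x0 \<le> v x + f x - \<psi> x"
  have "C2 U (\<lambda>x. \<psi> x + (-1) * f x) (\<lambda>x. G x + (-1) *\<^sub>R Gf x) (\<lambda>x. H x + (-1) *\<^sub>R Hf x)"
    by (intro C2_add C2_scale U C2_subset[OF assms(2)])
  from supersolD[OF assms(1) U(1-3) this] U(5) have "A \<bullet> (H x0 + (-1) *\<^sub>R Hf x0) \<le> 0"
    by (force simp: algebra_simps)
  then have "A \<bullet> H x0 \<le> A \<bullet> Hf x0" by (simp add: inner_diff_right)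
  also have "\<dots> \<le> 0" using assms(3) U by blast
  finally show "A \<bullet> H x0 \<le> 0" .
qed

lemma supersol_scale:
  assumes "supersol \<Omega> v" "c > 0"
  shows "supersol \<Omega> (\<lambda>x. c * v x)"
  unfolding supersol_def
proof (intro allI impI, elim conjE)
  fix x0 U \<psi> G H
  assume U: "open U" "x0 \<in> U" "U \<subseteq> \<Omega>" "C2 U \<psi> G H" "\<forall>x\<in>U. c * v x0 - \<psi> x0 \<le> c * v x - \<psi> x"
  have *: "C2 U (\<lambda>x. inverse c * \<psi> x) (\<lambda>x. inverse c *\<^sub>R G x) (\<lambda>x. inverse c *\<^sub>R H x)"
    by (intro C2_scale U)
  have "v x0 - inverse c * \<psi> x0 \<le> v x - inverse c * \<psi> x" if "x \<in> U" for x
  proof -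
    have "inverse c * (c * v x0 - \<psi> x0) \<le> inverse c * (c * v x - \<psi> x)"
      using U(5) that assms(2) by (intro mult_left_mono) auto
    then show ?thesis using assms(2) by (simp add: field_simps)
  qed
  from supersolD[OF assms(1) U(1-3) * this] have "A \<bullet> (inverse c *\<^sub>R H x0) \<le> 0" by blast
  then have "inverse c * (A \<bullet> H x0) \<le> 0" by simp
  then show "A \<bullet> H x0 \<le> 0" using assms(2) by (simp add: mult_le_0_iff)
qed

lemma supersol_dilate:
  assumes "supersol \<Omega> v" "r > 0" "\<And>x. x \<in> \<Omega>' \<Longrightarrow> r *\<^sub>R x \<in> \<Omega>"
  shows "supersol \<Omega>' (\<lambda>x. v (r *\<^sub>R x))"
  unfolding supersol_def
proof (intro allI impI, elim conjE)
  fix x0 U \<psi> G H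
  assume U: "open U" "x0 \<in> U" "U \<subseteq> \<Omega>'" "C2 U \<psi> G H"
    "\<forall>x\<in>U. v (r *\<^sub>R x0) - \<psi> x0 \<le> v (r *\<^sub>R x) - \<psi> x"
  let ?V = "{y. inverse r *\<^sub>R y \<in> U}"
  have V: "C2 ?V (\<lambda>y. \<psi> (inverse r *\<^sub>R y)) (\<lambda>y. inverse r *\<^sub>R G (inverse r *\<^sub>R y))
      (\<lambda>y. (inverse r)^2 *\<^sub>R H (inverse r *\<^sub>R y))"
    using assms(2) by (intro C2_dilate U) auto
  have "open ((\<lambda>y. inverse r *\<^sub>R y) -` U)"
    using U(1) by (intro open_vimage continuous_intros) auto
  then have 1: "open ?V" by (simp add: vimage_def)
  have 2: "r *\<^sub>R x0 \<in> ?V" using U assms by simp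
  have 3: "?V \<subseteq> \<Omega>"
  proof
    fix y assume "y \<in> ?V"
    then have "r *\<^sub>R (inverse r *\<^sub>R y) \<in> \<Omega>" using assms(3) U(3) by blast
    then show "y \<in> \<Omega>" using assms(2) by simp
  qed
  have "v (r *\<^sub>R x0) - \<psi> (inverse r *\<^sub>R (r *\<^sub>R x0)) \<le> v y - \<psi> (inverse r *\<^sub>R y)" if "y \<in> ?V" for y
    using U(5)[rule_format, of "inverse r *\<^sub>R y"] that assms(2) by simp
  from supersolD[OF assms(1) 1 2 3 V this]
  have "A \<bullet> ((inverse r)^2 *\<^sub>R H (inverse r *\<^sub>R r *\<^sub>R x0)) \<le> 0" .
  then have "(inverse r)^2 * (A \<bullet> H x0) \<le> 0" using assms(2) by simp
  then show "A \<bullet> H x0 \<le> 0" using assms(2) by (simp add: mult_le_0_iff)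
qed

lemma solution_scale_dilate:
  assumes "solution \<Omega> v" "r > 0" "\<And>x. x \<in> \<Omega>' \<Longrightarrow> r *\<^sub>R x \<in> \<Omega>" "c > 0"
  shows "solution \<Omega>' (\<lambda>x. c * v (r *\<^sub>R x))"
proof -
  from assms(1) have v: "continuous_on \<Omega> v" "supersol \<Omega> v" "supersol \<Omega> (\<lambda>x. - v x)"
    by (auto simp: solution_def)
  have "continuous_on \<Omega>' (\<lambda>x. v (r *\<^sub>R x))"
    by (rule continuous_on_compose2[OF v(1)]) (use assms(3) in \<open>auto intro: continuous_intros\<close>)
  then have "continuous_on \<Omega>' (\<lambda>x. c * v (r *\<^sub>R x))" by (rule continuous_on_mult_left)
  moreover have "supersol \<Omega>' (\<lambda>x. c * v (r *\<^sub>R x))"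
    by (rule supersol_scale[OF supersol_dilate[OF v(2) assms(2,3)] assms(4)])
  moreover have "supersol \<Omega>' (\<lambda>x. c * (- v (r *\<^sub>R x)))"
    by (rule supersol_scale[OF supersol_dilate[OF v(3) assms(2,3)] assms(4)])
  ultimately show ?thesis by (simp add: solution_def)
qed

lemma solution_uminus: "solution \<Omega> v \<Longrightarrow> solution \<Omega> (\<lambda>x. - v x)"
  by (auto simp: solution_def intro: continuous_intros)

lemma solution_add_C2:
  assumes "solution \<Omega> v" "C2 \<Omega> f Gf Hf" "\<And>x. x \<in> \<Omega> \<Longrightarrow> A \<bullet> Hf x = 0"
  shows "solution \<Omega> (\<lambda>x. v x + f x)"
proof -
  have "supersol \<Omega> (\<lambda>x. - v x + (-1) * f x)"
    by (rule supersol_add_C2[OF _ C2_scale[OF assms(2)]]) (use assms in \<open>auto simp: solution_def\<close>)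
  moreover have "supersol \<Omega> (\<lambda>x. v x + f x)"
    by (rule supersol_add_C2[OF _ assms(2)]) (use assms in \<open>auto simp: solution_def\<close>)
  moreover have "continuous_on \<Omega> (\<lambda>x. v x + f x)"
    using assms C2_cont by (auto simp: solution_def intro!: continuous_intros)
  ultimately show ?thesis by (simp add: solution_def)
qed

text \<open>A negative minimum of \<open>v - \<psi>\<close> would be attained inside
  \<open>D\<close>, where \<open>\<psi>\<close> touches \<open>v\<close> from below against its
  strictness. The boundary condition \<open>bd\<close> is a lower limit along \<open>D\<close>, so
  no continuity at the frontier is demanded.\<close>

lemma comparison:
  assumes D: "open D" "bounded D" and v: "supersol D v" "continuous_on D v"
    and \<psi>: "C2 D \<psi> G H" "\<And>x. x \<in> D \<Longrightarrow> 0 < A \<bullet> H x"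
    and bd: "\<And>z e. z \<in> frontier D \<Longrightarrow> 0 < e \<Longrightarrow> \<exists>d>0. \<forall>x\<in>D. dist x z < d \<longrightarrow> - e \<le> v x - \<psi> x"
    and x: "x \<in> D"
  shows "\<psi> x \<le> v x"
proof (rule ccontr)
  assume neg: "\<not> \<psi> x \<le> v x"
  \<comment> \<open>Half of the violation: near the frontier \<open>v - \<psi>\<close> is at least
    -e, strictly above the level -2e that defines \<open>E\<close>, so \<open>E\<close> cannot
    accumulate there.\<close>
  define e where "e = (\<psi> x - v x) / 2"
  have e: "e > 0" using neg by (simp add: e_def)
  define E where "E = {y \<in> D. v y - \<psi> y \<le> - 2 * e}"
  have cont: "continuous_on D (\<lambda>y. v y - \<psi> y)"
    by (intro continuous_intros v C2_cont[OF \<psi>(1)])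
  have "closed E"
    unfolding closed_sequential_limits
  proof (intro allI impI, elim conjE)
    fix X z assume X: "\<forall>n. X n \<in> E" "X \<longlonglongrightarrow> z"
    have XD: "X n \<in> D" for n using X(1) by (simp add: E_def)
    then have "z \<in> closure D" using X(2) closure_sequential by blast
    have "z \<in> D"
    proof (rule ccontr)
      assume "z \<notin> D"
      then have "z \<in> frontier D"
        using \<open>z \<in> closure D\<close> D(1) by (simp add: frontier_def interior_open)
      from bd[OF this e] obtain d where d: "d > 0" "\<forall>x\<in>D. dist x z < d \<longrightarrow> - e \<le> v x - \<psi> x" by blast
      from X(2) d(1) obtain n where "dist (X n) z < d"
        unfolding lim_sequentially by blast
      then have "- e \<le> v (X n) - \<psi> (X n)" using d(2) XD by blast
      moreover have "v (X n) - \<psi> (X n) \<le> - 2 * e" using X(1) by (simp add: E_def)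
      ultimately show False using e by linarith
    qed
    have "(\<lambda>n. v (X n) - \<psi> (X n)) \<longlonglongrightarrow> v z - \<psi> z"
      using cont \<open>z \<in> D\<close> X(2) XD by (auto simp: continuous_on_sequentially comp_def)
    then have "v z - \<psi> z \<le> - 2 * e"
      by (rule LIMSEQ_le_const2) (use X in \<open>auto simp: E_def\<close>)
    then show "z \<in> E" using \<open>z \<in> D\<close> by (simp add: E_def)
  qed
  moreover have "bounded E" using D(2) by (rule bounded_subset) (auto simp: E_def)
  ultimately have "compact E" by (simp add: compact_eq_bounded_closed)
  moreover have xE: "x \<in> E" using x by (simp add: E_def e_def field_simps)
  moreover have "continuous_on E (\<lambda>y. v y - \<psi> y)" using cont by (rule continuous_on_subset) (auto simp: E_def)
  ultimately obtain x0 where x0: "x0 \<in> E" "\<And>y. y \<in> E \<Longrightarrow> v x0 - \<psi> x0 \<le> v y - \<psi> y"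
    using continuous_attains_inf[of E "\<lambda>y. v y - \<psi> y"] by blast
  have "v x0 - \<psi> x0 \<le> v y - \<psi> y" if "y \<in> D" for y
  proof (cases "y \<in> E")
    case False
    then have "- 2 * e < v y - \<psi> y" using that by (simp add: E_def)
    moreover have "v x0 - \<psi> x0 \<le> - 2 * e" using x0(1) by (simp add: E_def)
    ultimately show ?thesis by linarith
  qed (use x0 in blast)
  moreover have "x0 \<in> D" using x0(1) by (simp add: E_def)
  ultimately have "A \<bullet> H x0 \<le> 0" by (intro supersolD[OF v(1) D(1) _ order_refl \<psi>(1)])
  with \<psi>(2)[OF \<open>x0 \<in> D\<close>] show False by simp
qed

lemma A_mat1_pos: "0 < A \<bullet> mat 1"
proof -
  have "0 < A $ i $ i" for i
  proof -
    have "l * (norm (axis i 1 :: real^'n))\<^sup>2 \<le> axis i 1 \<bullet> (A *v axis i 1)" by (rule A_ge)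
    also have "axis i 1 \<bullet> (A *v axis i 1) = A $ i $ i"
      by (simp add: inner_axis' matrix_vector_mul_component inner_axis)
    finally show ?thesis using l_pos by (simp add: norm_axis_1)
  qed
  then show ?thesis
    by (auto intro!: sum_pos simp: inner_matrix_sum mat_def if_distrib[of "(*) _"] cong: if_cong)
qed

lemma C2_norm_sq: "C2 U (\<lambda>x::real^'n. (norm x)\<^sup>2) (\<lambda>x. 2 *\<^sub>R x) (\<lambda>x. 2 *\<^sub>R mat 1)"
proof -
  have "C2 U (\<lambda>x::real^'n. (x - 0) \<bullet> (mat 1 *v (x - 0))) (\<lambda>x. 2 *\<^sub>R (mat 1 *v (x - 0))) (\<lambda>x. 2 *\<^sub>R mat 1)"
    by (rule C2_quadratic) (simp add: sym_matrices_def)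
  then show ?thesis by (simp add: dot_square_norm)
qed

text \<open>The small paraboloid e (|x|^2 - C^2) is a strict subsolution and nonpositive on
  \<open>D\<close>, so \<open>comparison\<close> gives v >= -e C^2 for every positive e.\<close>

lemma minimum_principle:
  assumes D: "open D" "bounded D" and v: "supersol D v" "continuous_on D v"
    and bd: "\<And>z e. z \<in> frontier D \<Longrightarrow> 0 < e \<Longrightarrow> \<exists>d>0. \<forall>x\<in>D. dist x z < d \<longrightarrow> - e \<le> v x"
    and x: "x \<in> D"
  shows "0 \<le> v x"
proof -
  obtain C where C: "\<And>x. x \<in> D \<Longrightarrow> norm x \<le> C" using D(2) bounded_iff by blast
  have C0: "0 \<le> C" using C[OF x] norm_ge_zero[of x] by linarith
  have main: "- e * C\<^sup>2 \<le> v x" if e: "e > 0" for e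
  proof -
    have C2: "C2 D (\<lambda>x. e * ((norm x)\<^sup>2 + - C\<^sup>2)) (\<lambda>x. e *\<^sub>R (2 *\<^sub>R x + 0)) (\<lambda>x. e *\<^sub>R (2 *\<^sub>R mat 1 + 0))"
      by (rule C2_scale[OF C2_add[OF C2_norm_sq C2_const]])
    have "e * ((norm x)\<^sup>2 + - C\<^sup>2) \<le> v x"
    proof (rule comparison[OF D v C2 _ _ x])
      show "0 < A \<bullet> (e *\<^sub>R (2 *\<^sub>R mat 1 + 0))" using A_mat1_pos e by simp
      fix e' :: real and z' assume z: "z' \<in> frontier D" "(0::real) < e'"
      have neg: "e * ((norm y)\<^sup>2 + - C\<^sup>2) \<le> 0" if "y \<in> D" for y
        using C[OF that] e power_mono[of "norm y" C 2] by (simp add: mult_le_0_iff)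
      obtain d where "d > 0" "\<forall>x\<in>D. dist x z' < d \<longrightarrow> - e' \<le> v x" using bd[OF z] by blast
      then show "\<exists>d>0. \<forall>x\<in>D. dist x z' < d \<longrightarrow> - e' \<le> v x - e * ((norm x)\<^sup>2 + - C\<^sup>2)"
        using neg by (intro exI[of _ d]) (auto intro: order_trans)
    qed
    moreover have "e * ((norm x)\<^sup>2 + - C\<^sup>2) \<ge> - e * C\<^sup>2" using e by (simp add: algebra_simps)
    ultimately show ?thesis by linarith
  qed
  show ?thesis
  proof (rule ccontr)
    assume "\<not> 0 \<le> v x"
    then have "v x < 0" by simp
    define e where "e = - v x / (2 * (C\<^sup>2 + 1))"
    have pos: "C\<^sup>2 + 1 > 0" by (simp add: add_nonneg_pos)
    then have "e > 0" using \<open>v x < 0\<close> unfolding e_def by (intro divide_pos_pos) auto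
    have "e * C\<^sup>2 \<le> e * (C\<^sup>2 + 1)" using \<open>e > 0\<close> by simp
    also have "\<dots> = - v x / 2" using pos by (simp add: e_def field_simps)
    finally show False using main[OF \<open>e > 0\<close>] \<open>v x < 0\<close> by simp
  qed
qed

end

section \<open>Kernels and the growth lemma\<close>

lemma C2_sum:
  assumes "finite Y" "\<And>y. y \<in> Y \<Longrightarrow> C2 U (f y) (G y) (H y)"
  shows "C2 U (\<lambda>x. \<Sum>y\<in>Y. f y x) (\<lambda>x. \<Sum>y\<in>Y. G y x) (\<lambda>x. \<Sum>y\<in>Y. H y x)"
  using assms by (induction Y rule: finite_induct) (auto simp: C2_const intro: C2_add)

section \<open>Sums of powers over lattice points\<close>

lemma sum_powr_le:
  fixes e :: real
  assumes e: "0 < e" "e \<le> 1" and N: "1 \<le> N"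
  shows "(\<Sum>j=1..N. real j powr (e - 1)) \<le> real N powr e / e"
  using N
proof (induction N rule: dec_induct)
  case base
  then show ?case using e by (simp add: field_simps)
next
  case (step N)
  have "((\<lambda>t. t powr e) has_real_derivative e * t powr (e - 1)) (at t)" if "real N \<le> t" for t
    using has_real_derivative_powr[of t e] that step by simp
  \<comment> \<open>The derivative at the intermediate point is at least its value at the right
    endpoint, so the sum telescopes.\<close>
  with MVT2[of "real N" "real (Suc N)" "\<lambda>t. t powr e" "\<lambda>t. e * t powr (e - 1)"]
  obtain z where z: "real N < z" "z < real (Suc N)"
    "real (Suc N) powr e - real N powr e = (real (Suc N) - real N) * (e * z powr (e - 1))" by auto
  have "real (Suc N) powr (e - 1) \<le> z powr (e - 1)"
    using z e step by (intro powr_mono2') auto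
  then have "e * real (Suc N) powr (e - 1) \<le> real (Suc N) powr e - real N powr e"
    using z(3) e by simp
  then have "real (Suc N) powr (e - 1) \<le> real (Suc N) powr e / e - real N powr e / e"
    using e by (simp add: field_simps)
  then show ?case using step by simp
qed

text \<open>\<open>J\<close> is any set of at most N naturals, since the distances from lattice
  points to a far point need not fill an initial segment. The part up to N is bounded by the full
  sum, with 1 coming from j = 0; the at most N indices beyond N contribute at most N^(e-1)
  each.\<close>

lemma sum_powr_finite_le:
  fixes e :: real
  assumes e: "0 < e" "e \<le> 1" and J: "finite J" "card J \<le> N" and N: "1 \<le> N"
  shows "(\<Sum>j\<in>J. max (real j) 1 powr (e - 1)) \<le> (1 / e + 2) * real N powr e"
proof -
  let ?g = "\<lambda>j. max (real j) 1 powr (e - 1)"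
  have N1: "1 \<le> real N powr e" using N e by (simp add: ge_one_powr_ge_zero)
  have "(\<Sum>j\<in>J. ?g j) = (\<Sum>j\<in>J \<inter> {..N}. ?g j) + (\<Sum>j\<in>J - {..N}. ?g j)"
    using J(1) by (subst sum.union_disjoint[symmetric]) (auto intro: sum.cong)
  also have "\<dots> \<le> (1 + real N powr e / e) + real N powr e"
  proof (rule add_mono)
    have "(\<Sum>j\<in>J \<inter> {..N}. ?g j) \<le> (\<Sum>j\<in>{..N}. ?g j)"
      by (rule sum_mono2) auto
    also have "(\<Sum>j\<in>{..N}. ?g j) = (\<Sum>j\<in>insert 0 {1..N}. ?g j)" by (rule sum.cong) auto
    also have "\<dots> = 1 + (\<Sum>j=1..N. real j powr (e - 1))"
      by (auto simp: max_def intro!: sum.cong)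
    also have "\<dots> \<le> 1 + real N powr e / e"
      using sum_powr_le[OF e N] by simp
    finally show "(\<Sum>j\<in>J \<inter> {..N}. ?g j) \<le> 1 + real N powr e / e" .
    have "(\<Sum>j\<in>J - {..N}. ?g j) \<le> (\<Sum>j\<in>J - {..N}. real N powr (e - 1))"
      using N e by (intro sum_mono powr_mono2') auto
    also have "\<dots> \<le> real N * real N powr (e - 1)"
      using J by (auto intro!: mult_right_mono order_trans[OF card_mono[of J "J - {..N}"]])
    also have "\<dots> = real N powr e"
      using N powr_add[of "real N" 1 "e - 1"] by simp
    finally show "(\<Sum>j\<in>J - {..N}. ?g j) \<le> real N powr e" .
  qed
  finally show ?thesis using N1 by (simp add: algebra_simps)
qed

text \<open>Rounding \<open>t\<close> down replaces |t - k| by an integer distance at the price of a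
  factor 2. On either side of \<open>t\<close> these distances are distinct, and the two sides give
  another factor 2.\<close>

lemma sum_shifted_powr_le:
  fixes e t :: real
  assumes e: "0 < e" "e \<le> 1" and N: "1 \<le> N"
  shows "(\<Sum>k=1..N. max \<bar>t - real k\<bar> 1 powr (e - 1)) \<le> 4 * (1 / e + 2) * real N powr e"
proof -
  define m where "m = \<lfloor>t\<rfloor>"
  let ?g = "\<lambda>j. max (real j) 1 powr (e - 1)"
  define K1 where "K1 = {k\<in>{1..N}. m \<le> int k}"
  define K2 where "K2 = {k\<in>{1..N}. int k < m}"
  have trm: "max \<bar>t - real k\<bar> 1 powr (e - 1) \<le> 2 * ?g (nat \<bar>m - int k\<bar>)" for k
  proof -
    have t: "of_int m \<le> t" "t < of_int m + 1" unfolding m_def by linarith+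
    define j where "j = real_of_int \<bar>m - int k\<bar>"
    have "\<bar>m - int k\<bar> \<in> {0, 1, 2} \<or> 3 \<le> \<bar>m - int k\<bar>" by auto
    \<comment> \<open>For j up to 2 the truncation at 1 dominates j / 2; for larger j, j - 1
      does.\<close>
    then have j: "j \<in> {0, 1, 2} \<or> 3 \<le> j" unfolding j_def by auto
    have "j - 1 \<le> \<bar>t - real k\<bar>" using t unfolding j_def by linarith
    with j have "max j 1 / 2 \<le> max \<bar>t - real k\<bar> 1" by (auto simp: max_def)
    then have "max \<bar>t - real k\<bar> 1 powr (e - 1) \<le> (max j 1 / 2) powr (e - 1)"
      using e by (intro powr_mono2') auto
    also have "\<dots> = 2 powr (1 - e) * max j 1 powr (e - 1)"
      by (simp add: powr_divide powr_diff)
    also have "\<dots> \<le> 2 * max j 1 powr (e - 1)"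
      using powr_mono[of "1 - e" 1 2] e by (intro mult_right_mono) auto
    also have "j = real (nat \<bar>m - int k\<bar>)" by (simp add: j_def)
    finally show ?thesis .
  qed
  have part: "(\<Sum>k\<in>K. ?g (nat \<bar>m - int k\<bar>)) \<le> (1 / e + 2) * real N powr e"
    if K: "K \<subseteq> {1..N}" "inj_on (\<lambda>k. nat \<bar>m - int k\<bar>) K" for K
  proof -
    have "finite K" using K(1) finite_subset by blast
    have "(\<Sum>k\<in>K. ?g (nat \<bar>m - int k\<bar>)) = (\<Sum>j\<in>(\<lambda>k. nat \<bar>m - int k\<bar>) ` K. ?g j)"
      using K(2) by (simp add: sum.reindex)
    also have "\<dots> \<le> (1 / e + 2) * real N powr e"
      using \<open>finite K\<close> card_mono[OF _ K(1)] K(2)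
      by (intro sum_powr_finite_le e N) (auto simp: card_image)
    finally show ?thesis .
  qed
  have "(\<Sum>k=1..N. max \<bar>t - real k\<bar> 1 powr (e - 1)) \<le> (\<Sum>k=1..N. 2 * ?g (nat \<bar>m - int k\<bar>))"
    by (intro sum_mono trm)
  also have "\<dots> = 2 * (\<Sum>k\<in>K1 \<union> K2. ?g (nat \<bar>m - int k\<bar>))"
    unfolding sum_distrib_left by (rule sum.cong) (auto simp: K1_def K2_def)
  also have "(\<Sum>k\<in>K1 \<union> K2. ?g (nat \<bar>m - int k\<bar>)) =
      (\<Sum>k\<in>K1. ?g (nat \<bar>m - int k\<bar>)) + (\<Sum>k\<in>K2. ?g (nat \<bar>m - int k\<bar>))"
    by (rule sum.union_disjoint) (auto simp: K1_def K2_def)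
  also have "\<dots> \<le> (1 / e + 2) * real N powr e + (1 / e + 2) * real N powr e"
    by (intro add_mono part) (auto simp: K1_def K2_def inj_on_def)
  finally show ?thesis by (simp add: algebra_simps)
qed

text \<open>A lattice cube that starts at \<open>c\<close> and is not centred there: only its
  cardinality, its spacing and its containment in a ball about \<open>c\<close> matter.\<close>

definition grid :: "real^'n \<Rightarrow> real \<Rightarrow> nat \<Rightarrow> (real^'n) set" where
  "grid c h N = (\<lambda>k. c + h *\<^sub>R (\<chi> i. real (k i))) ` (PiE UNIV (\<lambda>_. {1..N}))"

lemma
  fixes c :: "real^'n"
  assumes "h > 0"
  shows finite_grid: "finite (grid c h N)"
    and card_grid: "card (grid c h N) = N ^ CARD('n)"
    and inj_grid: "inj_on (\<lambda>k. c + h *\<^sub>R (\<chi> i. real (k i)) :: real^'n) (PiE UNIV (\<lambda>_. {1..N}))"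
proof -
  show "finite (grid c h N)" unfolding grid_def by (intro finite_imageI finite_PiE) auto
  show inj: "inj_on (\<lambda>k. c + h *\<^sub>R (\<chi> i. real (k i)) :: real^'n) (PiE UNIV (\<lambda>_. {1..N}))"
    using assms by (auto simp: inj_on_def vec_eq_iff)
  then show "card (grid c h N) = N ^ CARD('n)"
    unfolding grid_def by (simp add: card_image card_PiE)
qed

lemma grid_dist:
  fixes c :: "real^'n"
  assumes "h > 0" "y \<in> grid c h N"
  shows "dist c y \<le> h * (real CARD('n) * real N)"
proof -
  obtain k where k: "y = c + h *\<^sub>R (\<chi> i. real (k i))" "k \<in> PiE UNIV (\<lambda>_. {1..N})"
    using assms(2) by (auto simp: grid_def)
  have "norm (\<chi> i. real (k i) :: real^'n) \<le> (\<Sum>i\<in>UNIV. \<bar>(\<chi> i. real (k i) :: real^'n) $ i\<bar>)"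
    by (rule norm_le_l1_cart)
  also have "\<dots> \<le> (\<Sum>i\<in>(UNIV :: 'n set). real N)"
    using k(2) by (intro sum_mono) (auto simp: PiE_def Pi_def)
  finally show ?thesis using assms(1) k(1) by (simp add: dist_norm)
qed

text \<open>The power is split evenly over the \<open>n\<close> coordinates, so that the sum factors into sums in one
  dimension with exponent \<open>1/n - 1 > -1\<close>.\<close>

lemma sum_grid_le:
  fixes c x :: "real^'n" and n :: real
  defines "n \<equiv> real CARD('n)"
  assumes h: "h > 0" and N: "1 \<le> N" and Y: "Y \<subseteq> grid c h N" "\<And>y. y \<in> Y \<Longrightarrow> h \<le> dist x y"
  shows "(\<Sum>y\<in>Y. dist x y powr (1 - n)) \<le> (4 * (n + 2)) powr n * h powr (1 - n) * real N"
proof -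
  have n: "n \<ge> 1" by (simp add: n_def)
  define e where "e = 1 / n"
  have e: "0 < e" "e \<le> 1" "e - 1 \<le> 0" using n by (auto simp: e_def)
  have en: "(e - 1) * n = 1 - n" "n * (e - 1) = 1 - n" using n by (auto simp: e_def field_simps)
  define y where "y = (\<lambda>k. c + h *\<^sub>R (\<chi> i. real (k i)) :: real^'n)"
  define P where "P = PiE (UNIV :: 'n set) (\<lambda>_. {1..N})"
  define T where "T = {k \<in> P. y k \<in> Y}"
  have fP: "finite P" unfolding P_def by (intro finite_PiE) auto
  have YT: "Y = y ` T" using Y(1) unfolding T_def grid_def y_def P_def by auto
  have inj: "inj_on y T"
    using inj_grid[OF h, of c N] unfolding y_def T_def P_def by (rule inj_on_subset) auto
  define t where "t = (\<lambda>i. (x $ i - c $ i) / h)"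
  have bound: "dist x (y k) powr (1 - n) \<le> (\<Prod>i\<in>UNIV. h powr (e - 1) * max \<bar>t i - real (k i)\<bar> 1 powr (e - 1))"
    if k: "k \<in> T" for k
  proof -
    have hd: "h \<le> dist x (y k)" using k Y(2) by (auto simp: T_def)
    \<comment> \<open>A single coordinate difference bounds the distance from below; the truncation
      at 1 is covered by the assumption that \<open>x\<close> keeps distance \<open>h\<close> from
      \<open>Y\<close>.\<close>
    have d: "h * max \<bar>t i - real (k i)\<bar> 1 \<le> dist x (y k)" for i
    proof -
      have "h * \<bar>t i - real (k i)\<bar> = \<bar>h * (t i - real (k i))\<bar>" using h by (simp add: abs_mult)
      also have "h * (t i - real (k i)) = (x - y k) $ i"
        using h by (simp add: t_def y_def field_simps)
      also have "\<bar>(x - y k) $ i\<bar> \<le> dist x (y k)" unfolding dist_norm by (rule component_le_norm_cart)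
      finally show ?thesis using hd h by (simp add: max_def)
    qed
    have d0: "dist x (y k) > 0" using hd h by linarith
    have "dist x (y k) powr (1 - n) = (\<Prod>i\<in>(UNIV::'n set). dist x (y k) powr (e - 1))"
      using d0 by (simp add: powr_powr powr_realpow[symmetric] flip: en(1)) (simp add: n_def)
    also have "\<dots> \<le> (\<Prod>i\<in>(UNIV::'n set). (h * max \<bar>t i - real (k i)\<bar> 1) powr (e - 1))"
      using d e(3) h by (intro prod_mono conjI powr_mono2') (auto simp: mult_pos_pos)
    also have "\<dots> = (\<Prod>i\<in>UNIV. h powr (e - 1) * max \<bar>t i - real (k i)\<bar> 1 powr (e - 1))"
      by (intro prod.cong refl powr_mult)
    finally show ?thesis .
  qed
  have "(\<Sum>y\<in>Y. dist x y powr (1 - n)) = (\<Sum>k\<in>T. dist x (y k) powr (1 - n))"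
    unfolding YT by (simp add: sum.reindex[OF inj])
  also have "\<dots> \<le> (\<Sum>k\<in>T. \<Prod>i\<in>UNIV. h powr (e - 1) * max \<bar>t i - real (k i)\<bar> 1 powr (e - 1))"
    by (intro sum_mono bound)
  also have "\<dots> \<le> (\<Sum>k\<in>P. \<Prod>i\<in>UNIV. h powr (e - 1) * max \<bar>t i - real (k i)\<bar> 1 powr (e - 1))"
    by (intro sum_mono2 fP) (auto simp: T_def intro!: prod_nonneg)
  \<comment> \<open>Over the full cube a sum of products of one-variable factors is the product of
    the one-dimensional sums; this is why \<open>T\<close> was enlarged to \<open>P\<close>.\<close>
  also have "\<dots> = (\<Prod>i\<in>(UNIV::'n set). \<Sum>k=1..N. h powr (e - 1) * max \<bar>t i - real k\<bar> 1 powr (e - 1))"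
    unfolding P_def by (rule prod_sum_PiE[symmetric]) auto
  also have "\<dots> \<le> (\<Prod>i\<in>(UNIV::'n set). h powr (e - 1) * (4 * (1 / e + 2) * real N powr e))"
  proof (intro prod_mono conjI)
    show "0 \<le> (\<Sum>k=1..N. h powr (e - 1) * max \<bar>t i - real k\<bar> 1 powr (e - 1))" for i
      by (intro sum_nonneg mult_nonneg_nonneg) auto
    show "(\<Sum>k=1..N. h powr (e - 1) * max \<bar>t i - real k\<bar> 1 powr (e - 1)) \<le> h powr (e - 1) * (4 * (1 / e + 2) * real N powr e)" for i
      unfolding sum_distrib_left[symmetric] using sum_shifted_powr_le[OF e(1,2) N] by (intro mult_left_mono) auto
  qed
  also have "\<dots> = (h powr (e - 1) * (4 * (1 / e + 2) * real N powr e)) powr n"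
    using h N e by (simp add: n_def powr_realpow add_pos_pos)
  also have "\<dots> = (4 * (1 / e + 2)) powr n * h powr (1 - n) * real N"
    using N n e unfolding powr_mult powr_powr en by (simp add: e_def)
  also have "1 / e = n" by (simp add: e_def)
  finally show ?thesis .
qed

section \<open>The quadratic form of the inverse matrix and the kernels\<close>

context elliptic
begin

definition B :: "real^'n^'n" where "B = matrix_inv A"

definition q :: "real^'n \<Rightarrow> real" where "q x = x \<bullet> (B *v x)"

lemma A_inverse: "A ** B = mat 1" "B ** A = mat 1"
proof -
  have "x = 0" if "A *v x = 0" for x
  proof -
    have "l * (norm x)\<^sup>2 \<le> 0" using A_ge[of x] that by simp
    then show ?thesis using l_pos by (simp add: mult_le_0_iff)
  qed
  then have "invertible A"
    unfolding invertible_left_inverse matrix_left_invertible_ker by blast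
  then show "A ** B = mat 1" "B ** A = mat 1"
    unfolding B_def matrix_inv_def invertible_def by (metis (mono_tags, lifting) someI_ex)+
qed

lemma A_mult_B: "A *v (B *v x) = x"
  by (simp add: matrix_vector_mul_assoc A_inverse)

lemma B_sym: "B \<in> sym_matrices"
proof -
  have "transpose B ** transpose A = transpose (A ** B)" by (rule matrix_transpose_mul[symmetric])
  then have BA: "transpose B ** A = mat 1" using A_sym by (simp add: A_inverse sym_matrices_def)
  have "transpose B = transpose B ** (A ** B)" by (simp add: A_inverse)
  also have "\<dots> = (transpose B ** A) ** B" by (rule matrix_mul_assoc)
  finally have "transpose B = B" by (simp add: BA)
  then show ?thesis by (simp add: sym_matrices_def)
qed

lemma A_inner_B: "A \<bullet> B = real CARD('n)"
proof -
  have "A \<bullet> B = A \<bullet> transpose B" using B_sym by (simp add: sym_matrices_def)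
  also have "\<dots> = trace (A ** B)"
    by (simp add: inner_matrix_sum trace_def matrix_matrix_mult_def transpose_def)
  finally show ?thesis by (simp add: A_inverse trace_I)
qed

text \<open>\<open>q_lo\<close> comes from x = A y: q x = y . A y is at least l |y|^2, while |x| is
  at most |A| |y|.\<close>

definition "q_lo = l / (onorm ((*v) A))\<^sup>2"
definition "q_up = onorm ((*v) B)"

lemma onorm_A_pos: "0 < onorm ((*v) A)"
proof -
  let ?a = "axis (undefined::'n) (1::real)"
  have "l \<le> ?a \<bullet> (A *v ?a)" using A_ge[of ?a] by (simp add: norm_axis_1)
  also have "\<dots> \<le> norm ?a * norm (A *v ?a)" by (rule norm_cauchy_schwarz)
  also have "\<dots> \<le> onorm ((*v) A)" using onorm[OF matrix_vector_mul_bounded_linear, of A ?a] by simp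
  finally show ?thesis using l_pos by simp
qed

lemma q_lo_pos: "0 < q_lo"
  unfolding q_lo_def using l_pos onorm_A_pos by simp

lemma q_ge: "q_lo * (norm x)\<^sup>2 \<le> q x"
proof -
  define y where "y = B *v x"
  have x: "x = A *v y" by (simp add: y_def A_mult_B)
  have "norm x \<le> onorm ((*v) A) * norm y"
    unfolding x by (rule onorm[OF matrix_vector_mul_bounded_linear])
  then have "(norm x)\<^sup>2 \<le> (onorm ((*v) A) * norm y)\<^sup>2" by (intro power_mono) auto
  then have "q_lo * (norm x)\<^sup>2 \<le> q_lo * (onorm ((*v) A) * norm y)\<^sup>2"
    using q_lo_pos by (intro mult_left_mono) auto
  also have "\<dots> = l * (norm y)\<^sup>2" using onorm_A_pos by (simp add: q_lo_def power_mult_distrib)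
  also have "\<dots> \<le> y \<bullet> (A *v y)" by (rule A_ge)
  also have "\<dots> = q x" unfolding q_def x[symmetric] y_def[symmetric] by (simp add: inner_commute)
  finally show ?thesis .
qed

lemma q_le: "q x \<le> q_up * (norm x)\<^sup>2"
proof -
  have "q x \<le> norm x * norm (B *v x)" unfolding q_def by (rule norm_cauchy_schwarz)
  also have "\<dots> \<le> norm x * (q_up * norm x)"
    unfolding q_up_def by (intro mult_left_mono onorm[OF matrix_vector_mul_bounded_linear]) auto
  finally show ?thesis by (simp add: power2_eq_square mult_ac)
qed

lemma q_pos: "x \<noteq> 0 \<Longrightarrow> 0 < q x"
  using q_ge[of x] q_lo_pos by (smt (verit) mult_pos_pos zero_less_norm_iff zero_less_power)

lemma q_lo_le_up: "q_lo \<le> q_up"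
  using q_ge[of "axis undefined 1"] q_le[of "axis undefined 1"] by (simp add: norm_axis_1)

lemma q_up_pos: "0 < q_up"
  using q_lo_le_up q_lo_pos by simp

text \<open>In linear coordinates that turn \<open>A\<close> into the identity, \<open>q\<close> is
  the squared distance, and this is the Laplacian of the power 2s of the distance. The value is
  positive for s = \<open>p2\<close>, where two factors are negative, and for s = \<kappa> / 2,
  where none is.\<close>

lemma C2_q_powr:
  obtains G H where "C2 (- {y}) (\<lambda>x. q (x - y) powr s) G H"
    "\<And>x. x \<noteq> y \<Longrightarrow> A \<bullet> H x = 2 * s * (real CARD('n) + 2 * s - 2) * q (x - y) powr (s - 1)"
proof -
  let ?H = "\<lambda>x. (s * q (x - y) powr (s - 1)) *\<^sub>R (2 *\<^sub>R B)
     + (s * ((s - 1) * q (x - y) powr (s - 2))) *\<^sub>R outer (2 *\<^sub>R (B *v (x - y))) (2 *\<^sub>R (B *v (x - y)))"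
  have q0: "0 < q (x - y)" if "x \<in> - {y}" for x using that q_pos by simp
  have qC: "C2 (- {y}) (\<lambda>x. q (x - y)) (\<lambda>x. 2 *\<^sub>R (B *v (x - y))) (\<lambda>x. 2 *\<^sub>R B)"
    unfolding q_def by (rule C2_quadratic[OF B_sym])
  have d: "((\<lambda>t. t powr a) has_real_derivative a * t powr (a - 1)) (at t)" if "t > 0" for t a :: real
    by (rule has_real_derivative_powr[OF that])
  have d2: "((\<lambda>t. s * t powr (s - 1)) has_real_derivative s * ((s - 1) * t powr (s - 2))) (at t)" if "t > 0" for t
    using DERIV_cmult[OF d[OF that, of "s - 1"], of s] by simp
  have "continuous_on (- {y}) (\<lambda>x. s * ((s - 1) * q (x - y) powr (s - 2)))"
    using q0 by (intro continuous_intros C2_cont[OF qC]) force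
  from C2_compose_real[OF qC d[OF q0] d2[OF q0] this]
  have "C2 (- {y}) (\<lambda>x. q (x - y) powr s) (\<lambda>x. (s * q (x - y) powr (s - 1)) *\<^sub>R 2 *\<^sub>R (B *v (x - y))) ?H"
    by simp
  moreover have "A \<bullet> ?H x = 2 * s * (real CARD('n) + 2 * s - 2) * q (x - y) powr (s - 1)" if "x \<noteq> y" for x
  proof -
    have "A \<bullet> outer (2 *\<^sub>R (B *v (x - y))) (2 *\<^sub>R (B *v (x - y))) = 4 * q (x - y)"
      by (simp add: inner_outer matrix_vector_mult_scaleR A_mult_B q_def inner_commute)
    moreover have "q (x - y) powr (s - 2) * q (x - y) = q (x - y) powr (s - 1)"
      using q_pos[of "x - y"] that powr_add[of "q (x - y)" "s - 2" 1] by simp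
    ultimately have "A \<bullet> ?H x = s * q (x - y) powr (s - 1) * (2 * real CARD('n)) + s * (s - 1) * 4 * q (x - y) powr (s - 1)"
      by (simp add: inner_add_right A_inner_B)
    then show ?thesis by (simp add: algebra_simps)
  qed
  ultimately show thesis by (rule that)
qed

text \<open>The power \<open>1 - n\<close> of the distance lies strictly between \<open>-n\<close> (integrability) and \<open>2 - n\<close>
  (where \<open>q\<close> to this power solves the equation).\<close>

definition "p2 = (1 - real CARD('n)) / 2"

lemma p2_neg: "p2 < 0" using dim by (simp add: p2_def)

definition kern :: "real^'n \<Rightarrow> real^'n \<Rightarrow> real" where "kern y x = q (x - y) powr p2"

lemma kern_le:
  assumes "0 < r" "r \<le> dist x y"
  shows "kern y x \<le> (q_lo * r\<^sup>2) powr p2"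
proof -
  have "r\<^sup>2 \<le> (norm (x - y))\<^sup>2" using assms by (intro power_mono) (auto simp: dist_norm)
  then have "q_lo * r\<^sup>2 \<le> q (x - y)"
    using q_ge[of "x - y"] q_lo_pos by (smt (verit) mult_left_mono)
  then show ?thesis unfolding kern_def using p2_neg q_lo_pos assms by (intro powr_mono2') auto
qed

lemma kern_ge:
  assumes "x \<noteq> y" "dist x y \<le> r"
  shows "(q_up * r\<^sup>2) powr p2 \<le> kern y x"
proof -
  have "(norm (x - y))\<^sup>2 \<le> r\<^sup>2" using assms by (intro power_mono) (auto simp: dist_norm)
  then have "q (x - y) \<le> q_up * r\<^sup>2"
    using q_le[of "x - y"] q_up_pos by (smt (verit) mult_left_mono)
  then show ?thesis unfolding kern_def using p2_neg q_pos[of "x - y"] assms by (intro powr_mono2') auto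
qed

text \<open>Kernels with pole in \<open>cball c r\<close> are at most \<open>(16 * q_up * r\<^sup>2) powr p2\<close> at distance
  \<open>\<Theta> * r\<close> from \<open>c\<close>, and at least \<open>(9 * q_up * r\<^sup>2) powr p2\<close> at distance less than \<open>2 * r\<close>.\<close>

definition "\<Theta> = 1 + 4 * sqrt (q_up / q_lo)"
definition "\<gamma> r = (9 * q_up * r\<^sup>2) powr p2 - (16 * q_up * r\<^sup>2) powr p2"

lemma \<Theta>_ge: "5 \<le> \<Theta>"
  using q_lo_le_up q_lo_pos by (simp add: \<Theta>_def real_le_rsqrt)

lemma \<gamma>_pos: "0 < r \<Longrightarrow> 0 < \<gamma> r"
  unfolding \<gamma>_def using q_up_pos p2_neg by (simp add: powr_less_mono2_neg)

text \<open>Supplies the boundary condition of \<open>comparison\<close> for functions that extend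
  continuously to the frontier point.\<close>

lemma frontier_bound:
  assumes "continuous_on T f" "D \<subseteq> T" "z \<in> T" "0 \<le> f z" "0 < e"
  shows "\<exists>d>0. \<forall>x\<in>D. dist x z < d \<longrightarrow> - e \<le> (f x :: real)"
proof -
  from assms(1,3,5) obtain d where d: "d > 0" "\<forall>x\<in>T. dist x z < d \<longrightarrow> dist (f x) (f z) < e"
    unfolding continuous_on_iff by blast
  show ?thesis
  proof (intro exI[of _ d] conjI ballI impI d(1))
    fix x assume "x \<in> D" "dist x z < d"
    then have "dist (f x) (f z) < e" using d(2) assms(2) by blast
    then show "- e \<le> f x" using assms(4) by (auto simp: dist_real_def)
  qed
qed

text \<open>The comparison function is (a / C) (sum of kernels - card Y * b), where \<open>b\<close>
  bounds a kernel on the outer sphere: it is at most \<open>a\<close> at distance \<open>h\<close>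
  from the poles and nonpositive on the outer sphere. Points within \<open>h\<close> of a pole are
  left to the first argument of \<open>min\<close>.\<close>

lemma growth:
  assumes Y: "finite Y" "Y \<subseteq> cball c r" "Y \<noteq> {}" and r: "0 < r" and h: "0 < h"
    and v: "supersol \<Omega> v" "continuous_on \<Omega> v" and \<Omega>: "cball c (\<Theta> * r) \<subseteq> \<Omega>"
    and v0: "\<And>x. x \<in> cball c (\<Theta> * r) \<Longrightarrow> 0 \<le> v x" and a: "0 < a"
    and va: "\<And>x y. y \<in> Y \<Longrightarrow> dist x y \<le> h \<Longrightarrow> x \<in> cball c (\<Theta> * r) \<Longrightarrow> a \<le> v x"
    and C: "0 < C" "\<And>x. (\<And>y. y \<in> Y \<Longrightarrow> h \<le> dist x y) \<Longrightarrow> (\<Sum>y\<in>Y. kern y x) \<le> C"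
    and x: "dist c x < 2 * r"
  shows "min a (a / C * (real (card Y) * \<gamma> r)) \<le> v x"
proof -
  let ?P = "\<lambda>x. \<Sum>y\<in>Y. kern y x"
  define b where "b = (16 * q_up * r\<^sup>2) powr p2"
  define D where "D = ball c (\<Theta> * r) - (\<Union>y\<in>Y. cball y h)"
  \<comment> \<open>A closed set that contains \<open>D\<close> and misses the poles, on which the
    kernels are continuous and their sum is at most \<open>C\<close>.\<close>
  define S where "S = {x. \<forall>y\<in>Y. h \<le> dist x y}"
  define \<psi> where "\<psi> = (\<lambda>x. a / C * (?P x + (- real (card Y) * b)))"
  have "\<exists>G H. C2 (- {y}) (kern y) G H \<and> (\<forall>x. x \<noteq> y \<longrightarrow> 0 < A \<bullet> H x)" for y
  proof -
    obtain G H where GH: "C2 (- {y}) (\<lambda>x. q (x - y) powr p2) G H"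
      "\<And>x. x \<noteq> y \<Longrightarrow> A \<bullet> H x = 2 * p2 * (real CARD('n) + 2 * p2 - 2) * q (x - y) powr (p2 - 1)"
      using C2_q_powr[of y p2] by blast
    have "real CARD('n) + 2 * p2 - 2 = - 1" by (simp add: p2_def field_simps)
    then have "0 < A \<bullet> H x" if "x \<noteq> y" for x
      using GH(2)[OF that] p2_neg q_pos[of "x - y"] that by (simp add: mult_neg_pos)
    with GH(1) show ?thesis unfolding kern_def[abs_def] by blast
  qed
  then obtain G H where GH: "\<And>y. C2 (- {y}) (kern y) (G y) (H y)" "\<And>x y. x \<noteq> y \<Longrightarrow> 0 < A \<bullet> H y x"
    by metis
  have PC: "C2 (- Y) \<psi> (\<lambda>x. (a / C) *\<^sub>R ((\<Sum>y\<in>Y. G y x) + 0)) (\<lambda>x. (a / C) *\<^sub>R ((\<Sum>y\<in>Y. H y x) + 0))"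
    unfolding \<psi>_def by (intro C2_scale C2_add C2_sum C2_const Y(1) C2_subset[OF GH(1)]) auto
  have YS: "S \<subseteq> - Y" using h unfolding S_def by force
  have DS: "D \<subseteq> S" unfolding D_def S_def by (auto simp: dist_commute not_le less_imp_le)
  have opD: "open D"
    unfolding D_def using Y(1) by (intro open_Diff) (auto intro!: closed_UN)
  have clS: "closed S"
    unfolding S_def Ball_def by (intro closed_Collect_all closed_Collect_imp open_Collect_const closed_Collect_le continuous_intros)
  show ?thesis
  proof (cases "x \<in> D")
    case False
    moreover have xb: "dist c x < \<Theta> * r"
    proof -
      have "2 * r \<le> \<Theta> * r" using \<Theta>_ge r by (intro mult_right_mono) auto
      with x show ?thesis by linarith
    qed
    ultimately obtain y where "y \<in> Y" "dist x y \<le> h" by (auto simp: D_def dist_commute)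
    then have "a \<le> v x" using va xb by auto
    then show ?thesis by linarith
  next
    case True
    have "\<psi> x \<le> v x"
    proof (rule comparison[OF opD _ _ _ C2_subset[OF PC] _ _ True])
      show "bounded D" unfolding D_def by (rule bounded_subset[OF bounded_ball]) auto
      have "D \<subseteq> \<Omega>" using \<Omega> by (auto simp: D_def)
      then show "supersol D v" "continuous_on D v" using v supersol_subset continuous_on_subset by blast+
      show "D \<subseteq> - Y" using DS YS by blast
    next
      show "0 < A \<bullet> ((a / C) *\<^sub>R ((\<Sum>y\<in>Y. H y x) + 0))" if "x \<in> D" for x
      proof -
        have "x \<noteq> y" if "y \<in> Y" for y using \<open>x \<in> D\<close> that DS YS by auto
        then have "0 < (\<Sum>y\<in>Y. A \<bullet> H y x)" using Y GH(2) by (intro sum_pos) auto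
        then show ?thesis using a C by (simp add: inner_sum_right)
      qed
    next
      fix z and e :: real assume z: "z \<in> frontier D" and e: "0 < e"
      have zS: "z \<in> S" using z closure_minimal[OF DS clS] by (auto simp: frontier_def)
      have "closure D \<subseteq> cball c (\<Theta> * r)" unfolding D_def by (intro closure_minimal) auto
      then have zc: "z \<in> cball c (\<Theta> * r)" using z by (auto simp: frontier_def)
      have zD: "z \<notin> D" using z opD by (simp add: frontier_def interior_open)
      have Cz: "?P z \<le> C" using C(2) zS by (auto simp: S_def)
      have "\<psi> z \<le> v z"
      proof (cases "\<exists>y\<in>Y. dist z y \<le> h")
        case True
        then have "a \<le> v z" using va zc by blast
        moreover have "a / C * (?P z + (- real (card Y) * b)) \<le> a / C * C"
          using Cz a C by (intro mult_left_mono) (auto simp: b_def intro: order_trans[OF _ Cz])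
        ultimately show ?thesis using C by (simp add: \<psi>_def)
      next
        case False
        then have dz: "\<Theta> * r \<le> dist c z" using zD by (auto simp: D_def dist_commute not_le not_less)
        have "kern y z \<le> b" if "y \<in> Y" for y
        proof -
          have "dist c y \<le> r" using that Y(2) by auto
          \<comment> \<open>The ratio of the two constants of \<open>q\<close> in \<Theta> converts
            the estimate by \<open>q_lo\<close> into one by \<open>q_up\<close>, comparable with the
            near value 9 q_up r^2.\<close>
          then have "4 * sqrt (q_up / q_lo) * r \<le> dist z y"
            using dz dist_triangle2[of c z y] by (simp add: \<Theta>_def algebra_simps)
          then have "kern y z \<le> (q_lo * (4 * sqrt (q_up / q_lo) * r)\<^sup>2) powr p2"
            using q_lo_pos q_up_pos r by (intro kern_le) auto
          also have "q_lo * (4 * sqrt (q_up / q_lo) * r)\<^sup>2 = 16 * q_up * r\<^sup>2"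
            using q_lo_pos q_up_pos by (simp add: power_mult_distrib)
          finally show ?thesis by (simp add: b_def)
        qed
        then have "?P z \<le> real (card Y) * b" by (simp add: sum_bounded_above)
        then have "\<psi> z \<le> 0" unfolding \<psi>_def using a C by (intro mult_nonneg_nonpos) auto
        then show ?thesis using v0[OF zc] by linarith
      qed
      moreover have "continuous_on (S \<inter> cball c (\<Theta> * r)) (\<lambda>x. v x - \<psi> x)"
        using continuous_on_subset[OF v(2) \<Omega>] continuous_on_subset[OF C2_cont[OF PC] YS]
        by (auto intro!: continuous_intros elim: continuous_on_subset)
      moreover have "D \<subseteq> S \<inter> cball c (\<Theta> * r)" using DS by (auto simp: D_def)
      ultimately show "\<exists>d>0. \<forall>x\<in>D. dist x z < d \<longrightarrow> - e \<le> v x - \<psi> x"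
        using zS zc e by (intro frontier_bound[of "S \<inter> cball c (\<Theta> * r)"]) auto
    qed
    moreover have "real (card Y) * (9 * q_up * r\<^sup>2) powr p2 \<le> ?P x"
    proof (rule sum_bounded_below)
      fix y assume y: "y \<in> Y"
      have "dist c y \<le> r" using y Y(2) by auto
      then have "dist x y \<le> 3 * r" using x dist_triangle2[of x y c] by (simp add: dist_commute)
      moreover have "x \<noteq> y" using True DS YS y by blast
      ultimately show "(9 * q_up * r\<^sup>2) powr p2 \<le> kern y x"
        using kern_ge[of x y "3 * r"] by (simp add: power_mult_distrib mult_ac)
    qed
    then have "a / C * (real (card Y) * \<gamma> r) \<le> \<psi> x"
      unfolding \<psi>_def \<gamma>_def b_def using a C by (intro mult_left_mono) (auto simp: algebra_simps)
    ultimately show ?thesis by linarith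
  qed
qed

end

section \<open>Propagation of positivity\<close>

context elliptic
begin

text \<open>A single pole at \<open>c\<close>: the kernel is at most \<open>C\<close> at distance
  \<open>h\<close> and beyond. This carries a bound from an arbitrarily small ball to the fixed
  radius 2 r, with a constant that does not depend on \<open>v\<close>, \<open>c\<close> or
  \<open>\<Omega>\<close>.\<close>

lemma growth_ball:
  assumes "0 < r" "0 < h"
  shows "\<exists>\<delta>>0. \<forall>\<Omega> v c. supersol \<Omega> v \<and> continuous_on \<Omega> v \<and> cball c (\<Theta> * r) \<subseteq> \<Omega> \<and>
     (\<forall>x\<in>\<Omega>. 0 \<le> v x) \<and> (\<forall>x\<in>\<Omega>. dist x c \<le> h \<longrightarrow> a \<le> v x) \<and> 0 < a \<longrightarrow>
     (\<forall>x. dist c x < 2 * r \<longrightarrow> min a (a * \<delta>) \<le> v x)"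
proof -
  define C where "C = (q_lo * h\<^sup>2) powr p2"
  have C: "C > 0" using q_lo_pos assms by (simp add: C_def)
  show ?thesis
  proof (intro exI[of _ "\<gamma> r / C"] conjI allI impI; (elim conjE)?)
    show "0 < \<gamma> r / C" using C \<gamma>_pos assms by simp
    fix \<Omega> v c x
    assume v: "supersol \<Omega> v" "continuous_on \<Omega> v" "cball c (\<Theta> * r) \<subseteq> \<Omega>"
     "\<forall>x\<in>\<Omega>. 0 \<le> v x" "\<forall>x\<in>\<Omega>. dist x c \<le> h \<longrightarrow> a \<le> v x" "0 < a" and x: "dist c x < 2 * r"
    have "min a (a / C * (real (card {c}) * \<gamma> r)) \<le> v x"
      by (rule growth[where Y = "{c}" and h = h and \<Omega> = \<Omega> and c = c, OF _ _ _ assms v(1-3) _ v(6) _ C(1) _ x])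
        (use v assms kern_le[of h _ c] in \<open>auto simp: C_def\<close>)
    then show "min a (a * (\<gamma> r / C)) \<le> v x" by simp
  qed
qed

text \<open>The points near which all admissible \<open>v\<close> share one positive lower bound
  form a set that is open and, by \<open>growth_ball\<close>, relatively closed. Uniformity is built
  into \<open>good\<close>, which quantifies over \<open>v\<close> after the constant; compactness
  of \<open>C\<close> leaves finitely many constants.\<close>

lemma propagation:
  assumes \<Omega>: "open \<Omega>" "connected \<Omega>" and x0: "x0 \<in> \<Omega>" "0 < r0" and C: "compact C" "C \<subseteq> \<Omega>"
  shows "\<exists>\<delta>>0. \<forall>v. supersol \<Omega> v \<and> continuous_on \<Omega> v \<and> (\<forall>x\<in>\<Omega>. 0 \<le> v x) \<and>
     (\<forall>x\<in>ball x0 r0 \<inter> \<Omega>. 1 \<le> v x) \<longrightarrow> (\<forall>x\<in>C. \<delta> \<le> v x)"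
proof -
  define P where "P = (\<lambda>v. supersol \<Omega> v \<and> continuous_on \<Omega> v \<and> (\<forall>x\<in>\<Omega>. 0 \<le> v x) \<and>
     (\<forall>x\<in>ball x0 r0 \<inter> \<Omega>. 1 \<le> v x))"
  define good where "good = (\<lambda>x \<rho> \<delta>. \<rho> > 0 \<and> \<delta> > 0 \<and> (\<forall>v. P v \<longrightarrow> (\<forall>y\<in>ball x \<rho> \<inter> \<Omega>. \<delta> \<le> v y)))"
  define G where "G = {x \<in> \<Omega>. \<exists>\<rho> \<delta>. good x \<rho> \<delta>}"
  have "good x0 r0 1" using x0 by (auto simp: good_def P_def)
  then have x0G: "x0 \<in> G" using x0 by (auto simp: G_def)
  have "open G"
    unfolding open_contains_ball
  proof
    fix x assume "x \<in> G"
    then obtain \<rho> \<delta> where g: "x \<in> \<Omega>" "good x \<rho> \<delta>" by (auto simp: G_def)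
    obtain e where e: "e > 0" "ball x e \<subseteq> \<Omega>" using \<Omega>(1) g(1) open_contains_ball by blast
    have "y \<in> G" if y: "y \<in> ball x (min e \<rho>)" for y
    proof -
      have "ball y (\<rho> - dist x y) \<subseteq> ball x \<rho>" by (rule ball_subset_ball_iff[THEN iffD2]) (auto simp: dist_commute)
      then have "good y (\<rho> - dist x y) \<delta>"
        using g(2) y unfolding good_def by (auto simp: subset_iff)
      then show ?thesis using y e by (auto simp: G_def)
    qed
    then show "\<exists>e>0. ball x e \<subseteq> G" using e g by (intro exI[of _ "min e \<rho>"]) (auto simp: good_def)
  qed
  moreover have "open (\<Omega> - G)"
    unfolding open_contains_ball
  proof
    fix x assume x: "x \<in> \<Omega> - G"
    obtain e where e: "e > 0" "ball x e \<subseteq> \<Omega>" using \<Omega>(1) x open_contains_ball by blast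
    \<comment> \<open>Makes r + \<Theta> r < e: for every y within r of x the ball of radius
      \<Theta> r about y stays in \<open>\<Omega>\<close>, and the reach 2 r from y covers the ball
      of radius r about x.\<close>
    define r where "r = e / (2 * (\<Theta> + 1))"
    have r: "r > 0" using e \<Theta>_ge by (simp add: r_def)
    have "r * (\<Theta> + 1) = e / 2" using \<Theta>_ge by (simp add: r_def divide_simps)
    then have re: "r + \<Theta> * r < e" using e by (simp add: algebra_simps)
    have "r \<le> \<Theta> * r" using \<Theta>_ge r by simp
    with re have r': "r < e" using r by linarith
    have "y \<notin> G" if y: "dist x y < r" for y
    proof
      assume "y \<in> G"
      then obtain \<rho> \<delta> where g: "y \<in> \<Omega>" "good y \<rho> \<delta>" by (auto simp: G_def)
      then have g0: "\<rho> / 2 > 0" "\<delta> > 0" by (auto simp: good_def)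
      from growth_ball[OF r g0(1), of \<delta>] obtain \<delta>' where d': "\<delta>' > 0" and
        gr: "\<forall>\<Omega> v c. supersol \<Omega> v \<and> continuous_on \<Omega> v \<and> cball c (\<Theta> * r) \<subseteq> \<Omega> \<and>
     (\<forall>x\<in>\<Omega>. 0 \<le> v x) \<and> (\<forall>x\<in>\<Omega>. dist x c \<le> \<rho> / 2 \<longrightarrow> \<delta> \<le> v x) \<and> 0 < \<delta> \<longrightarrow>
     (\<forall>x. dist c x < 2 * r \<longrightarrow> min \<delta> (\<delta> * \<delta>') \<le> v x)"
        by (elim exE conjE)
      have sub: "cball y (\<Theta> * r) \<subseteq> \<Omega>"
      proof
        fix z assume "z \<in> cball y (\<Theta> * r)"
        then have "dist x z < e" using dist_triangle[of x z y] y re by auto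
        then show "z \<in> \<Omega>" using e by auto
      qed
      have "good x r (min \<delta> (\<delta> * \<delta>'))"
        unfolding good_def
      proof (intro conjI allI impI ballI)
        fix v z assume v: "P v" and z: "z \<in> ball x r \<inter> \<Omega>"
        have "\<forall>x\<in>\<Omega>. dist x y \<le> \<rho> / 2 \<longrightarrow> \<delta> \<le> v x"
          using g(2) v unfolding good_def by (auto simp: dist_commute)
        moreover have "dist y z < 2 * r" using dist_triangle3[of y z x] y z by auto
        moreover note v[unfolded P_def]
        ultimately show "min \<delta> (\<delta> * \<delta>') \<le> v z"
          using gr[rule_format, of \<Omega> v y z] v sub g0 by (simp add: P_def)
      qed (use r g0 d' in auto)
      then show False using x by (auto simp: G_def)
    qed
    moreover have "ball x r \<subseteq> \<Omega>" using e r' by auto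
    ultimately show "\<exists>e>0. ball x e \<subseteq> \<Omega> - G" using r by (intro exI[of _ r]) auto
  qed
  moreover have "G \<subseteq> \<Omega>" by (auto simp: G_def)
  ultimately have "G = \<Omega>"
    using connectedD[OF \<Omega>(2), of G "\<Omega> - G"] x0G by blast
  then have "\<forall>x\<in>C. \<exists>\<rho> \<delta>. good x \<rho> \<delta>" using C(2) unfolding G_def by blast
  then obtain \<rho> \<delta> where g: "\<And>x. x \<in> C \<Longrightarrow> good x (\<rho> x) (\<delta> x)" by metis
  have "C \<subseteq> (\<Union>x\<in>C. ball x (\<rho> x))" using g by (force simp: good_def)
  then obtain F where F: "F \<subseteq> C" "finite F" "C \<subseteq> (\<Union>x\<in>F. ball x (\<rho> x))"
    using compactE_image[OF C(1), of C "\<lambda>x. ball x (\<rho> x)"] by auto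
  define m where "m = Min (insert 1 (\<delta> ` F))"
  have m: "m > 0" "\<And>x. x \<in> F \<Longrightarrow> m \<le> \<delta> x"
    using F g unfolding m_def by (auto simp: good_def)
  have "m \<le> v x" if v: "P v" and x: "x \<in> C" for v x
  proof -
    from x F obtain y where y: "y \<in> F" "x \<in> ball y (\<rho> y)" by auto
    moreover have "x \<in> \<Omega>" "y \<in> C" using x C(2) y(1) F(1) by auto
    ultimately have "\<delta> y \<le> v x" using g[of y] v unfolding good_def by blast
    then show ?thesis using m(2)[OF y(1)] by linarith
  qed
  then show ?thesis using m(1) unfolding P_def by blast
qed

text \<open>At each grid point one of the functions is at least 1/2, so one of them owns N^n / 2
  poles; against the kernel bound C N^n the number N cancels. Hence \<delta> does not see the mesh,
  which has to follow the moduli of continuity of \<open>v1\<close> and \<open>v2\<close>.\<close>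

lemma halving:
  assumes r: "0 < r" and \<Omega>: "cball c (\<Theta> * r) \<subseteq> \<Omega>"
  shows "\<exists>\<delta>>0. \<forall>v1 v2. solution \<Omega> v1 \<and> solution \<Omega> v2 \<and> (\<forall>x\<in>\<Omega>. 0 \<le> v1 x) \<and> (\<forall>x\<in>\<Omega>. 0 \<le> v2 x) \<and>
     (\<forall>x\<in>cball c r. 1 \<le> v1 x + v2 x) \<longrightarrow>
     (\<forall>x\<in>ball c r. \<delta> \<le> v1 x) \<or> (\<forall>x\<in>ball c r. \<delta> \<le> v2 x)"
proof -
  define n where "n = real CARD('n)"
  have n: "n \<ge> 2" using dim by (simp add: n_def)
  \<comment> \<open>The constant of \<open>sum_grid_le\<close> for h = r / (n N), where h^(1-n) N =
    (r/n)^(1-n) N^n.\<close>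
  define C where "C = q_lo powr p2 * (4 * (n + 2)) powr n * (r / n) powr (1 - n)"
  have C: "C > 0" using q_lo_pos n r by (simp add: C_def)
  \<comment> \<open>Values at the poles are at least 1/2 and vary by less than 1/4 within
    \<open>h\<close>, so \<open>growth\<close> is used with a = 1/4; the second entry is (1/4) / (C
    N^n) times N^n / 2 times \<gamma> r.\<close>
  define \<delta> where "\<delta> = min (1/4) (\<gamma> r / (8 * C))"
  have \<delta>: "\<delta> > 0" using C \<gamma>_pos[OF r] by (simp add: \<delta>_def)
  have rT: "r \<le> \<Theta> * r" "2 * r \<le> \<Theta> * r" using \<Theta>_ge r by auto
  show ?thesis
  proof (intro exI[of _ \<delta>] conjI allI impI \<delta>; elim conjE)
    fix v1 v2
    assume v1: "solution \<Omega> v1" and v2: "solution \<Omega> v2" and nn: "\<forall>x\<in>\<Omega>. 0 \<le> v1 x" "\<forall>x\<in>\<Omega>. 0 \<le> v2 x"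
      and sum: "\<forall>x\<in>cball c r. 1 \<le> v1 x + v2 x"
    have uc: "\<exists>d>0. \<forall>x\<in>cball c (\<Theta> * r). \<forall>y\<in>cball c (\<Theta> * r). dist x y < d \<longrightarrow> dist (v x) (v y) < 1 / 4"
      if "solution \<Omega> v" for v
    proof -
      have "continuous_on (cball c (\<Theta> * r)) v" using that \<Omega> by (auto simp: solution_def intro: continuous_on_subset)
      then have "uniformly_continuous_on (cball c (\<Theta> * r)) v" by (rule compact_uniformly_continuous) auto
      then show ?thesis unfolding uniformly_continuous_on_def by (metis dist_commute zero_less_divide_1_iff zero_less_numeral)
    qed
    from uc[OF v1] uc[OF v2] obtain d1 d2 where d1: "d1 > 0"
      "\<And>x y. x \<in> cball c (\<Theta> * r) \<Longrightarrow> y \<in> cball c (\<Theta> * r) \<Longrightarrow> dist x y < d1 \<Longrightarrow> dist (v1 x) (v1 y) < 1 / 4"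
      and d2: "d2 > 0"
      "\<And>x y. x \<in> cball c (\<Theta> * r) \<Longrightarrow> y \<in> cball c (\<Theta> * r) \<Longrightarrow> dist x y < d2 \<Longrightarrow> dist (v2 x) (v2 y) < 1 / 4"
      by metis
    obtain N0 :: nat where N0: "r / (n * min d1 d2) < real N0" using reals_Archimedean2 by blast
    define N where "N = max 1 N0"
    have N: "1 \<le> N" by (simp add: N_def)
    \<comment> \<open>With this spacing \<open>grid_dist\<close> keeps the grid inside
      \<open>cball c r\<close>, and N is large enough to bring \<open>h\<close> below both
      moduli.\<close>
    define h where "h = r / (n * real N)"
    have h: "h > 0" using r n N by (simp add: h_def)
    have hd: "h < d1" "h < d2"
    proof -
      define m where "m = min d1 d2"
      have m: "m > 0" "r / (n * m) < real N" using N0 d1 d2 by (auto simp: N_def m_def)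
      then have "r < real N * (n * m)" using n by (simp add: pos_divide_less_eq)
      then have "h < m" using n N by (simp add: h_def pos_divide_less_eq mult_ac)
      then have "h < min d1 d2" by (simp add: m_def)
      then show "h < d1" "h < d2" by auto
    qed
    define Y where "Y = grid c h N"
    have Yc: "Y \<subseteq> cball c r"
      using grid_dist[OF h, of _ c N] n N by (auto simp: Y_def h_def n_def)
    define Y1 where "Y1 = {y\<in>Y. 1/2 \<le> v1 y}"
    define Y2 where "Y2 = {y\<in>Y. 1/2 \<le> v2 y}"
    have "Y = Y1 \<union> Y2" using sum Yc by (force simp: Y1_def Y2_def)
    then have "N ^ CARD('n) \<le> card Y1 + card Y2"
      using card_Un_le[of Y1 Y2] card_grid[OF h, of c N] by (simp add: Y_def)
    then have "real (N ^ CARD('n)) \<le> real (card Y1 + card Y2)" by (rule of_nat_mono)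
    then have half: "real N powr n / 2 \<le> real (card Y1) \<or> real N powr n / 2 \<le> real (card Y2)"
      using N by (auto simp: n_def powr_realpow)
    have key: "\<forall>x\<in>ball c r. \<delta> \<le> v x"
      if v: "solution \<Omega> v" "\<forall>x\<in>\<Omega>. 0 \<le> v x"
        and d: "\<And>x y. x \<in> cball c (\<Theta> * r) \<Longrightarrow> y \<in> cball c (\<Theta> * r) \<Longrightarrow> dist x y < d \<Longrightarrow> dist (v x) (v y) < 1 / 4"
        and hd: "h < d" and Y': "Y' = {y\<in>Y. 1/2 \<le> v y}" "real N powr n / 2 \<le> real (card Y')" for v d Y'
    proof
      fix x assume x: "x \<in> ball c r"
      define H where "H = C * real N powr n"
      have H: "H > 0" using C N by (simp add: H_def)
      have Nn: "real N powr n > 0" using N by simp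
      have ne: "Y' \<noteq> {}" using Y'(2) Nn by auto
      have fin: "finite Y'" using finite_grid[OF h, of c N] Y'(1) by (simp add: Y_def)
      have bd: "(\<Sum>y\<in>Y'. kern y x) \<le> H" if x: "\<And>y. y \<in> Y' \<Longrightarrow> h \<le> dist x y" for x
      proof -
        have "(\<Sum>y\<in>Y'. kern y x) \<le> (\<Sum>y\<in>Y'. q_lo powr p2 * dist x y powr (1 - n))"
        proof (rule sum_mono)
          fix y assume y: "y \<in> Y'"
          have d0: "0 < dist x y" using x[OF y] h by linarith
          have "kern y x \<le> (q_lo * (dist x y)\<^sup>2) powr p2" by (rule kern_le[OF d0]) simp
          also have "\<dots> = q_lo powr p2 * ((dist x y)\<^sup>2) powr p2"
            using q_lo_pos by (intro powr_mult)
          also have "((dist x y)\<^sup>2) powr p2 = dist x y powr (1 - n)"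
          proof -
            have "2 * p2 = 1 - n" by (simp add: p2_def n_def)
            then show ?thesis using d0 by (simp add: powr_powr flip: powr_numeral)
          qed
          finally show "kern y x \<le> q_lo powr p2 * dist x y powr (1 - n)" .
        qed
        also have "\<dots> = q_lo powr p2 * (\<Sum>y\<in>Y'. dist x y powr (1 - n))" by (simp add: sum_distrib_left)
        also have "\<dots> \<le> q_lo powr p2 * ((4 * (n + 2)) powr n * h powr (1 - n) * real N)"
          using sum_grid_le[OF h N, of Y' c x] x Y'(1)
          by (intro mult_left_mono) (auto simp: n_def Y_def)
        also have "h powr (1 - n) * real N = (r / n) powr (1 - n) * real N powr n"
        proof -
          have "h = r / n * inverse (real N)" by (simp add: h_def field_simps)
          then have "h powr (1 - n) = (r / n) powr (1 - n) * inverse (real N) powr (1 - n)"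
            by (simp only: powr_mult)
          also have "inverse (real N) powr (1 - n) = real N powr (n - 1)"
            using N by (simp add: powr_minus[symmetric] inverse_powr)
          finally show ?thesis using N powr_add[of "real N" "n - 1" 1] by simp
        qed
        then have "q_lo powr p2 * ((4 * (n + 2)) powr n * h powr (1 - n) * real N) = H"
          by (simp add: H_def C_def mult_ac)
        finally show ?thesis .
      qed
      have sup: "supersol \<Omega> v" "continuous_on \<Omega> v" using v(1) by (auto simp: solution_def)
      have "min (1/4) ((1/4) / H * (real (card Y') * \<gamma> r)) \<le> v x"
      proof (rule growth[OF fin _ ne r h sup \<Omega> _ _ _ H bd])
        show "Y' \<subseteq> cball c r" using Yc Y'(1) by auto
        show "0 \<le> v x" if "x \<in> cball c (\<Theta> * r)" for x using that \<Omega> v(2) by blast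
        show "dist c x < 2 * r" using x r by simp
        fix x y assume y: "y \<in> Y'" and xy: "dist x y \<le> h" and xc: "x \<in> cball c (\<Theta> * r)"
        have "y \<in> cball c (\<Theta> * r)" using y Yc Y'(1) rT by fastforce
        then have "dist (v x) (v y) < 1/4" using d[OF xc] xy hd by auto
        moreover have "1/2 \<le> v y" using y Y'(1) by auto
        ultimately show "1/4 \<le> v x" unfolding dist_real_def by linarith
      qed auto
      moreover have "\<delta> \<le> min (1/4) ((1/4) / H * (real (card Y') * \<gamma> r))"
      proof -
        have "(1/4) / H * (real N powr n / 2 * \<gamma> r) \<le> (1/4) / H * (real (card Y') * \<gamma> r)"
          using Y'(2) H \<gamma>_pos[OF r] by (intro mult_left_mono mult_right_mono) auto
        moreover have "(1/4) / H * (real N powr n / 2 * \<gamma> r) = \<gamma> r / (8 * C)"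
          using N C by (simp add: H_def field_simps)
        ultimately show ?thesis by (auto simp: \<delta>_def)
      qed
      ultimately show "\<delta> \<le> v x" by linarith
    qed
    from half show "(\<forall>x\<in>ball c r. \<delta> \<le> v1 x) \<or> (\<forall>x\<in>ball c r. \<delta> \<le> v2 x)"
      using key[OF v1 nn(1) d1(2) hd(1) Y1_def] key[OF v2 nn(2) d2(2) hd(2) Y2_def] by blast
  qed
qed

end

section \<open>The cone and the Hopf lemma\<close>

lemma mem_trunc_cone:
  assumes "S \<subseteq> unit_sphere"
  shows "x \<in> trunc_cone S t \<longleftrightarrow> x \<noteq> 0 \<and> x /\<^sub>R norm x \<in> S \<and> norm x < t"
proof
  assume "x \<in> trunc_cone S t"
  then obtain r \<sigma> where r: "x = r *\<^sub>R \<sigma>" "\<sigma> \<in> S" "0 < r" "r < t" by (auto simp: trunc_cone_def)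
  then have "norm \<sigma> = 1" using assms by auto
  then show "x \<noteq> 0 \<and> x /\<^sub>R norm x \<in> S \<and> norm x < t" using r by auto
next
  assume "x \<noteq> 0 \<and> x /\<^sub>R norm x \<in> S \<and> norm x < t"
  then show "x \<in> trunc_cone S t"
    unfolding trunc_cone_def by (intro CollectI exI[of _ "norm x"] exI[of _ "x /\<^sub>R norm x"]) auto
qed

lemma homogeneous_ext_scale:
  "0 < r \<Longrightarrow> homogeneous_ext a f (r *\<^sub>R x) = r powr a * homogeneous_ext a f x"
  by (cases "x = 0") (simp_all add: homogeneous_ext_def powr_mult field_simps)

lemma sph_closure_eq:
  assumes "S \<subseteq> unit_sphere"
  shows "sph_closure S = closure S"
proof -
  have "closure S \<subseteq> unit_sphere" using assms by (intro closure_minimal) auto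
  then show ?thesis
    using assms by (auto simp: sph_closure_def closure_of_subtopology Int_absorb1)
qed

text \<open>\<open>wt\<close> extends the homogeneous solution as a C2 function across the lateral
  boundary, which gives a meaning to its gradient and Hessian at boundary points. \<open>W\<close>
  is a neighbourhood of the closed cone without its vertex.\<close>

locale cone_problem = elliptic A l for A :: "real^'n^'n" and l :: real +
  fixes S :: "(real^'n) set" and \<kappa> :: real and \<phi> :: "real^'n \<Rightarrow> real"
    and W :: "(real^'n) set" and wt :: "real^'n \<Rightarrow> real" and Gw Hw
  assumes S: "sph_domain S" and S_smooth: "smooth_sph_boundary S"
    and \<kappa>: "0 < \<kappa>"
    and w_sol: "solution (trunc_cone S 1) (homogeneous_ext \<kappa> \<phi>)"
    and \<phi>0: "\<And>\<sigma>. \<sigma> \<in> sph_boundary S \<Longrightarrow> \<phi> \<sigma> = 0"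
    and \<phi>_pos: "\<And>\<sigma>. \<sigma> \<in> S \<Longrightarrow> 0 < \<phi> \<sigma>"
    and \<phi>_le: "\<And>\<sigma>. \<sigma> \<in> sph_closure S \<Longrightarrow> \<phi> \<sigma> \<le> 1"
    and \<phi>_1: "\<exists>\<sigma>\<in>sph_closure S. \<phi> \<sigma> = 1"
    and W: "open W" "\<And>x. x \<noteq> 0 \<Longrightarrow> x /\<^sub>R norm x \<in> sph_closure S \<Longrightarrow> x \<in> W"
    and wt: "C2 W wt Gw Hw"
    and wt_eq: "\<And>x. x \<noteq> 0 \<Longrightarrow> x /\<^sub>R norm x \<in> sph_closure S \<Longrightarrow> wt x = homogeneous_ext \<kappa> \<phi> x"
begin

abbreviation K :: "real \<Rightarrow> (real^'n) set" where "K t \<equiv> trunc_cone S t"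
abbreviation w :: "real^'n \<Rightarrow> real" where "w \<equiv> homogeneous_ext \<kappa> \<phi>"

text \<open>The vertex is left out since a function of degree \<kappa> need not be differentiable
  there.\<close>

definition CC :: "(real^'n) set" where
  "CC = {x. x \<noteq> 0 \<and> x /\<^sub>R norm x \<in> sph_closure S}"

lemma S_sphere: "S \<subseteq> unit_sphere"
  using S openin_imp_subset by (auto simp: sph_domain_def)

lemmas mem_K = mem_trunc_cone[OF S_sphere]

lemma sph_closure_S: "sph_closure S = closure S" by (rule sph_closure_eq[OF S_sphere])

lemma closure_S: "compact (closure S)" "closure S \<subseteq> unit_sphere" "S \<subseteq> closure S"
proof -
  show "closure S \<subseteq> unit_sphere" using S_sphere by (intro closure_minimal) auto
  then show "compact (closure S)"
    by (simp add: compact_eq_bounded_closed bounded_subset[OF bounded_sphere])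
qed (rule closure_subset)

lemma sph_boundary_S: "sph_boundary S = closure S - S"
  using S interior_of_eq[of "top_of_set unit_sphere" S] sph_closure_S
  unfolding sph_boundary_def frontier_of_def sph_closure_def sph_domain_def by auto

lemma K_mono: "s \<le> t \<Longrightarrow> K s \<subseteq> K t"
  by (auto simp: mem_K)

lemma K_scale: "0 < r \<Longrightarrow> r *\<^sub>R x \<in> K t \<longleftrightarrow> x \<in> K (t / r)"
  by (auto simp: mem_K field_simps)

lemma K_CC: "x \<in> K t \<Longrightarrow> x \<in> CC"
  using closure_S by (auto simp: mem_K CC_def sph_closure_S)

lemma CC_W: "CC \<subseteq> W" using W(2) by (auto simp: CC_def)

lemma wt_CC: "x \<in> CC \<Longrightarrow> wt x = w x" using wt_eq by (auto simp: CC_def)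

lemma K_bounded: "bounded (K t)"
  by (rule bounded_subset[OF bounded_ball[of 0 t]]) (auto simp: mem_K)

lemma K_open: "open (K t)"
proof -
  from S obtain U where U: "open U" "S = unit_sphere \<inter> U"
    unfolding sph_domain_def openin_open by auto
  have "K t = {x. x \<noteq> 0 \<and> x /\<^sub>R norm x \<in> U} \<inter> ball 0 t"
    unfolding set_eq_iff mem_K using U(2) by auto
  then show ?thesis using open_cone_over[OF U(1)] by auto
qed

lemma K_connected: "connected (K t)"
proof -
  have "K t = (\<lambda>(r, \<sigma>). r *\<^sub>R \<sigma>) ` ({0<..<t} \<times> S)"
    by (force simp: trunc_cone_def)
  moreover have "connected ({0<..<t} \<times> S)"
    using S by (intro connected_Times) (auto simp: sph_domain_def)
  ultimately show ?thesis
    by (auto intro!: connected_continuous_image continuous_intros simp: case_prod_unfold)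
qed

lemma closure_K: "x \<in> closure (K t) \<Longrightarrow> x = 0 \<or> x \<in> CC \<and> norm x \<le> t"
proof -
  assume x: "x \<in> closure (K t)"
  let ?T = "(\<lambda>(r, \<sigma>). r *\<^sub>R \<sigma>) ` ({0..t} \<times> closure S)"
  have "compact ?T"
    using closure_S by (intro compact_continuous_image compact_Times)
      (auto intro!: continuous_intros simp: case_prod_unfold)
  moreover have "K t \<subseteq> ?T" using closure_S by (force simp: trunc_cone_def)
  ultimately have "x \<in> ?T" using x closure_minimal compact_imp_closed by blast
  then obtain r \<sigma> where r: "x = r *\<^sub>R \<sigma>" "0 \<le> r" "r \<le> t" "\<sigma> \<in> closure S" by auto
  then have "norm \<sigma> = 1" using closure_S by auto
  then show ?thesis using r by (cases "r = 0") (auto simp: CC_def sph_closure_S)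
qed

lemma w_pos: "x \<in> K t \<Longrightarrow> 0 < w x"
  using \<phi>_pos by (auto simp: mem_K homogeneous_ext_def)

lemma \<phi>_nonneg: "\<sigma> \<in> closure S \<Longrightarrow> 0 \<le> \<phi> \<sigma>"
  using \<phi>_pos \<phi>0 sph_boundary_S by (metis DiffI less_eq_real_def order_refl)

lemma w_nonneg: "x \<in> CC \<Longrightarrow> 0 \<le> w x"
  using \<phi>_nonneg by (auto simp: CC_def homogeneous_ext_def sph_closure_S)

lemma w_0 [simp]: "w 0 = 0" by (simp add: homogeneous_ext_def)

lemma w_eq_0: "x \<in> CC \<Longrightarrow> x /\<^sub>R norm x \<notin> S \<Longrightarrow> w x = 0"
  using \<phi>0 by (auto simp: CC_def homogeneous_ext_def sph_closure_S sph_boundary_S)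

lemma w_le: "x \<in> CC \<Longrightarrow> w x \<le> norm x powr \<kappa>"
  using \<phi>_le by (auto simp: CC_def homogeneous_ext_def sph_closure_S mult_left_le)

lemma w_le_1: "x \<in> CC \<Longrightarrow> norm x \<le> 1 \<Longrightarrow> w x \<le> 1"
  using w_le[of x] powr_mono2[of \<kappa> "norm x" 1] \<kappa> by auto

lemma w_continuous: "continuous_on (CC \<union> {0}) w"
proof -
  have "continuous_on CC wt" using C2_cont[OF wt] CC_W continuous_on_subset by blast
  then have c: "continuous_on CC w" using wt_CC by (simp cong: continuous_on_cong)
  show ?thesis
    unfolding continuous_on_def
  proof
    fix x assume x: "x \<in> CC \<union> {0}"
    show "(w \<longlongrightarrow> w x) (at x within CC \<union> {0})"
    proof (cases "x = 0")
      case False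
      then have "x \<in> CC" using x by auto
      then have "(w \<longlongrightarrow> w x) (at x within CC)" using c by (auto simp: continuous_on_def)
      moreover have "at x within CC \<union> {0} = at x within CC"
        by (rule at_within_nhd[of x "UNIV - {0}"]) (use False in auto)
      ultimately show ?thesis by simp
    next
      case True
      have "continuous_on UNIV (\<lambda>x::real^'n. norm x powr \<kappa>)"
        using \<kappa> by (intro continuous_on_powr' continuous_intros) auto
      then have "((\<lambda>x. norm x powr \<kappa>) \<longlongrightarrow> norm x powr \<kappa>) (at x within CC \<union> {0})"
        by (meson UNIV_I continuous_on_def subset_UNIV tendsto_within_subset)
      then have l: "((\<lambda>x. norm x powr \<kappa>) \<longlongrightarrow> 0) (at x within CC \<union> {0})" using True by simp
      have "(w \<longlongrightarrow> 0) (at x within CC \<union> {0})"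
      proof (rule Lim_null_comparison[OF _ l])
        show "\<forall>\<^sub>F x in at x within CC \<union> {0}. norm (w x) \<le> norm x powr \<kappa>"
          unfolding eventually_at by (rule exI[of _ 1]) (use w_nonneg w_le in auto)
      qed
      then show ?thesis using True by simp
    qed
  qed
qed

lemma K1_W: "K t \<subseteq> W" using K_CC CC_W by blast

lemma w_C2: "C2 (K t) w Gw Hw"
  by (rule C2_cong[OF C2_subset[OF wt K1_W] K_open]) (use wt_CC K_CC in auto)

text \<open>\<open>w\<close> is C2 in the cone and serves as its own test function from both
  sides.\<close>

lemma L_w: "x \<in> K 1 \<Longrightarrow> A \<bullet> Hw x = 0"
proof -
  assume x: "x \<in> K 1"
  have "A \<bullet> Hw x \<le> 0"
    using w_sol by (intro supersolD[where v = w and \<psi> = w, OF _ K_open x order_refl w_C2]) (auto simp: solution_def)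
  moreover have "A \<bullet> ((-1) *\<^sub>R Hw x) \<le> 0"
    using w_sol by (intro supersolD[where v = "\<lambda>x. - w x" and \<psi> = "\<lambda>x. (-1) * w x", OF _ K_open x order_refl C2_scale[OF w_C2]])
      (auto simp: solution_def)
  ultimately show ?thesis by simp
qed

lemma solution_sub_w:
  assumes "solution (K 1) v"
  shows "solution (K 1) (\<lambda>x. v x - c * w x)"
  using solution_add_C2[OF assms C2_scale[OF w_C2, where c = "-c"]] L_w by simp

section \<open>Minimum principle on truncated cones\<close>

lemma frontier_K:
  assumes "z \<in> frontier (K t)" "t < s" "0 < t"
  shows "z \<in> K s \<and> norm z = t \<or> z \<in> CC \<union> {0} \<and> w z = 0 \<and> norm z \<le> t"
proof -
  have z: "z \<in> closure (K t)" "z \<notin> K t" using assms(1) K_open by (auto simp: frontier_def interior_open)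
  from closure_K[OF z(1)] show ?thesis
  proof
    assume zc: "z \<in> CC \<and> norm z \<le> t"
    show ?thesis
    proof (cases "z /\<^sub>R norm z \<in> S")
      case True
      then have "norm z = t" using z(2) zc by (auto simp: mem_K CC_def)
      then show ?thesis using True zc assms(2) by (auto simp: mem_K CC_def)
    next
      case False
      then show ?thesis using zc w_eq_0 by auto
    qed
  qed (use assms in auto)
qed

text \<open>The vertex is no special case: \<open>w\<close> vanishes there, so it is treated
  together with the lateral boundary, and only the cap |x| = t remains.\<close>

lemma minimum_principle_K:
  assumes v: "supersol (K 1) v" "continuous_on (K 1) v" and t: "0 < t" "t < 1"
    and cap: "\<And>x. x \<in> K 1 \<Longrightarrow> norm x = t \<Longrightarrow> 0 \<le> v x"
    and lat: "\<And>z e. z \<in> CC \<union> {0} \<Longrightarrow> norm z \<le> t \<Longrightarrow> w z = 0 \<Longrightarrow> 0 < e \<Longrightarrow>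
      \<exists>d>0. \<forall>x\<in>K 1. dist x z < d \<longrightarrow> - e \<le> v x"
    and x: "x \<in> K t"
  shows "0 \<le> v x"
proof (rule minimum_principle[OF K_open K_bounded _ _ _ x])
  have sub: "K t \<subseteq> K 1" using t by (intro K_mono) auto
  show "supersol (K t) v" "continuous_on (K t) v"
    using v sub supersol_subset continuous_on_subset by blast+
  fix z and e :: real assume z: "z \<in> frontier (K t)" and e: "0 < e"
  from frontier_K[OF z t(2,1)] show "\<exists>d>0. \<forall>x\<in>K t. dist x z < d \<longrightarrow> - e \<le> v x"
  proof
    assume "z \<in> K 1 \<and> norm z = t"
    then show ?thesis using cap e sub by (intro frontier_bound[OF v(2)]) auto
  next
    assume "z \<in> CC \<union> {0} \<and> w z = 0 \<and> norm z \<le> t"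
    then show ?thesis using lat[of z e] e sub by blast
  qed
qed

text \<open>\<open>w\<close> is continuous on the closed cone including the vertex, so a lower bound
  by a multiple of \<open>w\<close> makes the lower limit nonnegative wherever \<open>w\<close>
  vanishes.\<close>

lemma lateral_bound:
  assumes "\<And>x. x \<in> K 1 \<Longrightarrow> - (C * w x) \<le> v x" "z \<in> CC \<union> {0}" "w z = 0" "0 < e"
  shows "\<exists>d>0. \<forall>x\<in>K 1. dist x z < d \<longrightarrow> - e \<le> v x"
proof -
  have "\<exists>d>0. \<forall>x\<in>K 1. dist x z < d \<longrightarrow> - e \<le> - (C * w x)"
    by (rule frontier_bound[where T = "CC \<union> {0}"])
      (use assms K_CC in \<open>auto intro!: continuous_intros w_continuous[simplified]\<close>)
  then show ?thesis using assms(1) by (meson order_trans)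
qed

text \<open>The barrier is \<open>\<sigma> + k \<sigma>\<^sup>2 - \<bar>x - z\<bar>\<^sup>2\<close>, where \<open>\<sigma>\<close> is the extension of degree zero of
  the defining function of \<open>S\<close> near \<open>z / \<bar>z\<bar>\<close>.\<close>

lemma hopf:
  assumes z: "z \<in> CC" "w z = 0" "norm z < 1"
  shows "Gw z \<noteq> 0"
proof
  assume Gz: "Gw z = 0"
  define p where "p = z /\<^sub>R norm z"
  have z0: "z \<noteq> 0" using z by (auto simp: CC_def)
  have p: "p \<in> closure S" "p \<notin> S"
    using z w_pos[of z 1] by (auto simp: CC_def p_def sph_closure_S mem_K)
  then have "p \<in> sph_boundary S" by (simp add: sph_boundary_S)
  from S_smooth[unfolded smooth_sph_boundary_def, rule_format, OF this] obtain U \<rho> v where U: "open U" "p \<in> U" "smooth_on UNIV U \<rho>"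
    "S \<inter> U = {x \<in> unit_sphere \<inter> U. 0 < \<rho> x}" "v \<bullet> p = 0" "frechet_derivative \<rho> (at p) v \<noteq> 0"
    by (elim exE conjE)
  from U(3) have "Ck_on 2 UNIV U \<rho>" by (simp add: smooth_on_def)
  then obtain G\<rho> H\<rho> where \<rho>: "C2 U \<rho> G\<rho> H\<rho>" by (rule Ck_on_imp_C2)
  define V where "V = {x. x \<noteq> 0 \<and> x /\<^sub>R norm x \<in> U}"
  have V: "open V" "z \<in> V" using open_cone_over[OF U(1)] U(2) z0 by (auto simp: V_def p_def)
  obtain G1 H1 where C1: "C2 V (homogeneous_ext 0 \<rho>) G1 H1"
    unfolding V_def by (rule C2_homogeneous_ext[OF \<rho>])
  define \<sigma> where "\<sigma> = homogeneous_ext 0 \<rho>"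
  note C1 = C1[folded \<sigma>_def]
  have \<sigma>: "\<sigma> x = \<rho> (x /\<^sub>R norm x)" if "x \<in> V" for x
    using that by (simp add: \<sigma>_def homogeneous_ext_def V_def)
  have VK: "x \<in> K 1 \<longleftrightarrow> 0 < \<sigma> x" if "x \<in> V" "norm x < 1" for x
  proof -
    have "x /\<^sub>R norm x \<in> unit_sphere \<inter> U" using that by (auto simp: V_def)
    then have "x /\<^sub>R norm x \<in> S \<longleftrightarrow> 0 < \<rho> (x /\<^sub>R norm x)" using U(4) by blast
    then show ?thesis using that \<sigma>[OF that(1)] by (auto simp: mem_K V_def)
  qed
  have \<sigma>z: "\<sigma> z = 0"
  proof -
    have "\<rho> p \<le> 0" using U(2,4) p closure_S by fastforce
    moreover have "\<not> \<rho> p < 0"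
    proof
      assume neg: "\<rho> p < 0"
      have "open (U \<inter> \<rho> -` {..<0})"
        by (rule continuous_open_preimage[OF C2_cont[OF \<rho>] U(1)]) auto
      moreover have "p \<in> (U \<inter> \<rho> -` {..<0}) \<inter> closure S" using p(1) neg U(2) by simp
      ultimately have "(U \<inter> \<rho> -` {..<0}) \<inter> S \<noteq> {}" using open_Int_closure_eq_empty by blast
      then obtain x where "x \<in> S" "x \<in> U" "\<rho> x < 0" by auto
      then have "x \<in> {x \<in> unit_sphere \<inter> U. 0 < \<rho> x}" using U(4) by blast
      then show False using \<open>\<rho> x < 0\<close> by simp
    qed
    ultimately show ?thesis using \<sigma>[OF V(2)] by (simp add: p_def)
  qed
  define \<nu> where "\<nu> = G1 z"
  \<comment> \<open>For a tangent vector \<open>v\<close> the radial correction in the derivative of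
    normalization drops out, so the derivative of \<sigma> along \<open>v\<close> is that of \<rho>
    divided by |z|.\<close>
  have \<nu>: "\<nu> \<noteq> 0"
  proof
    assume "\<nu> = 0"
    have "((\<lambda>x. \<rho> (x /\<^sub>R norm x)) has_derivative
       (\<lambda>h. G\<rho> p \<bullet> (inverse (norm z) *\<^sub>R h - (inverse (norm z) ^ 3 * (z \<bullet> h)) *\<^sub>R z))) (at z)"
      using has_derivative_compose[OF has_derivative_normalize(1)[OF z0] C2_D1[OF \<rho>, of "z /\<^sub>R norm z"]] U(2)
      by (simp add: p_def)
    then have "(\<sigma> has_derivative
       (\<lambda>h. G\<rho> p \<bullet> (inverse (norm z) *\<^sub>R h - (inverse (norm z) ^ 3 * (z \<bullet> h)) *\<^sub>R z))) (at z)"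
      by (rule has_derivative_transform_within_open[OF _ V]) (simp add: \<sigma>)
    from has_derivative_unique[OF this C2_D1[OF C1 V(2)]]
    have "G\<rho> p \<bullet> (inverse (norm z) *\<^sub>R v - (inverse (norm z) ^ 3 * (z \<bullet> v)) *\<^sub>R z) = G1 z \<bullet> v"
      by metis
    moreover have "z \<bullet> v = 0" using U(5) z0 by (simp add: p_def inner_commute)
    ultimately have "G\<rho> p \<bullet> v = 0" using \<open>\<nu> = 0\<close> z0 by (simp add: \<nu>_def)
    then show False using U(6) frechet_derivative_at[OF C2_D1[OF \<rho> U(2)]] by metis
  qed
  define c0 where "c0 = norm \<nu> / 2"
  have c0: "c0 > 0" using \<nu> by (simp add: c0_def)
  have "open (V \<inter> G1 -` {y. c0 < norm y})"
    by (rule continuous_open_preimage[OF C2_cont_G[OF C1] V(1)]) (intro open_Collect_less continuous_intros)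
  then have "open (V \<inter> G1 -` {y. c0 < norm y} \<inter> W \<inter> ball 0 1)" using W(1) by auto
  moreover have "z \<in> V \<inter> G1 -` {y. c0 < norm y} \<inter> W \<inter> ball 0 1"
    using V z CC_W c0 by (auto simp: c0_def \<nu>_def)
  ultimately obtain s where s: "s > 0" "cball z s \<subseteq> V \<inter> G1 -` {y. c0 < norm y} \<inter> W \<inter> ball 0 1"
    using open_contains_cball by meson
  have sV: "cball z s \<subseteq> V" and sW: "cball z s \<subseteq> W" using s(2) by auto
  have sx: "x \<in> V" "x \<in> W" "norm x < 1" "c0 \<le> norm (G1 x)" if "x \<in> cball z s" for x
    using s(2) that by (auto simp: subset_iff)
  have "continuous_on (cball z s) (\<lambda>x. A \<bullet> H1 x)"
    using continuous_on_subset[OF C2_cont_H[OF C1] sV] by (intro continuous_intros)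
  then have "bounded ((\<lambda>x. A \<bullet> H1 x) ` cball z s)" using compact_continuous_image compact_imp_bounded compact_cball by blast
  then have "\<exists>C. \<forall>x\<in>cball z s. \<bar>A \<bullet> H1 x\<bar> \<le> C" unfolding bounded_iff by simp
  then obtain C where C: "\<And>x. x \<in> cball z s \<Longrightarrow> \<bar>A \<bullet> H1 x\<bar> \<le> C" by blast
  have C0: "0 \<le> C" using C[of z] s(1) by auto
  define tr where "tr = A \<bullet> mat 1"
  have tr: "tr > 0" using A_mat1_pos by (simp add: tr_def)
  \<comment> \<open>The gradient term becomes at least 3 C + 2 tr + 1; it outweighs the term with
    \<open>H1\<close>, at most 3 C, and the paraboloid, 2 tr, with margin 1.\<close>
  define k where "k = (3 * C + 2 * tr + 1) / (2 * l * c0\<^sup>2)"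
  have k: "k > 0" "2 * k * (l * c0\<^sup>2) = 3 * C + 2 * tr + 1"
    using c0 l_pos C0 tr by (auto simp: k_def)
  \<comment> \<open>k \<tau> <= 1 keeps the factor 1 + 2 k \<sigma> at most 3 and k \<sigma>^2 at
    most \<tau>; 2 \<tau> <= s^2 makes \<open>b\<close> nonpositive on the sphere of radius
    \<open>s\<close> about \<open>z\<close>.\<close>
  define \<tau> where "\<tau> = min (1 / k) (s\<^sup>2 / 2)"
  have \<tau>: "\<tau> > 0" "k * \<tau> \<le> 1" "2 * \<tau> \<le> s\<^sup>2" using k s by (auto simp: \<tau>_def min_def field_simps)
  define b where "b = (\<lambda>x. \<sigma> x + k * (\<sigma> x * \<sigma> x) + (-1) * ((x - z) \<bullet> (mat 1 *v (x - z))))"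
  define Hb where "Hb = (\<lambda>x. H1 x + k *\<^sub>R (\<sigma> x *\<^sub>R H1 x + \<sigma> x *\<^sub>R H1 x + outer (G1 x) (G1 x) + outer (G1 x) (G1 x))
     + (-1) *\<^sub>R (2 *\<^sub>R mat 1))"
  define Gb where "Gb = (\<lambda>x. G1 x + k *\<^sub>R (\<sigma> x *\<^sub>R G1 x + \<sigma> x *\<^sub>R G1 x) + (-1) *\<^sub>R (2 *\<^sub>R (mat 1 *v (x - z))))"
  have bC: "C2 V b Gb Hb"
    unfolding b_def Hb_def Gb_def
    by (intro C2_add C2_scale C2_mult C2_quadratic C1) (simp add: sym_matrices_def)
  have b_eq: "b x = \<sigma> x + k * (\<sigma> x)\<^sup>2 - (norm (x - z))\<^sup>2" for x
    by (simp add: b_def power2_eq_square dot_square_norm)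
  \<comment> \<open>Its frontier lies in three pieces: \<sigma> = 0 on the lateral boundary, the
    level \<sigma> = \<tau>, which is a compact part of the cone, and the sphere about
    \<open>z\<close>.\<close>
  define D where "D = {x \<in> ball z s. 0 < \<sigma> x \<and> \<sigma> x < \<tau>}"
  have Dc: "D \<subseteq> cball z s" by (auto simp: D_def)
  have DK: "D \<subseteq> K 1" using VK sx Dc by (auto simp: D_def)
  have wD: "wt x = w x" if "x \<in> D" for x using that wt_CC K_CC DK by blast
  have "D = ball z s \<inter> \<sigma> -` {0<..<\<tau>}" by (auto simp: D_def)
  then have opD: "open D"
    using continuous_open_preimage[OF continuous_on_subset[OF C2_cont[OF C1], of "ball z s"], of "{0<..<\<tau>}"] sV
      ball_subset_cball[of z s] by (metis open_ball open_greaterThanLessThan order_trans)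
  have contc: "continuous_on (cball z s) \<sigma>" using C2_cont[OF C1] sV continuous_on_subset by blast
  define E where "E = {x \<in> cball z s. \<sigma> x = \<tau>}"
  have "closed E" unfolding E_def using continuous_closed_preimage_constant[OF contc] by auto
  then have cE: "compact E"
    unfolding E_def by (metis (no_types, lifting) bounded_cball bounded_subset compact_eq_bounded_closed mem_Collect_eq subsetI)
  have EK: "E \<subseteq> K 1" using VK sx \<tau> by (auto simp: E_def)
  obtain \<mu> where \<mu>: "\<mu> > 0" "\<And>x. x \<in> E \<Longrightarrow> \<mu> \<le> w x"
  proof (cases "E = {}")
    case False
    have "continuous_on E w" using w_sol EK by (auto simp: solution_def intro: continuous_on_subset)
    from continuous_attains_inf[OF cE False this] obtain y where "y \<in> E" "\<And>x. x \<in> E \<Longrightarrow> w y \<le> w x" by blast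
    then show ?thesis using that[of "w y"] w_pos EK by blast
  qed (use that[of 1] in auto)
  \<comment> \<open>On the level \<sigma> = \<tau> the barrier is at most 2 \<tau> and
    \<open>w\<close> at least \<mu>.\<close>
  define \<epsilon> where "\<epsilon> = \<mu> / (2 * \<tau>)"
  have \<epsilon>: "\<epsilon> > 0" "\<epsilon> * (2 * \<tau>) = \<mu>" using \<mu> \<tau> by (auto simp: \<epsilon>_def)
  have b_le: "b x \<le> 2 * \<tau> - (norm (x - z))\<^sup>2" if "0 \<le> \<sigma> x" "\<sigma> x \<le> \<tau>" for x
  proof -
    have "k * \<sigma> x \<le> k * \<tau>" using that k by (intro mult_left_mono) auto
    then have "k * \<sigma> x \<le> 1" using \<tau>(2) by linarith
    then have "(k * \<sigma> x) * \<sigma> x \<le> 1 * \<tau>" using that \<tau> k by (intro mult_mono) auto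
    then have "k * (\<sigma> x)\<^sup>2 \<le> \<tau>" by (simp add: power2_eq_square mult_ac)
    then show ?thesis using that by (simp add: b_eq)
  qed
  have main: "\<epsilon> * b x \<le> w x" if x: "x \<in> D" for x
  proof (rule comparison[OF opD _ _ _ C2_scale[OF C2_subset[OF bC]] _ _ x])
    show "bounded D" using Dc bounded_subset bounded_cball by blast
    show "supersol D w" "continuous_on D w"
      using w_sol DK supersol_subset continuous_on_subset unfolding solution_def by blast+
    show "D \<subseteq> V" using Dc sV by auto
  next
    fix x assume x: "x \<in> D"
    then have xc: "x \<in> cball z s" and \<sigma>x: "0 < \<sigma> x" "\<sigma> x < \<tau>" by (auto simp: D_def)
    have "l * c0\<^sup>2 \<le> l * (norm (G1 x))\<^sup>2"
      using sx(4)[OF xc] c0 l_pos by (intro mult_left_mono power_mono) auto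
    also have "\<dots> \<le> G1 x \<bullet> (A *v G1 x)" by (rule A_ge)
    finally have "2 * k * (l * c0\<^sup>2) \<le> 2 * k * (G1 x \<bullet> (A *v G1 x))" using k by (intro mult_left_mono) auto
    then have 1: "3 * C + 2 * tr + 1 \<le> 2 * k * (G1 x \<bullet> (A *v G1 x))" using k by simp
    have "k * \<sigma> x \<le> k * \<tau>" using \<sigma>x k by (intro mult_left_mono) auto
    moreover have "0 \<le> k * \<sigma> x" using \<sigma>x k by simp
    ultimately have "\<bar>1 + 2 * (k * \<sigma> x)\<bar> \<le> 3" using \<tau>(2) by linarith
    then have "\<bar>(1 + 2 * (k * \<sigma> x)) * (A \<bullet> H1 x)\<bar> \<le> 3 * C"
      unfolding abs_mult using C[OF xc] by (intro mult_mono) auto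
    then have 2: "- (3 * C) \<le> (1 + 2 * (k * \<sigma> x)) * (A \<bullet> H1 x)" by linarith
    have "A \<bullet> Hb x = (1 + 2 * (k * \<sigma> x)) * (A \<bullet> H1 x) + 2 * k * (G1 x \<bullet> (A *v G1 x)) - 2 * tr"
      unfolding Hb_def inner_add_right inner_scaleR_right inner_outer tr_def by (simp add: algebra_simps)
    with 1 2 have "0 < A \<bullet> Hb x" by linarith
    then show "0 < A \<bullet> (\<epsilon> *\<^sub>R Hb x)" using \<epsilon> by simp
  next
    fix y and e :: real assume y: "y \<in> frontier D" and e: "0 < e"
    have "closed (cball z s \<inter> \<sigma> -` {0..\<tau>})"
      by (rule continuous_closed_preimage[OF contc]) auto
    then have "closure D \<subseteq> cball z s \<inter> \<sigma> -` {0..\<tau>}"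
      by (rule closure_minimal[rotated]) (auto simp: D_def)
    then have yc: "y \<in> cball z s" and \<sigma>y: "0 \<le> \<sigma> y" "\<sigma> y \<le> \<tau>"
      using y by (auto simp: frontier_def)
    have ynD: "y \<notin> D" using y opD by (simp add: frontier_def interior_open)
    have "y \<in> closure (K 1)" using y closure_mono[OF DK] by (auto simp: frontier_def)
    moreover have "y \<noteq> 0" using sx(1)[OF yc] by (auto simp: V_def)
    ultimately have yC: "y \<in> CC" using closure_K by blast
    have "\<epsilon> * b y \<le> wt y"
    proof (cases "y \<in> E")
      case True
      have "b y \<le> 2 * \<tau>" using b_le[OF \<sigma>y] zero_le_power2[of "norm (y - z)"] by linarith
      then have "\<epsilon> * b y \<le> \<epsilon> * (2 * \<tau>)" using \<epsilon>(1) by (intro mult_left_mono) auto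
      then show ?thesis using \<epsilon> \<mu>(2)[OF True] wt_CC[OF yC] by linarith
    next
      case False
      then have "\<sigma> y = 0 \<or> dist z y = s" using ynD yc \<sigma>y by (auto simp: D_def E_def)
      then have "b y \<le> 0"
      proof
        assume "dist z y = s"
        then have "norm (y - z) = s" by (simp add: dist_norm norm_minus_commute)
        then show "b y \<le> 0" using b_le[OF \<sigma>y] \<tau> by simp
      qed (simp add: b_eq)
      then have "\<epsilon> * b y \<le> 0" using \<epsilon>(1) by (simp add: mult_le_0_iff)
      then show ?thesis using w_nonneg[OF yC] wt_CC[OF yC] by linarith
    qed
    moreover have "continuous_on (cball z s) (\<lambda>x. wt x - \<epsilon> * b x)"
      by (intro continuous_intros continuous_on_subset[OF C2_cont[OF wt] sW] continuous_on_subset[OF C2_cont[OF bC] sV])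
    ultimately have "\<exists>d>0. \<forall>x\<in>D. dist x y < d \<longrightarrow> - e \<le> wt x - \<epsilon> * b x"
      using Dc yc e by (intro frontier_bound[of "cball z s"]) auto
    then show "\<exists>d>0. \<forall>x\<in>D. dist x y < d \<longrightarrow> - e \<le> w x - \<epsilon> * b x"
      using wD by auto
  qed
  \<comment> \<open>Along the gradient \<nu> of \<sigma>, \<open>wt - \<epsilon> * b\<close> starts
    at 0 with slope -\<epsilon> |\<nu>|^2, because the gradient of \<open>wt\<close> vanishes at
    \<open>z\<close>; this contradicts \<open>main\<close>.\<close>
  have line: "((\<lambda>t. z + t *\<^sub>R \<nu>) has_derivative (\<lambda>t. t *\<^sub>R \<nu>)) (at 0)"
    by (auto intro!: derivative_eq_intros)
  have dir: "((\<lambda>t. f (z + t *\<^sub>R \<nu>)) has_real_derivative G z \<bullet> \<nu>) (at 0)" if "C2 X f G H" "z \<in> X" for X f G H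
    unfolding has_field_derivative_def
    by (rule has_derivative_eq_rhs[OF has_derivative_compose[OF line, of f "\<lambda>h. G z \<bullet> h"]])
      (use C2_D1[OF that] in auto)
  have ds: "((\<lambda>t. \<sigma> (z + t *\<^sub>R \<nu>)) has_real_derivative \<nu> \<bullet> \<nu>) (at 0)"
    using dir[OF C1 V(2)] by (simp add: \<nu>_def)
  have "Gb z = \<nu>" by (simp add: Gb_def \<sigma>z \<nu>_def)
  then have db: "((\<lambda>t. b (z + t *\<^sub>R \<nu>)) has_real_derivative \<nu> \<bullet> \<nu>) (at 0)"
    using dir[OF bC V(2)] by simp
  have dw: "((\<lambda>t. wt (z + t *\<^sub>R \<nu>)) has_real_derivative 0) (at 0)"
    using dir[OF wt] CC_W z Gz by auto
  have df: "((\<lambda>t. wt (z + t *\<^sub>R \<nu>) - \<epsilon> * b (z + t *\<^sub>R \<nu>)) has_real_derivative 0 - \<epsilon> * (\<nu> \<bullet> \<nu>)) (at 0)"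
    by (intro DERIV_diff dw DERIV_cmult db)
  have "0 - \<epsilon> * (\<nu> \<bullet> \<nu>) < 0" using \<epsilon> \<nu> by simp
  from DERIV_neg_dec_right[OF df this] obtain d1 where d1: "d1 > 0"
    "\<And>h. 0 < h \<Longrightarrow> h < d1 \<Longrightarrow> wt (z + h *\<^sub>R \<nu>) - \<epsilon> * b (z + h *\<^sub>R \<nu>) < wt z - \<epsilon> * b z" by auto
  have "0 < \<nu> \<bullet> \<nu>" using \<nu> by simp
  from DERIV_pos_inc_right[OF ds this] obtain d2 where d2: "d2 > 0"
    "\<And>h. 0 < h \<Longrightarrow> h < d2 \<Longrightarrow> 0 < \<sigma> (z + h *\<^sub>R \<nu>)" using \<sigma>z by auto
  have "isCont (\<lambda>t. \<sigma> (z + t *\<^sub>R \<nu>)) 0" by (rule DERIV_isCont[OF ds])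
  then obtain d3 where d3: "d3 > 0" "\<And>h. \<bar>h\<bar> < d3 \<Longrightarrow> \<bar>\<sigma> (z + h *\<^sub>R \<nu>)\<bar> < \<tau>"
    using \<tau>(1) \<sigma>z unfolding continuous_at_eps_delta by fastforce
  define h where "h = Min {d1, d2, d3, s / norm \<nu>} / 2"
  have m: "Min {d1, d2, d3, s / norm \<nu>} > 0" using d1 d2 d3 s \<nu> by auto
  have hh: "0 < h" "h < Min {d1, d2, d3, s / norm \<nu>}" using m unfolding h_def by linarith+
  then have h: "h < d1" "h < d2" "h < d3" "h < s / norm \<nu>" by auto
  have "norm (h *\<^sub>R \<nu>) < s" using h(4) hh(1) \<nu> by (simp add: field_simps)
  then have "z + h *\<^sub>R \<nu> \<in> D" using d2(2)[OF hh(1) h(2)] d3(2)[of h] h hh by (auto simp: D_def dist_norm)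
  from main[OF this] have "\<epsilon> * b (z + h *\<^sub>R \<nu>) \<le> wt (z + h *\<^sub>R \<nu>)"
    using wD \<open>z + h *\<^sub>R \<nu> \<in> D\<close> by auto
  moreover have "wt z = 0" "b z = 0" using z wt_CC \<sigma>z by (auto simp: b_eq)
  ultimately show False using d1(2)[OF hh(1) h(1)] by simp
qed

text \<open>A closed shell about the cap |x| = 1/2, compact and away both from the vertex and from
  |x| = 1, where no boundary values are prescribed.\<close>

definition Sh :: "(real^'n) set" where "Sh = {x \<in> CC. 1/4 \<le> norm x \<and> norm x \<le> 3/4}"

lemma Sh_compact: "compact Sh"
proof -
  have "Sh = (\<lambda>(r, \<sigma>). r *\<^sub>R \<sigma>) ` ({1/4..3/4} \<times> closure S)" (is "_ = ?T")
  proof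
    show "Sh \<subseteq> ?T"
    proof
      fix x assume "x \<in> Sh"
      then show "x \<in> ?T"
        by (intro image_eqI[of _ _ "(norm x, x /\<^sub>R norm x)"]) (auto simp: Sh_def CC_def sph_closure_S)
    qed
    have "norm \<sigma> = 1" if "\<sigma> \<in> closure S" for \<sigma> using closure_S that by auto
    then show "?T \<subseteq> Sh" by (force simp: Sh_def CC_def sph_closure_S)
  qed
  then show ?thesis
    using closure_S by (auto intro!: compact_continuous_image compact_Times continuous_intros simp: case_prod_unfold)
qed

lemma Sh_CC: "Sh \<subseteq> CC" by (auto simp: Sh_def)

text \<open>By compactness it suffices that \<open>w x + norm (Gw x)\<close> is positive on the
  shell: inside the cone the first term is, on the lateral boundary \<open>hopf\<close> applies.
  Half the minimum serves as threshold for both terms.\<close>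

lemma gradient_lower_bound:
  "\<exists>c>0. \<forall>x\<in>Sh. w x < c \<longrightarrow> c \<le> norm (Gw x)"
proof (cases "Sh = {}")
  case False
  have "continuous_on Sh (\<lambda>x. w x + norm (Gw x))"
    using continuous_on_subset[OF w_continuous] continuous_on_subset[OF C2_cont_G[OF wt]] Sh_CC CC_W
    by (intro continuous_intros) auto
  from continuous_attains_inf[OF Sh_compact False this]
  obtain x0 where x0: "x0 \<in> Sh" "\<And>x. x \<in> Sh \<Longrightarrow> w x0 + norm (Gw x0) \<le> w x + norm (Gw x)" by blast
  define c where "c = (w x0 + norm (Gw x0)) / 2"
  have "w x0 + norm (Gw x0) > 0"
  proof (cases "w x0 = 0")
    case True
    then show ?thesis using hopf[of x0] x0(1) by (auto simp: Sh_def)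
  next
    case False
    then show ?thesis using w_nonneg[of x0] x0(1) Sh_CC by (intro add_pos_nonneg) auto
  qed
  then have "c > 0" by (simp add: c_def)
  moreover have "c \<le> norm (Gw x)" if "x \<in> Sh" "w x < c" for x
    using x0(2)[OF that(1)] that(2) by (simp add: c_def)
  ultimately show ?thesis by blast
qed (auto intro: exI[of _ 1])

end

section \<open>Barriers near the lateral boundary\<close>

context cone_problem
begin

text \<open>Otherwise \<open>S\<close> is the whole sphere and, by homogeneity, some multiple of the strict subsolution
  \<open>q powr (\<kappa>/2)\<close> touches \<open>w\<close> from below.\<close>

lemma sph_boundary_nonempty: "sph_boundary S \<noteq> {}"
proof
  assume "sph_boundary S = {}"
  then have cl: "closure S = S" using closure_S by (auto simp: sph_boundary_S)
  have "closedin (top_of_set unit_sphere) S"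
    using S_sphere cl by (metis closed_closure closed_subset)
  moreover have "connected (unit_sphere :: (real^'n) set)"
    by (rule connected_sphere) (use dim in simp)
  ultimately have SS: "S = unit_sphere"
    using S unfolding sph_domain_def connected_clopen by metis
  have mK: "x \<in> K 1 \<longleftrightarrow> x \<noteq> 0 \<and> norm x < 1" for x
    unfolding mem_K by (auto simp: SS)
  obtain G H where GH: "C2 (- {0}) (\<lambda>x. q (x - 0) powr (\<kappa> / 2)) G H"
    "\<And>x. x \<noteq> 0 \<Longrightarrow> A \<bullet> H x = 2 * (\<kappa> / 2) * (real CARD('n) + 2 * (\<kappa> / 2) - 2) * q (x - 0) powr (\<kappa> / 2 - 1)"
    using C2_q_powr[of 0 "\<kappa> / 2"] by blast
  define Q where "Q = (\<lambda>x. q x powr (\<kappa> / 2))"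
  have QC: "C2 (- {0}) Q G H" using GH(1) by (simp add: Q_def)
  have Q_pos: "0 < Q x" if "x \<noteq> 0" for x using q_pos[OF that] by (simp add: Q_def)
  have Q_scale: "Q (r *\<^sub>R x) = r powr \<kappa> * Q x" if "r > 0" for r x
  proof -
    have "q (r *\<^sub>R x) = r\<^sup>2 * q x"
      by (simp add: q_def matrix_vector_mult_scaleR power2_eq_square)
    then have "Q (r *\<^sub>R x) = (r\<^sup>2) powr (\<kappa> / 2) * Q x" by (simp add: Q_def powr_mult)
    also have "(r\<^sup>2) powr (\<kappa> / 2) = r powr \<kappa>" using that by (simp add: powr_powr flip: powr_numeral)
    finally show ?thesis .
  qed
  have sub: "unit_sphere \<subseteq> - {0::real^'n}" "unit_sphere \<subseteq> CC \<union> {0}"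
    unfolding CC_def sph_closure_S cl by (auto simp: SS)
  have "continuous_on unit_sphere (\<lambda>x. w x / Q x)"
    using Q_pos sub continuous_on_subset[OF w_continuous sub(2)] continuous_on_subset[OF C2_cont[OF QC] sub(1)]
    by (intro continuous_intros ballI order.strict_implies_not_eq[OF Q_pos, symmetric]) auto
  moreover have "unit_sphere \<noteq> ({} :: (real^'n) set)" using S SS by (auto simp: sph_domain_def)
  ultimately obtain \<sigma>0 where \<sigma>0: "\<sigma>0 \<in> unit_sphere" "\<And>\<sigma>. \<sigma> \<in> unit_sphere \<Longrightarrow> w \<sigma>0 / Q \<sigma>0 \<le> w \<sigma> / Q \<sigma>"
    using continuous_attains_inf[of "unit_sphere :: (real^'n) set" "\<lambda>x. w x / Q x"] by (metis compact_sphere)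
  define m where "m = w \<sigma>0 / Q \<sigma>0"
  have \<sigma>0': "\<sigma>0 \<noteq> 0" "norm \<sigma>0 = 1" using \<sigma>0 by auto
  have "\<sigma>0 \<in> K 2" unfolding mem_K using \<sigma>0' by (simp add: SS)
  then have "0 < w \<sigma>0" by (rule w_pos)
  then have m: "m > 0" using Q_pos \<sigma>0' by (simp add: m_def)
  have le: "m * Q x \<le> w x" if "x \<noteq> 0" for x
  proof -
    have x: "x = norm x *\<^sub>R (x /\<^sub>R norm x)" "norm x > 0" "x /\<^sub>R norm x \<in> unit_sphere" using that by auto
    have "m * Q (x /\<^sub>R norm x) \<le> w (x /\<^sub>R norm x)"
      using \<sigma>0(2)[OF x(3)] Q_pos[of "x /\<^sub>R norm x"] that by (simp add: m_def pos_le_divide_eq)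
    then have "norm x powr \<kappa> * (m * Q (x /\<^sub>R norm x)) \<le> norm x powr \<kappa> * w (x /\<^sub>R norm x)"
      by (intro mult_left_mono) auto
    then show ?thesis
      using Q_scale[OF x(2), of "x /\<^sub>R norm x"] homogeneous_ext_scale[OF x(2), of \<kappa> \<phi> "x /\<^sub>R norm x"] x(1)
      by (simp add: mult_ac)
  qed
  \<comment> \<open>The point \<sigma>0 has norm 1 and is not in \<open>K 1\<close>; by homogeneity
    equality persists along its ray.\<close>
  define x0 where "x0 = (1/2) *\<^sub>R \<sigma>0"
  have x0: "x0 \<in> K 1" "x0 \<noteq> 0" using \<sigma>0' by (auto simp: mK x0_def)
  have eq: "m * Q x0 = w x0"
    using Q_scale[of "1/2" \<sigma>0] homogeneous_ext_scale[of "1/2" \<kappa> \<phi> \<sigma>0] Q_pos[of \<sigma>0] \<sigma>0'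
    by (simp add: x0_def m_def)
  have "C2 (K 1) (\<lambda>x. m * Q x) (\<lambda>x. m *\<^sub>R G x) (\<lambda>x. m *\<^sub>R H x)"
    by (rule C2_scale[OF C2_subset[OF QC]]) (auto simp: mK)
  then have "A \<bullet> (m *\<^sub>R H x0) \<le> 0"
    using w_sol le eq
    by (intro supersolD[where v = w and \<psi> = "\<lambda>x. m * Q x", OF _ K_open x0(1) order_refl])
      (auto simp: solution_def mK)
  then have "A \<bullet> H x0 \<le> 0" using m by (simp add: mult_le_0_iff)
  moreover have "0 < A \<bullet> H x0"
    using GH(2)[OF x0(2)] \<kappa> dim q_pos[OF x0(2)] by (simp add: add_pos_nonneg)
  ultimately show False by simp
qed

section \<open>The zone near the lateral boundary and the cutoff of the barriers\<close>

lemma open_zone: "open {x \<in> K 1. 1/4 < norm x \<and> norm x < 3/4 \<and> w x < \<tau>}"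
proof -
  have "continuous_on (K 1) w" using w_sol by (simp add: solution_def)
  then have "open (K 1 \<inter> w -` {..<\<tau>})" by (rule continuous_open_preimage[OF _ K_open]) auto
  moreover have "open {x::real^'n. 1/4 < norm x}" "open {x::real^'n. norm x < 3/4}"
    by (intro open_Collect_less continuous_intros)+
  ultimately have "open ((K 1 \<inter> w -` {..<\<tau>}) \<inter> {x. 1/4 < norm x} \<inter> {x. norm x < 3/4})"
    by (metis open_Int)
  also have "(K 1 \<inter> w -` {..<\<tau>}) \<inter> {x. 1/4 < norm x} \<inter> {x. norm x < 3/4} =
    {x \<in> K 1. 1/4 < norm x \<and> norm x < 3/4 \<and> w x < \<tau>}" by auto
  finally show ?thesis .
qed

text \<open>These are the pieces on which both barriers are checked: a level set of
  \<open>w\<close>, two caps, and the lateral boundary as the last alternative.\<close>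

lemma zone_frontier:
  assumes "0 < \<tau>" "y \<in> frontier {x \<in> K 1. 1/4 < norm x \<and> norm x < 3/4 \<and> w x < \<tau>}"
  shows "y \<in> Sh" "w y \<le> \<tau>"
    "y \<in> K 1 \<and> (w y = \<tau> \<or> norm y = 1/4 \<or> norm y = 3/4) \<or> y \<notin> K 1 \<and> w y = 0"
proof -
  let ?D = "{x \<in> K 1. 1/4 < norm x \<and> norm x < 3/4 \<and> w x < \<tau>}"
  have "continuous_on Sh w" by (rule continuous_on_subset[OF w_continuous]) (use Sh_CC in auto)
  then have "closed (Sh \<inter> w -` {..\<tau>})"
    by (rule continuous_closed_preimage) (use Sh_compact compact_imp_closed in auto)
  then have "closure ?D \<subseteq> Sh \<inter> w -` {..\<tau>}"
    by (rule closure_minimal[rotated]) (auto simp: Sh_def intro: K_CC)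
  then show y: "y \<in> Sh" "w y \<le> \<tau>" using assms by (auto simp: frontier_def)
  have "y \<notin> ?D" using assms(2) open_zone by (simp add: frontier_def interior_open)
  moreover have "w y = 0" if "y \<notin> K 1"
    using that y(1) w_eq_0[of y] by (auto simp: Sh_def mem_K CC_def)
  ultimately show "y \<in> K 1 \<and> (w y = \<tau> \<or> norm y = 1/4 \<or> norm y = 3/4) \<or> y \<notin> K 1 \<and> w y = 0"
    using y by (auto simp: Sh_def)
qed

text \<open>\<open>k\<close> is defined by 2 k l c^2 = C + 1, so that the gradient term beats an
  error of size C with margin 1.\<close>

lemma Gw_A_lower:
  assumes "0 < c" "c \<le> norm (Gw x)" "k = (C + 1) / (2 * l * c\<^sup>2)" "0 \<le> C"
  shows "C + 1 \<le> 2 * k * (Gw x \<bullet> (A *v Gw x))"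
proof -
  have "l * c\<^sup>2 \<le> l * (norm (Gw x))\<^sup>2" using assms l_pos by (intro mult_left_mono power_mono) auto
  also have "\<dots> \<le> Gw x \<bullet> (A *v Gw x)" by (rule A_ge)
  finally have "2 * k * (l * c\<^sup>2) \<le> 2 * k * (Gw x \<bullet> (A *v Gw x))"
    using assms l_pos by (intro mult_left_mono) auto
  moreover have "2 * k * (l * c\<^sup>2) = C + 1" using assms l_pos by simp
  ultimately show ?thesis by simp
qed

lemma bounded_on_Sh:
  assumes "continuous_on Sh f"
  obtains C where "0 \<le> C" "\<And>x. x \<in> Sh \<Longrightarrow> \<bar>f x :: real\<bar> \<le> C"
proof -
  have "bounded (f ` Sh)" using compact_continuous_image[OF assms Sh_compact] compact_imp_bounded by blast
  then have "\<exists>C>0. \<forall>x\<in>Sh. \<bar>f x\<bar> \<le> C" unfolding bounded_pos by simp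
  then show thesis using that by (meson less_imp_le)
qed

text \<open>A polynomial in |x|^2, hence smooth, that vanishes on |x| = 1/2. The constant 9/256
  below is its value (1/16 - 1/4)^2 on |x| = 1/4, the smaller of its values on the two caps.\<close>

definition \<zeta> :: "real^'n \<Rightarrow> real" where "\<zeta> x = ((norm x)\<^sup>2 - 1/4)\<^sup>2"

lemma C2_\<zeta>: obtains G H where "C2 UNIV \<zeta> G H"
proof -
  have "\<exists>G H. C2 UNIV (\<lambda>x::real^'n. ((norm x)\<^sup>2 + - (1/4)) * ((norm x)\<^sup>2 + - (1/4))) G H"
    using C2_mult[OF C2_add[OF C2_norm_sq C2_const] C2_add[OF C2_norm_sq C2_const]] by blast
  moreover have "\<zeta> = (\<lambda>x. ((norm x)\<^sup>2 + - (1/4)) * ((norm x)\<^sup>2 + - (1/4)))"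
    by (auto simp: \<zeta>_def power2_eq_square)
  ultimately show thesis using that by auto
qed

lemma \<zeta>_values: "0 \<le> \<zeta> x" "norm x = 1/4 \<or> norm x = 3/4 \<Longrightarrow> 9/256 \<le> \<zeta> x" "norm x = 1/2 \<Longrightarrow> \<zeta> x = 0"
proof -
  show "norm x = 1/4 \<or> norm x = 3/4 \<Longrightarrow> 9/256 \<le> \<zeta> x"
    by (elim disjE; simp only: \<zeta>_def power2_eq_square; simp)
  show "norm x = 1/2 \<Longrightarrow> \<zeta> x = 0"
    by (simp only: \<zeta>_def power2_eq_square) simp
qed (simp add: \<zeta>_def)

text \<open>The barrier \<open>w * (\<eta> + k * w)\<close> is at least \<open>w\<close> on \<open>\<bar>x\<bar> = 1/2\<close> and, where \<open>k * w \<le> 1\<close>,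
  nonpositive on \<open>\<bar>x\<bar> = 1/4\<close> and \<open>\<bar>x\<bar> = 3/4\<close>.\<close>

lemma lower_bound:
  assumes x0: "x0 \<in> K 1" "0 < r0"
  shows "\<exists>\<delta>>0. \<forall>v. solution (K 1) v \<and> (\<forall>x\<in>K 1. 0 \<le> v x) \<and> (\<forall>x\<in>ball x0 r0 \<inter> K 1. 1 \<le> v x) \<longrightarrow>
     (\<forall>x\<in>K (1/2). \<delta> * w x \<le> v x)"
proof -
  obtain c where c: "c > 0" "\<And>x. x \<in> Sh \<Longrightarrow> w x < c \<Longrightarrow> c \<le> norm (Gw x)"
    using gradient_lower_bound by blast
  obtain G\<zeta> H\<zeta> where \<zeta>C: "C2 UNIV \<zeta> G\<zeta> H\<zeta>" by (rule C2_\<zeta>)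
  \<comment> \<open>64 * 9/256 = 9/4 exceeds 2, so \<eta> + k w is negative on the two caps as long
    as k w <= 1.\<close>
  define \<eta> where "\<eta> = (\<lambda>x. 1 + (- 64) * \<zeta> x)"
  define G\<eta> where "G\<eta> = (\<lambda>x. 0 + (- 64) *\<^sub>R G\<zeta> x)"
  define H\<eta> where "H\<eta> = (\<lambda>x. 0 + (- 64) *\<^sub>R H\<zeta> x)"
  have \<eta>C: "C2 W \<eta> G\<eta> H\<eta>" unfolding \<eta>_def G\<eta>_def H\<eta>_def
    by (intro C2_add C2_const C2_scale C2_subset[OF \<zeta>C]) auto
  \<comment> \<open>What remains of the Hessian of \<open>wt * \<eta>\<close> once
    \<open>A \<bullet> Hw x\<close> vanishes: bounded, but without a sign.\<close>
  define Rm where "Rm = (\<lambda>x. A \<bullet> (wt x *\<^sub>R H\<eta> x + outer (Gw x) (G\<eta> x) + outer (G\<eta> x) (Gw x)))"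
  have ShW: "Sh \<subseteq> W" using Sh_CC CC_W by blast
  have "continuous_on Sh Rm" unfolding Rm_def
    by (intro continuous_intros continuous_on_subset[OF C2_cont[OF wt] ShW] continuous_on_subset[OF C2_cont_G[OF wt] ShW]
        continuous_on_subset[OF C2_cont_H[OF \<eta>C] ShW] continuous_on_subset[OF C2_cont_G[OF \<eta>C] ShW])
  then obtain C where C: "0 \<le> C" "\<And>x. x \<in> Sh \<Longrightarrow> \<bar>Rm x\<bar> \<le> C" using bounded_on_Sh[of Rm] by blast
  define k where "k = (C + 1) / (2 * l * c\<^sup>2)"
  have k: "k > 0" using C c l_pos by (simp add: k_def)
  define \<tau> where "\<tau> = min c (1 / k)"
  have \<tau>: "\<tau> > 0" "\<tau> \<le> c" "k * \<tau> \<le> 1" using k c by (auto simp: \<tau>_def min_def field_simps)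
  define b where "b = (\<lambda>x. wt x * \<eta> x + k * (wt x * wt x))"
  define Gb where "Gb = (\<lambda>x. (wt x *\<^sub>R G\<eta> x + \<eta> x *\<^sub>R Gw x) + k *\<^sub>R (wt x *\<^sub>R Gw x + wt x *\<^sub>R Gw x))"
  define Hb where "Hb = (\<lambda>x. (wt x *\<^sub>R H\<eta> x + \<eta> x *\<^sub>R Hw x + outer (Gw x) (G\<eta> x) + outer (G\<eta> x) (Gw x)) +
     k *\<^sub>R (wt x *\<^sub>R Hw x + wt x *\<^sub>R Hw x + outer (Gw x) (Gw x) + outer (Gw x) (Gw x)))"
  have bC: "C2 W b Gb Hb" unfolding b_def Gb_def Hb_def
    by (intro C2_add C2_scale C2_mult wt \<eta>C)
  have b_eq: "b x = w x * (\<eta> x + k * w x)" if "x \<in> CC" for x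
    using wt_CC[OF that] by (simp add: b_def algebra_simps)
  define D where "D = {x \<in> K 1. 1/4 < norm x \<and> norm x < 3/4 \<and> w x < \<tau>}"
  have DSh: "D \<subseteq> Sh" using K_CC by (auto simp: D_def Sh_def)
  have DK: "D \<subseteq> K 1" by (auto simp: D_def)
  \<comment> \<open>Where w >= \<tau> the shell is a compact part of the cone, so
    \<open>propagation\<close> supplies the constant \<open>\<delta>0\<close> there.\<close>
  define E where "E = Sh \<inter> w -` {\<tau>..}"
  have "continuous_on Sh w" by (rule continuous_on_subset[OF w_continuous]) (use Sh_CC in auto)
  then have "closed E" unfolding E_def
    by (rule continuous_closed_preimage) (use Sh_compact compact_imp_closed in auto)
  then have cE: "compact E" using Sh_compact unfolding E_def
    by (metis Int_lower1 bounded_subset compact_eq_bounded_closed)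
  have EK: "E \<subseteq> K 1"
  proof
    fix x assume x: "x \<in> E"
    then have "x /\<^sub>R norm x \<in> S" using w_eq_0[of x] \<tau> Sh_CC by (force simp: E_def)
    then show "x \<in> K 1" using x by (auto simp: E_def Sh_def CC_def mem_K)
  qed
  from propagation[OF K_open K_connected x0 cE EK] obtain \<delta>0 where \<delta>0: "\<delta>0 > 0"
    "\<And>v x. supersol (K 1) v \<and> continuous_on (K 1) v \<and> (\<forall>x\<in>K 1. 0 \<le> v x) \<and> (\<forall>x\<in>ball x0 r0 \<inter> K 1. 1 \<le> v x) \<Longrightarrow>
       x \<in> E \<Longrightarrow> \<delta>0 \<le> v x" by blast
  \<comment> \<open>On the level w = \<tau> the barrier is at most 2 \<tau>, so \<epsilon> b <=
    \<delta>0 <= v there.\<close>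
  define \<epsilon> where "\<epsilon> = \<delta>0 / (2 * \<tau>)"
  have \<epsilon>: "\<epsilon> > 0" "\<epsilon> * (2 * \<tau>) = \<delta>0" using \<delta>0 \<tau> by (auto simp: \<epsilon>_def)
  define \<delta> where "\<delta> = min \<delta>0 \<epsilon>"
  have \<delta>: "\<delta> > 0" using \<delta>0 \<epsilon> by (simp add: \<delta>_def)
  show ?thesis
  proof (intro exI[of _ \<delta>] conjI allI impI ballI \<delta>; elim conjE)
    fix v x assume v: "solution (K 1) v" "\<forall>x\<in>K 1. 0 \<le> v x" "\<forall>x\<in>ball x0 r0 \<inter> K 1. 1 \<le> v x"
      and xK: "x \<in> K (1/2)"
    have vs: "supersol (K 1) v" "continuous_on (K 1) v" using v(1) by (auto simp: solution_def)
    have vE: "\<delta>0 \<le> v x" if "x \<in> E" for x using \<delta>0(2) vs v that by blast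
    have main: "\<epsilon> * b x \<le> v x" if x: "x \<in> D" for x
    proof (rule comparison[OF _ _ _ _ C2_scale[OF C2_subset[OF bC]] _ _ x])
      show "open D" unfolding D_def by (rule open_zone)
      show "bounded D" using DK K_bounded bounded_subset by blast
      show "supersol D v" "continuous_on D v" using vs DK supersol_subset continuous_on_subset by blast+
      show "D \<subseteq> W" using DSh ShW by blast
    next
      fix x assume x: "x \<in> D"
      then have "x \<in> Sh" "w x < c" "x \<in> K 1" using DSh \<tau> by (auto simp: D_def)
      then have "C + 1 \<le> 2 * k * (Gw x \<bullet> (A *v Gw x))" "\<bar>Rm x\<bar> \<le> C" "A \<bullet> Hw x = 0"
        using Gw_A_lower[OF c(1) c(2) k_def C(1)] C(2) L_w by auto
      moreover have "A \<bullet> Hb x = Rm x + 2 * k * (Gw x \<bullet> (A *v Gw x)) + (\<eta> x + 2 * k * wt x) * (A \<bullet> Hw x)"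
        unfolding Hb_def Rm_def inner_add_right inner_scaleR_right inner_outer by (simp add: algebra_simps)
      ultimately have "0 < A \<bullet> Hb x" by simp
      then show "0 < A \<bullet> (\<epsilon> *\<^sub>R Hb x)" using \<epsilon> by simp
    next
      fix y and e :: real assume y: "y \<in> frontier D" and e: "0 < e"
      note z = zone_frontier[OF \<tau>(1) y[unfolded D_def]]
      have yC: "y \<in> CC" using z(1) Sh_CC by blast
      have w0: "0 \<le> w y" by (rule w_nonneg[OF yC])
      have kw: "k * w y \<le> 1" using mult_left_mono[OF z(2), of k] k \<tau>(3) by linarith
      have alt: "\<exists>d>0. \<forall>x\<in>D. dist x y < d \<longrightarrow> - e \<le> v x - \<epsilon> * b x" if b0: "b y \<le> 0"
      proof -
        have "\<exists>d>0. \<forall>x\<in>D. dist x y < d \<longrightarrow> - e \<le> - (\<epsilon> * b x)"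
          using DSh ShW z(1) b0 \<epsilon>(1) e
          by (intro frontier_bound[where T = W] continuous_intros C2_cont[OF bC]) (auto simp: mult_le_0_iff)
        then obtain d where d: "d > 0" "\<forall>x\<in>D. dist x y < d \<longrightarrow> - e \<le> - (\<epsilon> * b x)" by blast
        have "- e \<le> v x - \<epsilon> * b x" if "x \<in> D" "dist x y < d" for x
        proof -
          have "0 \<le> v x" "- e \<le> - (\<epsilon> * b x)" using d(2) that v(2) DK by auto
          then show ?thesis by linarith
        qed
        then show ?thesis using d(1) by blast
      qed
      show "\<exists>d>0. \<forall>x\<in>D. dist x y < d \<longrightarrow> - e \<le> v x - \<epsilon> * b x"
      proof (cases "y \<in> K 1 \<and> w y = \<tau>")
        case True
        then have "\<delta>0 \<le> v y" using vE z(1) by (auto simp: E_def)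
        moreover have "b y \<le> 2 * \<tau>"
        proof -
          have "\<eta> y + k * w y \<le> 2" using kw \<zeta>_values(1)[of y] by (simp add: \<eta>_def)
          then have "w y * (\<eta> y + k * w y) \<le> w y * 2" using w0 by (intro mult_left_mono) auto
          then show ?thesis using b_eq[OF yC] True by simp
        qed
        then have "\<epsilon> * b y \<le> \<epsilon> * (2 * \<tau>)" using \<epsilon>(1) by (intro mult_left_mono) auto
        ultimately have "0 \<le> v y - \<epsilon> * b y" using \<epsilon> by linarith
        then show ?thesis using DK True e K1_W
          by (intro frontier_bound[where T = "K 1"] continuous_intros vs continuous_on_subset[OF C2_cont[OF bC]]) auto
      next
        case False
        have "b y \<le> 0"
        proof (cases "w y = 0")
          case True
          then show ?thesis using b_eq[OF yC] by simp
        next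
          case wy: False
          then have "norm y = 1/4 \<or> norm y = 3/4" using z(3) False by auto
          then have "\<eta> y + k * w y \<le> 0" using \<zeta>_values(2)[of y] kw by (simp add: \<eta>_def)
          then show ?thesis using b_eq[OF yC] w0 by (simp add: mult_nonneg_nonpos)
        qed
        then show ?thesis by (rule alt)
      qed
    qed
    \<comment> \<open>On the cap |x| = 1/2 either \<open>x\<close> lies in \<open>D\<close> and v >=
      \<epsilon> b >= \<epsilon> w, or w >= \<tau> and v >= \<delta>0 with w <= 1. The minimum
      principle carries this down to the vertex, which the zone of the barrier does not
      reach.\<close>
    have "0 \<le> v x - \<delta> * w x"
    proof (rule minimum_principle_K[of "\<lambda>x. v x - \<delta> * w x" "1/2"])
      show "supersol (K 1) (\<lambda>x. v x - \<delta> * w x)" "continuous_on (K 1) (\<lambda>x. v x - \<delta> * w x)"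
        using solution_sub_w[OF v(1)] by (auto simp: solution_def)
    next
      fix x assume x: "x \<in> K 1" "norm x = 1/2"
      have xC: "x \<in> CC" using K_CC x by blast
      have w01: "0 \<le> w x" "w x \<le> 1" using w_nonneg w_le_1 xC x by auto
      show "0 \<le> v x - \<delta> * w x"
      proof (cases "w x < \<tau>")
        case True
        then have "x \<in> D" using x by (simp add: D_def)
        have "\<epsilon> * w x \<le> \<epsilon> * b x"
        proof (intro mult_left_mono)
          have "\<eta> x = 1" using \<zeta>_values(3)[OF x(2)] by (simp add: \<eta>_def)
          then show "w x \<le> b x" using b_eq[OF xC] w01 k by (simp add: algebra_simps)
        qed (use \<epsilon> in auto)
        moreover have "\<delta> * w x \<le> \<epsilon> * w x" using w01 by (intro mult_right_mono) (auto simp: \<delta>_def)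
        ultimately show ?thesis using main[OF \<open>x \<in> D\<close>] by linarith
      next
        case False
        then have "\<delta>0 \<le> v x" using x xC by (intro vE) (auto simp: E_def Sh_def)
        moreover have "\<delta> * w x \<le> \<delta>0 * 1" using w01 \<delta> by (intro mult_mono) (auto simp: \<delta>_def)
        ultimately show ?thesis by simp
      qed
    next
      fix z and e :: real assume "z \<in> CC \<union> {0}" "w z = 0" "0 < e"
      then show "\<exists>d>0. \<forall>x\<in>K 1. dist x z < d \<longrightarrow> - e \<le> v x - \<delta> * w x"
        using v(2) by (intro lateral_bound[of \<delta>]) auto
    qed (use xK in auto)
    then show "\<delta> * w x \<le> v x" by simp
  qed
qed

text \<open>The barrier \<open>\<zeta> + k * w * (2 * c - w)\<close> is of order \<open>w\<close> only on \<open>\<bar>x\<bar> = 1/2\<close>: on the other two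
  caps \<open>u\<close> is merely bounded, and \<open>\<zeta>\<close> dominates it.\<close>

lemma upper_bound:
  assumes u: "solution (K 1) u" and M: "\<And>x. x \<in> K 1 \<Longrightarrow> u x \<le> M"
    and lat: "\<And>z e. z \<in> CC \<union> {0} \<Longrightarrow> norm z \<le> 3/4 \<Longrightarrow> w z = 0 \<Longrightarrow> 0 < e \<Longrightarrow>
      \<exists>d>0. \<forall>x\<in>K 1. dist x z < d \<longrightarrow> u x \<le> e"
  shows "\<exists>C>0. \<forall>x\<in>K (1/2). u x \<le> C * w x"
proof -
  obtain c where c: "c > 0" "\<And>x. x \<in> Sh \<Longrightarrow> w x < c \<Longrightarrow> c \<le> norm (Gw x)"
    using gradient_lower_bound by blast
  obtain G\<zeta> H\<zeta> where \<zeta>C: "C2 UNIV \<zeta> G\<zeta> H\<zeta>" by (rule C2_\<zeta>)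
  have ShW: "Sh \<subseteq> W" using Sh_CC CC_W by blast
  have "continuous_on Sh (\<lambda>x. A \<bullet> H\<zeta> x)"
    by (intro continuous_intros continuous_on_subset[OF C2_cont_H[OF \<zeta>C]]) auto
  then obtain C where C: "0 \<le> C" "\<And>x. x \<in> Sh \<Longrightarrow> \<bar>A \<bullet> H\<zeta> x\<bar> \<le> C"
    using bounded_on_Sh[of "\<lambda>x. A \<bullet> H\<zeta> x"] by blast
  define k where "k = (C + 1) / (2 * l * c\<^sup>2)"
  have k: "k > 0" using C c l_pos by (simp add: k_def)
  define b where "b = (\<lambda>x. \<zeta> x + k * ((2 * c) * wt x + (-1) * (wt x * wt x)))"
  define Gb where "Gb = (\<lambda>x. G\<zeta> x + k *\<^sub>R ((2 * c) *\<^sub>R Gw x + (-1) *\<^sub>R (wt x *\<^sub>R Gw x + wt x *\<^sub>R Gw x)))"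
  define Hb where "Hb = (\<lambda>x. H\<zeta> x + k *\<^sub>R ((2 * c) *\<^sub>R Hw x + (-1) *\<^sub>R
     (wt x *\<^sub>R Hw x + wt x *\<^sub>R Hw x + outer (Gw x) (Gw x) + outer (Gw x) (Gw x))))"
  have bC: "C2 W b Gb Hb" unfolding b_def Gb_def Hb_def
    by (intro C2_add C2_scale C2_mult wt C2_subset[OF \<zeta>C]) auto
  have b_eq: "b x = \<zeta> x + k * (w x * (2 * c - w x))" if "x \<in> CC" for x
    using wt_CC[OF that] by (simp add: b_def algebra_simps)
  define D where "D = {x \<in> K 1. 1/4 < norm x \<and> norm x < 3/4 \<and> w x < c}"
  have DSh: "D \<subseteq> Sh" using K_CC by (auto simp: D_def Sh_def)
  have DK: "D \<subseteq> K 1" by (auto simp: D_def)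
  \<comment> \<open>A lower bound for \<open>b\<close> on the frontier inside the cone: 9/256 on the
    caps, through \<zeta>, and k c^2 on the level w = c, where w (2 c - w) = c^2.\<close>
  define \<beta> where "\<beta> = min (9/256) (k * c\<^sup>2)"
  have \<beta>: "\<beta> > 0" using k c by (simp add: \<beta>_def)
  \<comment> \<open>Makes C1 b at least |M| + 1 there, which covers \<open>u\<close>; the summand 1
    keeps \<open>C1\<close> positive.\<close>
  define C1 where "C1 = (\<bar>M\<bar> + 1) / \<beta>"
  have C1: "C1 > 0" "C1 * \<beta> = \<bar>M\<bar> + 1" using \<beta> by (auto simp: C1_def)
  have us: "supersol (K 1) (\<lambda>x. - u x)" "continuous_on (K 1) (\<lambda>x. - u x)"
    using u by (auto simp: solution_def intro: continuous_intros)
  \<comment> \<open>The gradient term enters \<open>A \<bullet> Hb x\<close> with a minus sign and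
    makes it negative, so -C1 b is a strict subsolution to be placed below -u.\<close>
  have main: "(- C1) * b x \<le> - u x" if x: "x \<in> D" for x
  proof (rule comparison[OF _ _ _ _ C2_scale[OF C2_subset[OF bC]] _ _ x])
    show "open D" unfolding D_def by (rule open_zone)
    show "bounded D" using DK K_bounded bounded_subset by blast
    show "supersol D (\<lambda>x. - u x)" "continuous_on D (\<lambda>x. - u x)"
      using us DK supersol_subset continuous_on_subset by blast+
    show "D \<subseteq> W" using DSh ShW by blast
  next
    fix x assume x: "x \<in> D"
    then have "x \<in> Sh" "w x < c" "x \<in> K 1" using DSh by (auto simp: D_def)
    then have "C + 1 \<le> 2 * k * (Gw x \<bullet> (A *v Gw x))" "\<bar>A \<bullet> H\<zeta> x\<bar> \<le> C" "A \<bullet> Hw x = 0"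
      using Gw_A_lower[OF c(1) c(2) k_def C(1)] C(2) L_w by auto
    moreover have "A \<bullet> Hb x = A \<bullet> H\<zeta> x - 2 * k * (Gw x \<bullet> (A *v Gw x)) + k * (2 * c - 2 * wt x) * (A \<bullet> Hw x)"
      unfolding Hb_def inner_add_right inner_scaleR_right inner_outer by (simp add: algebra_simps)
    ultimately have "A \<bullet> Hb x < 0" by simp
    then show "0 < A \<bullet> ((- C1) *\<^sub>R Hb x)" using C1 by (simp add: mult_pos_neg)
  next
    fix y and e :: real assume y: "y \<in> frontier D" and e: "0 < e"
    note z = zone_frontier[OF c(1) y[unfolded D_def]]
    have yC: "y \<in> CC" using z(1) Sh_CC by blast
    have w0: "0 \<le> w y" by (rule w_nonneg[OF yC])
    have "0 \<le> w y * (2 * c - w y)" using w0 z(2) by (intro mult_nonneg_nonneg) auto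
    then have kw: "0 \<le> k * (w y * (2 * c - w y))" using k by simp
    show "\<exists>d>0. \<forall>x\<in>D. dist x y < d \<longrightarrow> - e \<le> - u x - (- C1) * b x"
    proof (cases "y \<in> K 1")
      case True
      have "\<beta> \<le> b y"
      proof (cases "w y = c")
        case True
        then have "b y = \<zeta> y + k * c\<^sup>2" using b_eq[OF yC] by (simp add: power2_eq_square)
        then show ?thesis using \<zeta>_values(1)[of y] by (simp add: \<beta>_def)
      next
        case False
        then have "norm y = 1/4 \<or> norm y = 3/4" using z(3) True by auto
        then have "9/256 \<le> b y" using \<zeta>_values(2)[of y] kw b_eq[OF yC] by linarith
        then show ?thesis by (simp add: \<beta>_def)
      qed
      then have "C1 * \<beta> \<le> C1 * b y" using C1 by (intro mult_left_mono) auto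
      then have "0 \<le> - u y - (- C1) * b y" using C1 M[OF True] by simp
      then show ?thesis using DK True e K1_W
        by (intro frontier_bound[where T = "K 1"] continuous_intros us continuous_on_subset[OF C2_cont[OF bC]]) auto
    next
      case False
      then have "w y = 0" using z(3) by auto
      moreover have "norm y \<le> 3/4" using z(1) by (simp add: Sh_def)
      ultimately obtain d1 where d1: "d1 > 0" "\<forall>x\<in>K 1. dist x y < d1 \<longrightarrow> u x \<le> e / 2"
        using lat[of y "e/2"] yC e by auto
      have "b y \<ge> 0" using kw b_eq[OF yC] \<zeta>_values(1)[of y] by simp
      then have "\<exists>d>0. \<forall>x\<in>D. dist x y < d \<longrightarrow> - (e / 2) \<le> C1 * b x"
        using DSh ShW z(1) C1 e
        by (intro frontier_bound[where T = W] continuous_intros C2_cont[OF bC]) auto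
      then obtain d2 where d2: "d2 > 0" "\<forall>x\<in>D. dist x y < d2 \<longrightarrow> - (e / 2) \<le> C1 * b x" by blast
      have "- e \<le> - u x - (- C1) * b x" if "x \<in> D" "dist x y < min d1 d2" for x
      proof -
        have "u x \<le> e / 2" "- (e / 2) \<le> C1 * b x" using d1(2) d2(2) that DK by auto
        then show ?thesis by simp
      qed
      then show ?thesis using d1(1) d2(1) by (intro exI[of _ "min d1 d2"]) auto
    qed
  qed
  \<comment> \<open>On |x| = 1/2: where w < c, \<zeta> = 0 gives b <= 2 c k w; elsewhere w >= c
    turns the bound \<open>M\<close> into a multiple of \<open>w\<close>.\<close>
  define C' where "C' = max (C1 * k * (2 * c)) ((\<bar>M\<bar> + 1) / c)"
  have C': "C' > 0" using C1 k c by (simp add: C'_def less_max_iff_disj)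
  have "0 \<le> - u x - (- C') * w x" if x: "x \<in> K (1/2)" for x
  proof (rule minimum_principle_K[of "\<lambda>x. - u x - (- C') * w x" "1/2"])
    show "supersol (K 1) (\<lambda>x. - u x - (- C') * w x)" "continuous_on (K 1) (\<lambda>x. - u x - (- C') * w x)"
      using solution_sub_w[OF solution_uminus[OF u], of "- C'"] by (auto simp: solution_def)
  next
    fix x assume x: "x \<in> K 1" "norm x = 1/2"
    have xC: "x \<in> CC" using K_CC x by blast
    have w0: "0 \<le> w x" using w_nonneg xC by auto
    show "0 \<le> - u x - (- C') * w x"
    proof (cases "w x < c")
      case True
      then have "x \<in> D" using x by (simp add: D_def)
      have "b x \<le> k * (2 * c) * w x"
      proof -
        have "0 \<le> k * (w x * w x)" using k by simp
        then show ?thesis using b_eq[OF xC] \<zeta>_values(3)[OF x(2)] by (simp add: algebra_simps)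
      qed
      then have "C1 * b x \<le> C1 * (k * (2 * c) * w x)" using C1 by (intro mult_left_mono) auto
      moreover have "C1 * k * (2 * c) * w x \<le> C' * w x" using w0 by (intro mult_right_mono) (auto simp: C'_def)
      ultimately show ?thesis using main[OF \<open>x \<in> D\<close>] by (simp add: mult_ac)
    next
      case False
      have "\<bar>M\<bar> + 1 = (\<bar>M\<bar> + 1) / c * c" using c by simp
      also have "\<dots> \<le> C' * w x" using False c C' by (intro mult_mono) (auto simp: C'_def)
      finally show ?thesis using M[OF x(1)] by simp
    qed
  next
    fix z and e :: real assume z: "z \<in> CC \<union> {0}" "norm z \<le> 1/2" "w z = 0" "0 < e"
    then obtain d where d: "d > 0" "\<forall>x\<in>K 1. dist x z < d \<longrightarrow> u x \<le> e" using lat[of z e] by auto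
    have "- e \<le> - u x - (- C') * w x" if "x \<in> K 1" "dist x z < d" for x
    proof -
      have "0 \<le> C' * w x" using C' w_nonneg K_CC that by simp
      then show ?thesis using d(2) that by fastforce
    qed
    then show "\<exists>d>0. \<forall>x\<in>K 1. dist x z < d \<longrightarrow> - e \<le> - u x - (- C') * w x" using d(1) by blast
  qed (use x in auto)
  then show ?thesis using C' by (intro exI[of _ C']) auto
qed

end

section \<open>Oscillation decay of the quotient\<close>

context cone_problem
begin

lemma w_scale: "0 < r \<Longrightarrow> w (r *\<^sub>R x) = r powr \<kappa> * w x"
  by (rule homogeneous_ext_scale)

lemma solution_rescale:
  assumes "solution (K 1) v" "0 < r" "r \<le> 1" "0 < c"
  shows "solution (K 1) (\<lambda>x. c * v (r *\<^sub>R x))"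
proof (rule solution_scale_dilate[OF assms(1,2) _ assms(4)])
  fix x assume "x \<in> K 1"
  moreover have "K 1 \<subseteq> K (1 / r)" using assms by (intro K_mono) simp
  ultimately show "r *\<^sub>R x \<in> K 1" using K_scale[OF assms(2)] by auto
qed

lemma K1_nonempty: "\<exists>x. x \<in> K 1"
proof -
  obtain \<sigma> where "\<sigma> \<in> S" using S by (auto simp: sph_domain_def)
  then have "(1/2) *\<^sub>R \<sigma> \<in> K 1" unfolding trunc_cone_def by (intro CollectI exI[of _ "1/2"] exI[of _ \<sigma>]) auto
  then show ?thesis by blast
qed

text \<open>\<open>v\<close> and \<open>w - v\<close> are nonnegative solutions whose sum
  \<open>w\<close> is bounded below on a fixed ball. \<open>halving\<close> gives one of them a
  lower bound there, and \<open>lower_bound\<close> turns it into a multiple of \<open>w\<close>;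
  for \<open>w - v\<close> this is an upper bound on \<open>v\<close>.\<close>

lemma oscillation:
  "\<exists>\<delta>. 0 < \<delta> \<and> \<delta> < 1 \<and> (\<forall>v. solution (K 1) v \<and> (\<forall>x\<in>K 1. 0 \<le> v x \<and> v x \<le> w x) \<longrightarrow>
     (\<forall>x\<in>K (1/2). \<delta> * w x \<le> v x) \<or> (\<forall>x\<in>K (1/2). v x \<le> (1 - \<delta>) * w x))"
proof -
  obtain x0 where x0: "x0 \<in> K 1" using K1_nonempty by blast
  obtain e where e: "e > 0" "cball x0 e \<subseteq> K 1" using x0 K_open open_contains_cball by blast
  have \<Theta>: "\<Theta> > 0" using \<Theta>_ge by linarith
  define r where "r = e / \<Theta>"
  have r: "0 < r" "cball x0 (\<Theta> * r) \<subseteq> K 1" using e \<Theta> by (auto simp: r_def)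
  have "r \<le> \<Theta> * r" using r \<Theta>_ge by simp
  then have rK: "cball x0 r \<subseteq> K 1" using r(2) by (meson order_trans subset_cball)
  have "continuous_on (cball x0 r) w" using w_sol rK by (auto simp: solution_def intro: continuous_on_subset)
  from continuous_attains_inf[OF compact_cball _ this] r(1)
  obtain y where y: "y \<in> cball x0 r" "\<And>x. x \<in> cball x0 r \<Longrightarrow> w y \<le> w x" by auto
  define m where "m = w y"
  have m: "m > 0" using y(1) rK w_pos unfolding m_def by blast
  obtain \<delta>1 where \<delta>1: "\<delta>1 > 0" and H: "\<And>v1 v2. solution (K 1) v1 \<and> solution (K 1) v2 \<and> (\<forall>x\<in>K 1. 0 \<le> v1 x) \<and> (\<forall>x\<in>K 1. 0 \<le> v2 x) \<and>
     (\<forall>x\<in>cball x0 r. 1 \<le> v1 x + v2 x) \<Longrightarrow>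
     (\<forall>x\<in>ball x0 r. \<delta>1 \<le> v1 x) \<or> (\<forall>x\<in>ball x0 r. \<delta>1 \<le> v2 x)"
    using halving[OF r] by blast
  obtain \<delta>2 where \<delta>2: "\<delta>2 > 0" and L: "\<And>v x. solution (K 1) v \<and> (\<forall>x\<in>K 1. 0 \<le> v x) \<and> (\<forall>x\<in>ball x0 r \<inter> K 1. 1 \<le> v x) \<Longrightarrow>
     x\<in>K (1/2) \<Longrightarrow> \<delta>2 * w x \<le> v x"
    using lower_bound[OF x0 r(1)] by blast
  \<comment> \<open>\<open>m\<close> undoes the normalization of the sum to at least 1,
    \<open>\<delta>1\<close> and \<open>\<delta>2\<close> come from the two lemmas, and 1/2 keeps
    the constant below 1.\<close>
  define \<delta> where "\<delta> = min (m * \<delta>1 * \<delta>2) (1/2)"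
  have \<delta>: "0 < \<delta>" "\<delta> < 1" "\<delta> \<le> m * \<delta>1 * \<delta>2" using m \<delta>1 \<delta>2 by (auto simp: \<delta>_def)
  have low: "\<delta> * w x \<le> v x"
    if v: "solution (K 1) v" "\<forall>x\<in>K 1. 0 \<le> v x" and b: "\<forall>x\<in>ball x0 r. \<delta>1 \<le> 1 / m * v x" and x: "x \<in> K (1/2)" for v x
  proof -
    define c where "c = 1 / (m * \<delta>1)"
    have c: "c > 0" using m \<delta>1 by (simp add: c_def)
    have "solution (K 1) (\<lambda>x. c * v x)" using solution_rescale[OF v(1), of 1 c] c by simp
    moreover have "\<forall>x\<in>ball x0 r \<inter> K 1. 1 \<le> c * v x"
      using b m \<delta>1 by (auto simp: c_def field_simps)
    ultimately have "\<delta>2 * w x \<le> c * v x" using v(2) c x by (intro L) auto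
    then have "m * \<delta>1 * \<delta>2 * w x \<le> v x" using m \<delta>1 by (simp add: c_def field_simps)
    moreover have "\<delta> * w x \<le> m * \<delta>1 * \<delta>2 * w x"
      using \<delta>(3) w_pos[OF x] by (intro mult_right_mono) auto
    ultimately show ?thesis by linarith
  qed
  show ?thesis
  proof (intro exI[of _ \<delta>] conjI allI impI \<delta>(1,2); elim conjE)
    fix v assume v: "solution (K 1) v" and vb: "\<forall>x\<in>K 1. 0 \<le> v x \<and> v x \<le> w x"
    define v' where "v' = (\<lambda>x. - v x - (- 1) * w x)"
    have v': "solution (K 1) v'" unfolding v'_def by (rule solution_sub_w[OF solution_uminus[OF v]])
    have v'0: "\<forall>x\<in>K 1. 0 \<le> v' x" using vb by (simp add: v'_def)
    have im: "1 / m > 0" using m by simp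
    have "(\<forall>x\<in>ball x0 r. \<delta>1 \<le> 1 / m * v x) \<or> (\<forall>x\<in>ball x0 r. \<delta>1 \<le> 1 / m * v' x)"
    proof (rule H, intro conjI ballI)
      show "solution (K 1) (\<lambda>x. 1 / m * v x)" "solution (K 1) (\<lambda>x. 1 / m * v' x)"
        using solution_rescale[OF v, of 1 "1/m"] solution_rescale[OF v', of 1 "1/m"] im by auto
      fix x assume "x \<in> cball x0 r"
      then have "m \<le> w x" using y(2) by (simp add: m_def)
      then show "1 \<le> 1 / m * v x + 1 / m * v' x" using m by (simp add: v'_def field_simps)
    qed (use vb v'0 m in auto)
    then show "(\<forall>x\<in>K (1/2). \<delta> * w x \<le> v x) \<or> (\<forall>x\<in>K (1/2). v x \<le> (1 - \<delta>) * w x)"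
    proof
      assume "\<forall>x\<in>ball x0 r. \<delta>1 \<le> 1 / m * v x"
      then show ?thesis using low[OF v] vb by auto
    next
      assume "\<forall>x\<in>ball x0 r. \<delta>1 \<le> 1 / m * v' x"
      then have "\<delta> * w x \<le> v' x" if "x \<in> K (1/2)" for x using low[OF v' v'0] that by auto
      then show ?thesis by (auto simp: v'_def algebra_simps)
    qed
  qed
qed

text \<open>\<open>oscillation\<close> is iterated on dyadic cones: each halving of the radius cuts
  the fraction \<delta> off one end of the interval [a, b].\<close>

lemma ratio_decay:
  assumes v: "solution (K 1) v" and C: "0 < C" "\<And>x. x \<in> K 1 \<Longrightarrow> 0 \<le> v x \<and> v x \<le> C * w x" and e: "0 < e"
  shows "\<exists>r a b. 0 < r \<and> r \<le> 1 \<and> 0 \<le> b - a \<and> b - a \<le> e \<and> (\<forall>x\<in>K r. a * w x \<le> v x \<and> v x \<le> b * w x)"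
proof -
  obtain \<delta> where \<delta>: "0 < \<delta>" "\<delta> < 1" and O: "\<And>v. solution (K 1) v \<Longrightarrow> (\<forall>x\<in>K 1. 0 \<le> v x \<and> v x \<le> w x) \<Longrightarrow>
     (\<forall>x\<in>K (1/2). \<delta> * w x \<le> v x) \<or> (\<forall>x\<in>K (1/2). v x \<le> (1 - \<delta>) * w x)"
    using oscillation by blast
  have step: "\<exists>a b. 0 \<le> b - a \<and> b - a \<le> C * (1 - \<delta>) ^ k \<and> (\<forall>x\<in>K ((1/2) ^ k). a * w x \<le> v x \<and> v x \<le> b * w x)" for k
  proof (induction k)
    case 0
    then show ?case using C by (intro exI[of _ 0] exI[of _ C]) auto
  next
    case (Suc k)
    then obtain a b where ab: "0 \<le> b - a" "b - a \<le> C * (1 - \<delta>) ^ k"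
      "\<And>x. x \<in> K ((1/2) ^ k) \<Longrightarrow> a * w x \<le> v x \<and> v x \<le> b * w x" by auto
    define r where "r = (1/2 :: real) ^ k"
    have r: "0 < r" "r \<le> 1" by (auto simp: r_def power_le_one)
    have sub: "K ((1/2) ^ Suc k) \<subseteq> K ((1/2) ^ k)" by (intro K_mono) simp
    show ?case
    \<comment> \<open>An interval of length 0 cannot be normalized, but then nothing has to be
      improved.\<close>
    proof (cases "a = b")
      case True
      then show ?thesis using ab sub \<delta> C by (intro exI[of _ a]) auto
    next
      case False
      then have ba: "b - a > 0" using ab by simp
      have rp: "r powr \<kappa> > 0" using r by simp
      \<comment> \<open>The rescaled solution with [a, b] mapped to [0, 1]; since \<open>w\<close>
        has degree \<kappa>, the bounds on the smaller cone become 0 <= V <= w on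
        \<open>K 1\<close>.\<close>
      define V where "V = (\<lambda>x. 1 / (b - a) * (r powr (-\<kappa>) * v (r *\<^sub>R x) - a * w x))"
      have s1: "solution (K 1) (\<lambda>x. r powr (-\<kappa>) * v (r *\<^sub>R x))"
        by (rule solution_rescale[OF v r]) (use r in auto)
      have "solution (K 1) V"
        using solution_rescale[OF solution_sub_w[OF s1, of a], of 1 "1 / (b - a)"] ba by (simp add: V_def)
      moreover have V: "r powr (-\<kappa>) * v (r *\<^sub>R x) = a * w x + (b - a) * V x" for x
        using ba by (simp add: V_def)
      have vV: "v (r *\<^sub>R x) = r powr \<kappa> * (a * w x + (b - a) * V x)" for x
        using V[of x] r by (simp add: powr_minus field_simps)
      have bounds: "0 \<le> V x \<and> V x \<le> w x" if "x \<in> K 1" for x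
      proof -
        have "r *\<^sub>R x \<in> K ((1/2) ^ k)" using K_scale[OF r(1)] that r by (simp add: r_def)
        then have "a * (r powr \<kappa> * w x) \<le> r powr \<kappa> * (a * w x + (b - a) * V x)"
          "r powr \<kappa> * (a * w x + (b - a) * V x) \<le> b * (r powr \<kappa> * w x)"
          using ab(3)[of "r *\<^sub>R x"] w_scale[OF r(1)] vV by auto
        then have "r powr \<kappa> * (a * w x) \<le> r powr \<kappa> * (a * w x + (b - a) * V x)"
          "r powr \<kappa> * (a * w x + (b - a) * V x) \<le> r powr \<kappa> * (b * w x)" by (auto simp: mult_ac)
        then have "a * w x \<le> a * w x + (b - a) * V x" "a * w x + (b - a) * V x \<le> b * w x"
          using rp by (auto simp only: mult_le_cancel_left_pos)
        then have "0 \<le> (b - a) * V x" "(b - a) * V x \<le> (b - a) * w x" by (auto simp: algebra_simps)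
        then show ?thesis using ba by (auto simp: zero_le_mult_iff)
      qed
      ultimately have alt: "(\<forall>x\<in>K (1/2). \<delta> * w x \<le> V x) \<or> (\<forall>x\<in>K (1/2). V x \<le> (1 - \<delta>) * w x)"
        using O by blast
      have conv: "\<exists>y\<in>K (1/2). x = r *\<^sub>R y" if "x \<in> K ((1/2) ^ Suc k)" for x
      proof
        show "x = r *\<^sub>R (x /\<^sub>R r)" using r by simp
        have "r *\<^sub>R (x /\<^sub>R r) \<in> K ((1/2) ^ Suc k)" using that r by simp
        then show "x /\<^sub>R r \<in> K (1/2)" using K_scale[OF r(1), of "x /\<^sub>R r"] r by (simp add: r_def)
      qed
      have ba_le: "\<delta> * (b - a) \<le> b - a" using ba \<delta> by (intro mult_left_le_one_le) auto
      have dec: "(b - a) * (1 - \<delta>) \<le> C * (1 - \<delta>) ^ Suc k"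
        using mult_right_mono[OF ab(2), of "1 - \<delta>"] \<delta> by (simp add: mult_ac)
      from alt show ?thesis
      proof
        assume V': "\<forall>x\<in>K (1/2). \<delta> * w x \<le> V x"
        show ?thesis
        proof (rule exI[of _ "a + \<delta> * (b - a)"], rule exI[of _ b], intro conjI ballI)
          show "0 \<le> b - (a + \<delta> * (b - a))"
            using ba_le by linarith
          show "b - (a + \<delta> * (b - a)) \<le> C * (1 - \<delta>) ^ Suc k" using dec by (simp add: algebra_simps)
          fix x assume x: "x \<in> K ((1/2) ^ Suc k)"
          then show "v x \<le> b * w x" using ab(3) sub by blast
          obtain y where y: "y \<in> K (1/2)" "x = r *\<^sub>R y" using conv[OF x] by blast
          have "(b - a) * (\<delta> * w y) \<le> (b - a) * V y" using V' y(1) ba by (intro mult_left_mono) auto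
          then have "r powr \<kappa> * ((a + \<delta> * (b - a)) * w y) \<le> r powr \<kappa> * (a * w y + (b - a) * V y)"
            using rp by (intro mult_left_mono) (auto simp: algebra_simps)
          then show "(a + \<delta> * (b - a)) * w x \<le> v x"
            using vV[of y] w_scale[OF r(1), of y] y(2) by (simp add: mult_ac)
        qed
      next
        assume V': "\<forall>x\<in>K (1/2). V x \<le> (1 - \<delta>) * w x"
        show ?thesis
        proof (rule exI[of _ a], rule exI[of _ "b - \<delta> * (b - a)"], intro conjI ballI)
          show "0 \<le> b - \<delta> * (b - a) - a"
            using ba_le by linarith
          show "b - \<delta> * (b - a) - a \<le> C * (1 - \<delta>) ^ Suc k" using dec by (simp add: algebra_simps)
          fix x assume x: "x \<in> K ((1/2) ^ Suc k)"
          then show "a * w x \<le> v x" using ab(3) sub by blast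
          obtain y where y: "y \<in> K (1/2)" "x = r *\<^sub>R y" using conv[OF x] by blast
          have "(b - a) * V y \<le> (b - a) * ((1 - \<delta>) * w y)" using V' y(1) ba by (intro mult_left_mono) auto
          then have "r powr \<kappa> * (a * w y + (b - a) * V y) \<le> r powr \<kappa> * ((b - \<delta> * (b - a)) * w y)"
            using rp by (intro mult_left_mono) (auto simp: algebra_simps)
          then show "v x \<le> (b - \<delta> * (b - a)) * w x"
            using vV[of y] w_scale[OF r(1), of y] y(2) by (simp add: mult_ac)
        qed
      qed
    qed
  qed
  have "(\<lambda>k. C * (1 - \<delta>) ^ k) \<longlonglongrightarrow> C * 0"
    by (intro tendsto_mult_left LIMSEQ_power_zero) (use \<delta> in auto)
  then have "(\<lambda>k. C * (1 - \<delta>) ^ k) \<longlonglongrightarrow> 0" by simp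
  from order_tendstoD(2)[OF this e] obtain k where k: "C * (1 - \<delta>) ^ k < e"
    by (auto simp: eventually_sequentially)
  obtain a b where "0 \<le> b - a" "b - a \<le> C * (1 - \<delta>) ^ k"
    "\<forall>x\<in>K ((1/2) ^ k). a * w x \<le> v x \<and> v x \<le> b * w x" using step[of k] by blast
  then show ?thesis using k by (intro exI[of _ "(1/2) ^ k"] exI[of _ a] exI[of _ b]) (auto simp: power_le_one)
qed

section \<open>Two-sided bounds by the homogeneous solution and the blow-up limit\<close>

lemma zero_of_w:
  assumes "z \<in> CC \<union> {0}" "w z = 0" "norm z < 1"
  shows "z \<in> lateral_boundary S"
proof (cases "z = 0")
  case True
  \<comment> \<open>The vertex is in \<open>lateral_boundary S\<close> only as 0 times a boundary
    point, so \<open>S\<close> must have one.\<close>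
  obtain \<sigma> where "\<sigma> \<in> sph_boundary S" using sph_boundary_nonempty by blast
  then show ?thesis using True unfolding lateral_boundary_def by (intro CollectI exI[of _ 0] exI[of _ \<sigma>]) auto
next
  case False
  then have "z /\<^sub>R norm z \<in> closure S" using assms by (auto simp: CC_def sph_closure_S)
  moreover have "z /\<^sub>R norm z \<notin> S"
    using assms False w_pos[of z 1] by (auto simp: mem_K)
  ultimately have "z /\<^sub>R norm z \<in> sph_boundary S" by (simp add: sph_boundary_S)
  then show ?thesis using False assms
    unfolding lateral_boundary_def by (intro CollectI exI[of _ "norm z"] exI[of _ "z /\<^sub>R norm z"]) auto
qed

text \<open>\<open>a0\<close> is fixed before \<open>e\<close>: otherwise both bounds could tend to
  0 and leave the quotient of \<open>u\<close> by its supremum undetermined. The cone is shrunk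
  twice by a factor 2, once because \<open>u\<close> may be unbounded near |x| = 1, once because
  \<open>upper_bound\<close> reaches only \<open>K (1/2)\<close>.\<close>

lemma asymptotics:
  assumes u: "solution (K 1) u" "\<And>x. x \<in> K 1 \<Longrightarrow> 0 \<le> u x" "\<exists>x\<in>K 1. u x \<noteq> 0"
    and cont: "continuous_on (K 1 \<union> lateral_boundary S) u"
    and u0: "\<And>x. x \<in> lateral_boundary S \<Longrightarrow> u x = 0"
  shows "\<exists>a0>0. \<forall>e>0. \<exists>r a b. 0 < r \<and> r \<le> 1 \<and> a0 \<le> a \<and> a \<le> b \<and> b - a \<le> e \<and>
    (\<forall>x\<in>K r. a * w x \<le> u x \<and> u x \<le> b * w x)"
proof -
  have "closure (K (1/2)) \<subseteq> K 1 \<union> lateral_boundary S"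
  proof
    fix x assume "x \<in> closure (K (1/2))"
    from closure_K[OF this] show "x \<in> K 1 \<union> lateral_boundary S"
      using zero_of_w[of x] w_eq_0[of x] by (cases "x = 0") (auto simp: mem_K CC_def)
  qed
  then have "continuous_on (closure (K (1/2))) u" using cont continuous_on_subset by blast
  moreover have "compact (closure (K (1/2)))" using K_bounded by (simp add: compact_closure)
  ultimately have "bounded (u ` closure (K (1/2)))" using compact_continuous_image compact_imp_bounded by blast
  then obtain M where M: "\<And>x. x \<in> K (1/2) \<Longrightarrow> u x \<le> M"
    unfolding bounded_iff using closure_subset[of "K (1/2)"] by (auto simp: abs_le_iff subset_iff)
  have half: "(1/2) *\<^sub>R x \<in> K t \<longleftrightarrow> x \<in> K (2 * t)" for x t using K_scale[of "1/2" x t] by (simp add: mult.commute)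
  define u1 where "u1 = (\<lambda>x. 1 * u ((1/2) *\<^sub>R x))"
  have u1: "solution (K 1) u1" unfolding u1_def by (rule solution_rescale[OF u(1)]) auto
  have "\<exists>C>0. \<forall>x\<in>K (1/2). u1 x \<le> C * w x"
  proof (rule upper_bound[OF u1])
    show "u1 x \<le> M" if "x \<in> K 1" for x using M half[of x "1/2"] that by (simp add: u1_def)
    fix z and e :: real assume z: "z \<in> CC \<union> {0}" "norm z \<le> 3/4" "w z = 0" "0 < e"
    define z' where "z' = (1/2) *\<^sub>R z"
    have "w z' = 0" using w_scale[of "1/2" z] z by (simp add: z'_def)
    moreover have "z' \<in> CC \<union> {0}" using z(1) by (auto simp: CC_def z'_def inverse_eq_divide)
    ultimately have zl: "z' \<in> lateral_boundary S" using z by (intro zero_of_w) (auto simp: z'_def)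
    have "\<exists>d>0. \<forall>x\<in>K 1. dist x z' < d \<longrightarrow> - e \<le> - u x"
      by (rule frontier_bound[where T = "K 1 \<union> lateral_boundary S"])
        (use cont zl u0 z(4) in \<open>auto intro: continuous_intros\<close>)
    then obtain d where d: "d > 0" "\<forall>x\<in>K 1. dist x z' < d \<longrightarrow> - e \<le> - u x" by blast
    have "u1 x \<le> e" if "x \<in> K 1" "dist x z < d" for x
    proof -
      have "(1/2) *\<^sub>R x \<in> K 1" using that half[of x 1] K_mono[of 1 2] by auto
      moreover have "dist ((1/2) *\<^sub>R x) z' = dist x z / 2" by (simp add: z'_def dist_norm flip: scaleR_diff_right)
      moreover have "dist x z / 2 < d" using that(2) zero_le_dist[of x z] by linarith
      ultimately have "- e \<le> - u ((1/2) *\<^sub>R x)" using d(2) by metis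
      then show ?thesis by (simp add: u1_def)
    qed
    then show "\<exists>d>0. \<forall>x\<in>K 1. dist x z < d \<longrightarrow> u1 x \<le> e" using d(1) by blast
  qed
  then obtain C where C: "C > 0" "\<And>x. x \<in> K (1/2) \<Longrightarrow> u1 x \<le> C * w x" by blast
  \<comment> \<open>w (x / 4) = p w x, so division by \<open>p\<close> keeps \<open>w\<close> as the
    reference function for the rescaled solution.\<close>
  define p where "p = (1/4 :: real) powr \<kappa>"
  have p: "p > 0" by (simp add: p_def)
  define v where "v = (\<lambda>x. 1 / p * u ((1/4) *\<^sub>R x))"
  have v: "solution (K 1) v" unfolding v_def by (rule solution_rescale[OF u(1)]) (use p in auto)
  have quarter: "(1/4) *\<^sub>R x \<in> K t \<longleftrightarrow> x \<in> K (4 * t)" for x t using K_scale[of "1/4" x t] by (simp add: mult.commute)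
  have v0: "0 \<le> v x" if "x \<in> K 1" for x
    using that u(2) quarter[of x 1] K_mono[of 1 4] p by (auto simp: v_def)
  have vC: "v x \<le> (C / p) * w x" if "x \<in> K 1" for x
  proof -
    have "u1 ((1/2) *\<^sub>R x) \<le> C * w ((1/2) *\<^sub>R x)" using C(2) half[of x "1/2"] that by simp
    also have "w ((1/2) *\<^sub>R x) \<le> w x"
      using w_scale[of "1/2" x] w_pos[OF that] \<kappa> powr_mono2[of \<kappa> "1/2" 1] by (simp add: mult_left_le_one_le)
    finally have "u ((1/4) *\<^sub>R x) \<le> C * w x" using C(1) by (simp add: u1_def)
    then show ?thesis using p by (simp add: v_def divide_right_mono)
  qed
  \<comment> \<open>\<open>u\<close> is positive somewhere, perhaps far from the vertex;
    \<open>propagation\<close> carries this to y / 4, which makes \<open>v\<close> positive at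
    \<open>y\<close>.\<close>
  obtain x1 where x1: "x1 \<in> K 1" "u x1 > 0" using u(2,3) by (metis less_eq_real_def)
  have uc: "continuous_on (K 1) u" using u(1) by (auto simp: solution_def)
  have ballge: "\<exists>r>0. \<forall>x\<in>ball z r \<inter> K 1. f z / 2 \<le> f x" if "continuous_on (K 1) f" "z \<in> K 1" "f z > 0" for f :: "real^'n \<Rightarrow> real" and z
  proof -
    from that obtain d where d: "d > 0" "\<forall>x\<in>K 1. dist x z < d \<longrightarrow> dist (f x) (f z) < f z / 2"
      unfolding continuous_on_iff by (meson half_gt_zero)
    have "f z / 2 \<le> f x" if "x \<in> ball z d \<inter> K 1" for x
    proof -
      have "dist (f x) (f z) < f z / 2" using d(2) that by (auto simp: dist_commute)
      then show ?thesis unfolding dist_real_def by linarith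
    qed
    then show ?thesis using d(1) by blast
  qed
  obtain r1 where r1: "r1 > 0" "\<forall>x\<in>ball x1 r1 \<inter> K 1. u x1 / 2 \<le> u x" using ballge[OF uc x1] by blast
  obtain y where y: "y \<in> K 1" using K1_nonempty by blast
  have y4: "(1/4) *\<^sub>R y \<in> K 1" using quarter[of y 1] K_mono[of 1 4] y by auto
  have "u ((1/4) *\<^sub>R y) > 0"
  proof -
    obtain \<delta> where \<delta>: "\<delta> > 0" "\<And>v. supersol (K 1) v \<and> continuous_on (K 1) v \<and> (\<forall>x\<in>K 1. 0 \<le> v x) \<and>
       (\<forall>x\<in>ball x1 r1 \<inter> K 1. 1 \<le> v x) \<Longrightarrow> (\<forall>x\<in>{(1/4) *\<^sub>R y}. \<delta> \<le> v x)"
      using propagation[OF K_open K_connected x1(1) r1(1), of "{(1/4) *\<^sub>R y}"] y4 by auto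
    define c where "c = 2 / u x1"
    have c: "c > 0" using x1 by (simp add: c_def)
    have "solution (K 1) (\<lambda>x. c * u x)" using solution_rescale[OF u(1), of 1 c] c by simp
    moreover have "\<forall>x\<in>ball x1 r1 \<inter> K 1. 1 \<le> c * u x" using r1(2) x1(2) by (auto simp: c_def field_simps)
    ultimately have "\<delta> \<le> c * u ((1/4) *\<^sub>R y)" using \<delta>(2)[of "\<lambda>x. c * u x"] u(2) c by (auto simp: solution_def)
    then show ?thesis using \<delta>(1) c by (smt (verit) mult_nonneg_nonpos)
  qed
  then have "v y > 0" using p by (simp add: v_def)
  have vc: "continuous_on (K 1) v" using v by (simp add: solution_def)
  obtain r2 where r2: "r2 > 0" "\<forall>x\<in>ball y r2 \<inter> K 1. v y / 2 \<le> v x" using ballge[OF vc y \<open>v y > 0\<close>] by blast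
  obtain \<delta> where \<delta>: "\<delta> > 0" "\<And>v. solution (K 1) v \<and> (\<forall>x\<in>K 1. 0 \<le> v x) \<and> (\<forall>x\<in>ball y r2 \<inter> K 1. 1 \<le> v x) \<Longrightarrow>
     (\<forall>x\<in>K (1/2). \<delta> * w x \<le> v x)"
    using lower_bound[OF y r2(1)] by blast
  define c where "c = 2 / v y"
  have c: "c > 0" using \<open>v y > 0\<close> by (simp add: c_def)
  have "solution (K 1) (\<lambda>x. c * v x)" using solution_rescale[OF v, of 1 c] c by simp
  moreover have "\<forall>x\<in>ball y r2 \<inter> K 1. 1 \<le> c * v x" using r2(2) \<open>v y > 0\<close> by (auto simp: c_def field_simps)
  ultimately have "\<forall>x\<in>K (1/2). \<delta> * w x \<le> c * v x" using \<delta>(2)[of "\<lambda>x. c * v x"] v0 c by auto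
  then have low: "\<delta> / c * w x \<le> v x" if "x \<in> K (1/2)" for x using that c by (auto simp: field_simps)
  define a0 where "a0 = \<delta> / c"
  have a0: "a0 > 0" using \<delta>(1) c by (simp add: a0_def)
  show ?thesis
  proof (rule exI[of _ a0], intro conjI a0 allI impI)
    fix e :: real assume e: "e > 0"
    have "C / p > 0" using C p by simp
    from ratio_decay[OF v this _ e] v0 vC obtain r a b where r: "0 < r" "r \<le> 1"
      and ab: "0 \<le> b - a" "b - a \<le> e" "\<And>x. x \<in> K r \<Longrightarrow> a * w x \<le> v x \<and> v x \<le> b * w x" by blast
    define r' where "r' = min r (1/2) / 4"
    have r': "0 < r'" "r' \<le> 1" using r by (auto simp: r'_def)
    \<comment> \<open>\<open>ratio_decay\<close> does not bound \<open>a\<close> away from 0;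
      raising it to \<open>a0\<close> is allowed because both give lower bounds, and it only
      shortens the interval.\<close>
    have bnd: "max a a0 * w x \<le> u x \<and> u x \<le> b * w x" if x: "x \<in> K r'" for x
    proof -
      have "(1/4) *\<^sub>R (4 *\<^sub>R x) \<in> K r'" using x by simp
      then have "4 *\<^sub>R x \<in> K (min r (1/2))" using quarter[of "4 *\<^sub>R x" r'] by (simp add: r'_def)
      then have xr: "4 *\<^sub>R x \<in> K r" "4 *\<^sub>R x \<in> K (1/2)"
        using K_mono[OF min.cobounded1[of r "1/2"]] K_mono[OF min.cobounded2[of r "1/2"]] by blast+
      have vx: "v (4 *\<^sub>R x) = 1 / p * u x" by (simp add: v_def)
      have "w x = p * w (4 *\<^sub>R x)" using w_scale[of "1/4" "4 *\<^sub>R x"] by (simp add: p_def)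
      then have wx: "w (4 *\<^sub>R x) = 1 / p * w x" using p by simp
      have "a * (1 / p * w x) \<le> 1 / p * u x" "1 / p * u x \<le> b * (1 / p * w x)" "a0 * (1 / p * w x) \<le> 1 / p * u x"
        using ab(3)[OF xr(1)] low[OF xr(2)] by (auto simp: vx wx a0_def)
      then have "a * w x \<le> u x" "u x \<le> b * w x" "a0 * w x \<le> u x" using p by (auto simp: divide_le_cancel)
      then show ?thesis by (simp add: max_def)
    qed
    obtain z where z: "z \<in> K 1" using K1_nonempty by blast
    have "r' *\<^sub>R z \<in> K r'" using K_scale[OF r'(1), of z r'] r' z by simp
    then have "max a a0 * w (r' *\<^sub>R z) \<le> b * w (r' *\<^sub>R z)" "0 < w (r' *\<^sub>R z)"
      using bnd[of "r' *\<^sub>R z"] w_pos[of "r' *\<^sub>R z" r'] by linarith+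
    then have le: "max a a0 \<le> b" using mult_le_cancel_right_pos by blast
    show "\<exists>r a b. 0 < r \<and> r \<le> 1 \<and> a0 \<le> a \<and> a \<le> b \<and> b - a \<le> e \<and> (\<forall>x\<in>K r. a * w x \<le> u x \<and> u x \<le> b * w x)"
      by (rule exI[of _ r'], rule exI[of _ "max a a0"], rule exI[of _ b])
        (use r' bnd ab le in auto)
  qed
qed

text \<open>The supremum of \<open>w\<close> over \<open>K R\<close> is R^\<kappa>: the maximum 1 of
  \<phi> is attained in \<open>S\<close>, since \<phi> vanishes on the boundary. The value
  R^\<kappa> is only approached, along that ray as s tends to R.\<close>

lemma sup_cone_bounds:
  assumes R: "0 < R" "R \<le> 1" and u: "\<And>x. x \<in> K R \<Longrightarrow> a * w x \<le> u x \<and> u x \<le> b * w x" and ab: "0 \<le> a" "a \<le> b"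
  shows "a * R powr \<kappa> \<le> sup_cone S u R" "sup_cone S u R \<le> b * R powr \<kappa>"
proof -
  have KR: "trunc_cone S 1 \<inter> ball 0 R = K R" using R by (auto simp: mem_K)
  have ub: "u x \<le> b * R powr \<kappa>" if x: "x \<in> K R" for x
  proof -
    have "w x \<le> norm x powr \<kappa>" by (rule w_le[OF K_CC[OF x]])
    also have "\<dots> \<le> R powr \<kappa>" using x \<kappa> by (intro powr_mono2) (auto simp: mem_K)
    finally have "b * w x \<le> b * R powr \<kappa>" using ab by (intro mult_left_mono) auto
    then show ?thesis using u[OF x] by linarith
  qed
  obtain z where z: "z \<in> K 1" using K1_nonempty by blast
  then have "R *\<^sub>R z \<in> K R" using K_scale[OF R(1), of z R] R by simp
  then show "sup_cone S u R \<le> b * R powr \<kappa>"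
    unfolding sup_cone_def KR using ub by (intro cSUP_least) auto
  obtain \<sigma> where \<sigma>: "\<sigma> \<in> closure S" "\<phi> \<sigma> = 1" using \<phi>_1 sph_closure_S by auto
  then have \<sigma>S: "\<sigma> \<in> S" using \<phi>0 sph_boundary_S by (metis DiffI zero_neq_one)
  have "a * s powr \<kappa> \<le> sup_cone S u R" if s: "0 < s" "s < R" for s
  proof -
    have n\<sigma>: "norm \<sigma> = 1" using \<sigma>S S_sphere by auto
    have sK: "s *\<^sub>R \<sigma> \<in> K R" using s \<sigma>S unfolding trunc_cone_def by blast
    have "w (s *\<^sub>R \<sigma>) = s powr \<kappa>" using s n\<sigma> \<sigma> by (simp add: homogeneous_ext_def)
    then have "a * s powr \<kappa> \<le> u (s *\<^sub>R \<sigma>)" using u[OF sK] by simp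
    also have "\<dots> \<le> sup_cone S u R"
      unfolding sup_cone_def KR using sK ub by (intro cSUP_upper bdd_aboveI2) auto
    finally show ?thesis .
  qed
  then have "eventually (\<lambda>s. a * s powr \<kappa> \<le> sup_cone S u R) (at_left R)"
    unfolding eventually_at_left_field using R(1) by blast
  moreover have "((\<lambda>s. a * s powr \<kappa>) \<longlongrightarrow> a * R powr \<kappa>) (at_left R)"
    using R(1) by (intro tendsto_intros) auto
  ultimately show "a * R powr \<kappa> \<le> sup_cone S u R"
    by (intro tendsto_upperbound[where F = "at_left R"]) auto
qed

text \<open>Both u(R x) and M(R) w(x) lie between a R^\<kappa> w(x) and b R^\<kappa> w(x), and M(R)
  is at least a0 R^\<kappa>, so the error is at most (b - a) / a0. This is uniform on the whole
  cone, as w <= 1 there.\<close>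

lemma blowup_converges:
  assumes u: "solution (K 1) u" "\<And>x. x \<in> K 1 \<Longrightarrow> 0 \<le> u x" "\<exists>x\<in>K 1. u x \<noteq> 0"
    and cont: "continuous_on (K 1 \<union> lateral_boundary S) u"
    and u0: "\<And>x. x \<in> lateral_boundary S \<Longrightarrow> u x = 0"
    and R: "\<And>k. 0 < R k" "R \<longlonglongrightarrow> 0"
  shows "uniform_limit (K 1) (\<lambda>j x. u (R j *\<^sub>R x) / sup_cone S u (R j)) w sequentially"
  unfolding uniform_limit_iff
proof (intro allI impI)
  fix e :: real assume e: "e > 0"
  obtain a0 where a0: "a0 > 0" and as: "\<And>e. e > 0 \<Longrightarrow> \<exists>r a b. 0 < r \<and> r \<le> 1 \<and> a0 \<le> a \<and> a \<le> b \<and> b - a \<le> e \<and>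
    (\<forall>x\<in>K r. a * w x \<le> u x \<and> u x \<le> b * w x)"
    using asymptotics[OF u cont u0] by blast
  have "e * a0 / 2 > 0" using e a0 by simp
  from as[OF this] obtain r a b where r: "0 < r" "r \<le> 1" and ab: "a0 \<le> a" "a \<le> b" "b - a \<le> e * a0 / 2"
    and ur: "\<And>x. x \<in> K r \<Longrightarrow> a * w x \<le> u x \<and> u x \<le> b * w x" by blast
  have a: "a > 0" "b > 0" using a0 ab by auto
  have "\<forall>\<^sub>F n in sequentially. R n < r" using order_tendstoD(2)[OF R(2) r(1)] .
  then show "\<forall>\<^sub>F n in sequentially. \<forall>x\<in>K 1. dist (u (R n *\<^sub>R x) / sup_cone S u (R n)) (w x) < e"
  proof (rule eventually_mono, intro ballI)
    fix n x assume Rn: "R n < r" and x: "x \<in> K 1"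
    define \<rho> where "\<rho> = R n"
    have \<rho>: "0 < \<rho>" "\<rho> \<le> 1" using R(1) Rn r by (auto simp: \<rho>_def less_imp_le)
    have KK: "K \<rho> \<subseteq> K r" using Rn by (intro K_mono) (simp add: \<rho>_def)
    define m where "m = sup_cone S u \<rho>"
    have m: "a * \<rho> powr \<kappa> \<le> m" "m \<le> b * \<rho> powr \<kappa>"
      unfolding m_def using sup_cone_bounds[OF \<rho>, of a u b] ur KK a ab by auto
    have pp: "\<rho> powr \<kappa> > 0" using \<rho> by simp
    have m0: "m > 0" using m(1) a pp by (smt (verit) mult_pos_pos)
    have "\<rho> *\<^sub>R x \<in> K r" using K_scale[OF \<rho>(1), of x \<rho>] \<rho> x KK by auto
    from ur[OF this] have ux: "a * (\<rho> powr \<kappa> * w x) \<le> u (\<rho> *\<^sub>R x)" "u (\<rho> *\<^sub>R x) \<le> b * (\<rho> powr \<kappa> * w x)"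
      using w_scale[OF \<rho>(1)] by auto
    have w01: "0 \<le> w x" "w x \<le> 1" using w_pos[OF x] w_le_1[OF K_CC[OF x]] x by (auto simp: mem_K)
    have "\<bar>u (\<rho> *\<^sub>R x) - m * w x\<bar> \<le> (b - a) * \<rho> powr \<kappa> * w x"
    proof -
      have "a * \<rho> powr \<kappa> * w x \<le> m * w x" "m * w x \<le> b * \<rho> powr \<kappa> * w x"
        using m w01 by (auto intro: mult_right_mono)
      then show ?thesis using ux by (simp add: algebra_simps abs_le_iff)
    qed
    also have "\<dots> \<le> (e * a0 / 2) * \<rho> powr \<kappa> * 1"
      using ab w01 pp e a0 by (intro mult_mono) auto
    also have "\<dots> \<le> (e / 2) * m"
    proof -
      have "a0 * \<rho> powr \<kappa> \<le> a * \<rho> powr \<kappa>" using ab pp by (intro mult_right_mono) auto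
      then have "a0 * \<rho> powr \<kappa> \<le> m" using m(1) by linarith
      then have "(e / 2) * (a0 * \<rho> powr \<kappa>) \<le> (e / 2) * m" using e by (intro mult_left_mono) auto
      then show ?thesis by simp
    qed
    also have "\<dots> < e * m" using e m0 by simp
    finally have "\<bar>u (\<rho> *\<^sub>R x) - m * w x\<bar> < e * m" .
    moreover have "u (\<rho> *\<^sub>R x) / m - w x = (u (\<rho> *\<^sub>R x) - m * w x) / m" using m0 by (simp add: field_simps)
    ultimately have "\<bar>u (\<rho> *\<^sub>R x) / m - w x\<bar> < e" using m0 by (simp add: abs_divide pos_divide_less_eq)
    then show "dist (u (R n *\<^sub>R x) / sup_cone S u (R n)) (w x) < e" by (simp add: dist_real_def \<rho>_def m_def)
  qed
qed

end

section \<open>The operator is linear\<close>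

lemma sym_matrices_closed:
  shows "M \<in> sym_matrices \<Longrightarrow> N \<in> sym_matrices \<Longrightarrow> M + N \<in> sym_matrices"
    and "M \<in> sym_matrices \<Longrightarrow> c *\<^sub>R M \<in> sym_matrices"
    and "0 \<in> sym_matrices"
    and "X + transpose X \<in> sym_matrices"
  by (auto simp: sym_matrices_def transpose_def vec_eq_iff add.commute)

lemma linear_operator:
  fixes F :: "real^'n^'n \<Rightarrow> real"
  assumes concave: "concave_on sym_matrices F" and ell: "uniformly_elliptic F"
    and hom: "homogeneous_degree_one F"
  obtains A l where "A \<in> sym_matrices" "0 < l" "\<And>x. l * (norm x)\<^sup>2 \<le> x \<bullet> (A *v x)"
    "\<And>M. M \<in> sym_matrices \<Longrightarrow> F M = A \<bullet> M"
proof -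
  note cl = sym_matrices_closed
  have h: "F (t *\<^sub>R M) = t * F M" if "M \<in> sym_matrices" for t M
    using hom that by (simp add: homogeneous_degree_one_def)
  have super: "F M + F N \<le> F (M + N)" if MN: "M \<in> sym_matrices" "N \<in> sym_matrices" for M N
  proof -
    \<comment> \<open>Concavity at the midpoint of 2 M and 2 N, combined with homogeneity.\<close>
    have "- F ((1 - 1/2) *\<^sub>R (2 *\<^sub>R M) + (1/2) *\<^sub>R (2 *\<^sub>R N)) \<le>
      (1 - 1/2) * (- F (2 *\<^sub>R M)) + (1/2) * (- F (2 *\<^sub>R N))"
      using concave unfolding concave_on_def
      by (rule convex_onD) (use MN cl in auto)
    then show ?thesis using h MN by simp
  qed
  have add: "F (M + N) = F M + F N" if MN: "M \<in> sym_matrices" "N \<in> sym_matrices" for M N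
  proof -
    \<comment> \<open>Superadditivity at -M and -N; oddness turns it into the reverse
      inequality.\<close>
    have "F ((-1) *\<^sub>R M) + F ((-1) *\<^sub>R N) \<le> F ((-1) *\<^sub>R M + (-1) *\<^sub>R N)"
      by (intro super cl MN)
    also have "(-1) *\<^sub>R M + (-1) *\<^sub>R N = (-1) *\<^sub>R (M + N)" by simp
    finally show ?thesis
      using super[OF MN] h[OF MN(1), of "-1"] h[OF MN(2), of "-1"] h[OF cl(1)[OF MN], of "-1"] by simp
  qed
  \<comment> \<open>Precomposition with the symmetric part gives a linear functional on all
    matrices, which has a representing matrix; invariance under transposition makes that matrix
    symmetric.\<close>
  define f where "f = (\<lambda>X. F ((1/2) *\<^sub>R (X + transpose X)))"
  have tr_add: "transpose (X + Y) = transpose X + transpose Y"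
    and tr_scale: "transpose (c *\<^sub>R X) = c *\<^sub>R transpose X" for X Y :: "real^'n^'n" and c
    by (auto simp: transpose_def vec_eq_iff)
  have lin: "linear f"
  proof (rule linearI)
    show "f (X + Y) = f X + f Y" for X Y
    proof -
      have "(1/2) *\<^sub>R ((X + Y) + transpose (X + Y)) = (1/2) *\<^sub>R (X + transpose X) + (1/2) *\<^sub>R (Y + transpose Y)"
        by (simp add: tr_add algebra_simps)
      then show ?thesis unfolding f_def using add cl by metis
    qed
    show "f (c *\<^sub>R X) = c *\<^sub>R f X" for c X
    proof -
      have "(1/2) *\<^sub>R (c *\<^sub>R X + transpose (c *\<^sub>R X)) = c *\<^sub>R ((1/2) *\<^sub>R (X + transpose X))"
        by (simp add: tr_scale algebra_simps)
      then show ?thesis unfolding f_def using h[OF cl(2)[OF cl(4)], of c "1/2" X] by simp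
    qed
  qed
  define A where "A = adjoint f 1"
  have A: "f X = A \<bullet> X" for X
    using adjoint_works[OF lin, of X 1] by (simp add: A_def inner_commute)
  have "transpose A \<bullet> X = A \<bullet> X" for X
  proof -
    have "transpose A \<bullet> X = A \<bullet> transpose X"
      unfolding inner_matrix_sum transpose_def by (subst sum.swap) simp
    also have "\<dots> = A \<bullet> X" unfolding A[symmetric] f_def by (simp add: add.commute)
    finally show ?thesis .
  qed
  then have "transpose A = A" using vector_eq_rdot[of "transpose A" A] by blast
  then have A_sym: "A \<in> sym_matrices" by (simp add: sym_matrices_def)
  have F: "F M = A \<bullet> M" if "M \<in> sym_matrices" for M
  proof -
    have "(1/2) *\<^sub>R (M + transpose M) = M"
      using that scaleR_half_double[of M] by (simp add: sym_matrices_def)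
    then show ?thesis using A[of M] by (simp add: f_def)
  qed
  from ell obtain l where l: "0 < l" "\<And>M N. M \<in> sym_matrices \<Longrightarrow> N \<in> sym_matrices \<Longrightarrow> nonneg_matrix N \<Longrightarrow>
     l * onorm ((*v) N) \<le> F (M + N) - F M"
    unfolding uniformly_elliptic_def by metis
  have "l * (norm x)\<^sup>2 \<le> x \<bullet> (A *v x)" for x
  proof -
    \<comment> \<open>Ellipticity is tested on the rank-one matrix x x^T, on which the operator is x
      . A x and whose norm is at least |x|^2.\<close>
    have "nonneg_matrix (outer x x)"
      by (simp add: nonneg_matrix_def outer_mult_vec inner_commute)
    from l(2)[OF cl(3) outer_in_sym this] have "l * onorm ((*v) (outer x x)) \<le> F (outer x x) - F 0" by simp
    also have "\<dots> = x \<bullet> (A *v x)" by (simp add: F cl inner_outer)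
    finally have 1: "l * onorm ((*v) (outer x x)) \<le> x \<bullet> (A *v x)" .
    have "norm (outer x x *v x) \<le> onorm ((*v) (outer x x)) * norm x"
      by (rule onorm[OF matrix_vector_mul_bounded_linear])
    then have "(norm x)\<^sup>2 * norm x \<le> onorm ((*v) (outer x x)) * norm x"
      by (simp add: outer_mult_vec dot_square_norm)
    then have "(norm x)\<^sup>2 \<le> onorm ((*v) (outer x x))"
      by (cases "x = 0") (auto simp: onorm_pos_le)
    then have "l * (norm x)\<^sup>2 \<le> l * onorm ((*v) (outer x x))" using l(1) by (intro mult_left_mono) auto
    with 1 show ?thesis by linarith
  qed
  then show thesis using that A_sym l(1) F by blast
qed

text \<open>A \<open>C2\<close> test function is admissible for \<open>Ck_on 2\<close>, and its
  \<open>hessian\<close> is the symmetric matrix \<open>H\<close>, on which the operator is given by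
  \<open>A\<close>. For the second half the test function is negated.\<close>

lemma (in elliptic) viscosity_solution_imp_solution:
  assumes F: "\<And>M. M \<in> sym_matrices \<Longrightarrow> F M = A \<bullet> M" and u: "viscosity_solution F \<Omega> u"
  shows "solution \<Omega> u"
proof -
  have "supersol \<Omega> u"
    unfolding supersol_def
  proof (intro allI impI, elim conjE)
    fix x0 U \<psi> G H
    assume U: "open U" "x0 \<in> U" "U \<subseteq> \<Omega>" "C2 U \<psi> G H" "\<forall>x\<in>U. u x0 - \<psi> x0 \<le> u x - \<psi> x"
    have "F (hessian \<psi> x0) \<le> 0"
      using u U C2_imp_Ck_on[OF U(4)] unfolding viscosity_solution_def viscosity_supersolution_def by blast
    then show "A \<bullet> H x0 \<le> 0"
      using C2_hessian[OF U(4,1,2)] C2_hessian_sym[OF U(4,1,2)] F by simp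
  qed
  moreover have "supersol \<Omega> (\<lambda>x. - u x)"
    unfolding supersol_def
  proof (intro allI impI, elim conjE)
    fix x0 U \<psi> G H
    assume U: "open U" "x0 \<in> U" "U \<subseteq> \<Omega>" "C2 U \<psi> G H" "\<forall>x\<in>U. - u x0 - \<psi> x0 \<le> - u x - \<psi> x"
    have C: "C2 U (\<lambda>x. (-1) * \<psi> x) (\<lambda>x. (-1) *\<^sub>R G x) (\<lambda>x. (-1) *\<^sub>R H x)" by (rule C2_scale[OF U(4)])
    have "\<forall>x\<in>U. u x - (-1) * \<psi> x \<le> u x0 - (-1) * \<psi> x0" using U(5) by auto
    then have "0 \<le> F (hessian (\<lambda>x. (-1) * \<psi> x) x0)"
      using u U(1-3) C2_imp_Ck_on[OF C] unfolding viscosity_solution_def viscosity_subsolution_def by blast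
    also have "\<dots> = A \<bullet> ((-1) *\<^sub>R H x0)"
      using C2_hessian[OF C U(1,2)] C2_hessian_sym[OF C U(1,2)] F by metis
    finally show "A \<bullet> H x0 \<le> 0" by simp
  qed
  ultimately show ?thesis using u by (simp add: solution_def viscosity_solution_def)
qed

theorem theorem6p3:
  fixes F :: "real^'n^'n \<Rightarrow> real"
    and S :: "(real^'n) set"
    and \<kappa> :: real
    and \<phi> u :: "real^'n \<Rightarrow> real"
    and R :: "nat \<Rightarrow> real"
  assumes "2 \<le> CARD('n)"
    and "concave_on sym_matrices F"
    and "uniformly_elliptic F"
    and "smooth_on sym_matrices (sym_matrices - {0}) F"
    and "homogeneous_degree_one F"
    and "F 0 = 0"
    and "sph_domain S"
    and "smooth_sph_boundary S"
    and "0 < \<kappa>"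
    and "smooth_up_to (sph_closure S) \<phi>"
    and "viscosity_solution F (trunc_cone S 1) (homogeneous_ext \<kappa> \<phi>)"
    and "\<forall>\<sigma>\<in>sph_boundary S. \<phi> \<sigma> = 0"
    and "\<forall>\<sigma>\<in>S. 0 < \<phi> \<sigma>"
    and "(\<forall>\<sigma>\<in>sph_closure S. \<phi> \<sigma> \<le> 1) \<and> (\<exists>\<sigma>\<in>sph_closure S. \<phi> \<sigma> = 1)"
    and "\<forall>x\<in>trunc_cone S 1. 0 \<le> u x"
    and "\<exists>x\<in>trunc_cone S 1. u x \<noteq> 0"
    and "viscosity_solution F (trunc_cone S 1) u"
    and "continuous_on (trunc_cone S 1 \<union> lateral_boundary S) u"
    and "\<forall>x\<in>lateral_boundary S. u x = 0"
    and "\<forall>k. 0 < R k"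
    and "decseq R"
    and "R \<longlonglongrightarrow> 0"
  shows "\<exists>s :: nat \<Rightarrow> nat. strict_mono s \<and>
           converges_locally_uniformly_on (trunc_cone S 1)
             (\<lambda>j x. u (R (s j) *\<^sub>R x) / sup_cone S u (R (s j)))
             (homogeneous_ext \<kappa> \<phi>)"
proof -
  obtain A l where A: "A \<in> sym_matrices" "0 < l" "\<And>x. l * (norm x)\<^sup>2 \<le> x \<bullet> (A *v x)"
    and F: "\<And>M. M \<in> sym_matrices \<Longrightarrow> F M = A \<bullet> M"
    using linear_operator[OF assms(2,3,5)] by blast
  interpret elliptic A l by unfold_locales (use A assms(1) in auto)
  obtain U g where U: "open U" "sph_closure S \<subseteq> U" "smooth_on UNIV U g" "\<forall>x\<in>sph_closure S. g x = \<phi> x"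
    using assms(10) unfolding smooth_up_to_def by blast
  obtain Gg Hg where "C2 U g Gg Hg" using U(3) Ck_on_imp_C2[of U g] unfolding smooth_on_def by blast
  then obtain Gw Hw where w: "C2 {x. x \<noteq> 0 \<and> x /\<^sub>R norm x \<in> U} (homogeneous_ext \<kappa> g) Gw Hw"
    using C2_homogeneous_ext[of U g Gg Hg \<kappa>] by blast
  \<comment> \<open>The extension across the lateral boundary is the homogeneous extension of
    \<open>g\<close>, which is smooth near the closure of \<open>S\<close> and equals \<phi> on
    it.\<close>
  interpret cone_problem A l S \<kappa> \<phi> "{x. x \<noteq> 0 \<and> x /\<^sub>R norm x \<in> U}" "homogeneous_ext \<kappa> g" Gw Hw
  proof
    show "solution (trunc_cone S 1) (homogeneous_ext \<kappa> \<phi>)"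
      by (rule viscosity_solution_imp_solution[OF F assms(11)])
    show "open {x. x \<noteq> 0 \<and> x /\<^sub>R norm x \<in> U}" by (rule open_cone_over[OF U(1)])
  qed (use assms U w in \<open>auto simp: homogeneous_ext_def\<close>)
  have "solution (trunc_cone S 1) u" by (rule viscosity_solution_imp_solution[OF F assms(17)])
  then have "uniform_limit (trunc_cone S 1) (\<lambda>j x. u (R j *\<^sub>R x) / sup_cone S u (R j))
      (homogeneous_ext \<kappa> \<phi>) sequentially"
    using assms by (intro blowup_converges) auto
  then have "converges_locally_uniformly_on (trunc_cone S 1)
      (\<lambda>j x. u (R j *\<^sub>R x) / sup_cone S u (R j)) (homogeneous_ext \<kappa> \<phi>)"
    unfolding converges_locally_uniformly_on_def by (auto intro: uniform_limit_on_subset)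
  then show ?thesis by (intro exI[of _ "\<lambda>j. j"]) (auto simp: strict_mono_def)
qed

end
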